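(* Let $d\ge 2$, $\theta\ge 0$, $c>0$, $T>0$, and let $g:\Gamma\to(0,1)$ and $\rho_0:\overline U\to[0,1]$ satisfy assumptions (A1), (A2), (A3) listed in the context. Let $\rho$ be the solution on $[0,T]\times\overline U$ of the hydrodynamic equation corresponding to $\theta$ (Dirichlet if $\theta\in[0,1)$, Robin if $\theta=1$, Neumann if $\theta>1$), and let $\nu^n_t$ be the product measure on $\Omega_n$ with density $\rho(t,m_n(x))$ at each site $x\in U_n$. For each $n$ let $\mu^n$ be a probability measure on $\Omega_n$, and let $\mu^n_t$ be the law at time $t$ of the Markov process with generator $n^2L_n$ started from $\mu^n$. Assume that $$H(\mu^n|\nu^n_0)=o(n^d)\quad\text{as } n\to\infty.$$ Then for every $t\in[0,T]$, $$H(\mu^n_t|\nu^n_t)=o(n^d)\quad\text{as } n\to\infty.$$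
   Context: **Sets.** $U=(0,1)^d$, $\overline U=[0,1]^d$, $\Gamma=\overline U\setminus U$. For $1\le i\le d$, $\Gamma^{i,+}=\{r\in\Gamma: r_i=0\}$ and $\Gamma^{i,-}=\{r\in\Gamma: r_i=1\}$. For $n\in\mathbb N$, $U_n=\{x\in\mathbb Z^d: 0<x_i<n\ \forall i\}$ and $\Gamma_n=\{x\in U_n: \exists i,\ x_i=1 \text{ or } x_i=n-1\}$. $|z|=\sum_i|z_i|$. For $u\in U$, $[u]$ is a point of $\Gamma$ at minimal distance from $u$ (any choice if there are several). **Dynamics.** $\Omega_n=\{0,1\}^{U_n}$. The generator is $L_n=L_{b,n}+L_{p,n}$, where $$(L_{b,n}f)(\eta)=\sum_{\{x,y\}\subset U_n,\ |x-y|=1}\{f(\sigma^{x,y}\eta)-f(\eta)\}$$ (each unordered nearest-neighbour pair counted once), $\sigma^{x,y}\eta$ being $\eta$ with the values at $x$ and $y$ exchanged, and $$(L_{p,n}f)(\eta)=cn^{-\theta}\sum_{z\in\Gamma_n}\big[g([z/n])(1-\eta(z))+(1-g([z/n]))\eta(z)\big]\,[f(\sigma^z\eta)-f(\eta)],$$ $\sigma^z\eta$ being $\eta$ with the value at $z$ replaced by $1-\eta(z)$. **Hydrodynamic equations.** In all cases $\partial_t\rho=\Delta\rho$ on $U$ and $\rho(0,\cdot)=\rho_0$. The boundary conditions are: - $\theta\in[0,1)$ (Dirichlet): $\rho(t,u)=g(u)$ for $u\in\Gamma$. - $\theta=1$ (Robin): for every $1\le i\le d$, $\partial^+_{u_i}\rho(t,u)=c(\rho(t,u)-g(u))$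 for $u\in\Gamma^{i,+}$ and $\partial^-_{u_i}\rho(t,u)=c(g(u)-\rho(t,u))$ for $u\in\Gamma^{i,-}$. - $\theta>1$ (Neumann): for every $1\le i\le d$, $\partial^{\pm}_{u_i}\rho(t,u)=0$ for $u\in\Gamma^{i,\pm}$. Here $\partial^{\pm}_{u_i}$ are the one-sided (right/left) partial derivatives. "Solution" means the unique classical solution, smooth on $[0,T]\times\overline U$ (derivatives at boundary points being one-sided). **Assumptions.** (A1) $\rho_0\in C^\infty(\overline U)$, and there are an open set $V\subset\mathbb R^d$ containing $\Gamma$ and an extension of $g$ to $V$ that is smooth on $V$. (A2) There is $\varepsilon_0\in(0,1/2)$ such that $\rho_0$ and $g$ take values in $(\varepsilon_0,1-\varepsilon_0)$. (A3) Compatibility at $t=0$: if $\theta\in[0,1)$, $\rho_0=g$ on $\Gamma$; if $\theta=1$, $\partial^\pm_{u_i}\rho_0(u)=\pm c(\rho_0(u)-g(u))$ for all $u\in\Gamma^{i,\pm}$, $1\le i\le d$; if $\theta>1$, $\partial^\pm_{u_i}\rho_0(u)=0$ for all $u\in\Gamma^{i,\pm}$, $1\le i\le d$. **The map $m_n$ and the reference measure.** If $\theta\ge1$, $m_n(x)=x/n$ for $x\in U_n$. If $\theta\in[0,1)$, for $n$ large enough that $2c^{-1}n^{\theta-1}<1$, $m_n:U_n\to U$ acts coordinatewise: $$\big(m_n(x)\big)_i=c^{-1}n^{\theta-1}+(x_i-1)\,\frac{1-2c^{-1}n^{\theta-1}}{n-2},\qquad 1\le i\le d.$$ Thus coordinate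 values $1$ and $n-1$ are sent to distance $c^{-1}n^{\theta-1}$ from $0$ and $1$ respectively, with equal spacing in between. The reference measure is $$\nu^n_t(\eta)=\prod_{x\in U_n}\big\{\eta(x)\rho(t,m_n(x))+(1-\eta(x))(1-\rho(t,m_n(x)))\big\}.$$ **Relative entropy.** $H(\mu|\pi)=\int \frac{d\mu}{d\pi}\log\frac{d\mu}{d\pi}\,d\pi$ for $\mu\ll\pi$. *)

theory Defs
  imports "HOL-Probability.Probability"
begin

section \<open>The cube and its discretisation\<close>

definition cube :: "(real ^ 'd::finite) set" where
  "cube = {u. \<forall>i. 0 < u $ i \<and> u $ i < 1}"

definition closed_cube :: "(real ^ 'd::finite) set" where
  "closed_cube = {u. \<forall>i. 0 \<le> u $ i \<and> u $ i \<le> 1}"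

definition cube_boundary :: "(real ^ 'd::finite) set" where
  "cube_boundary = closed_cube - cube"

definition face_plus :: "'d \<Rightarrow> (real ^ 'd::finite) set" where
  "face_plus i = {r \<in> cube_boundary. r $ i = 0}"

definition face_minus :: "'d \<Rightarrow> (real ^ 'd::finite) set" where
  "face_minus i = {r \<in> cube_boundary. r $ i = 1}"

definition nearest_boundary_point :: "(real ^ 'd::finite \<Rightarrow> real ^ 'd) \<Rightarrow> bool" where
  "nearest_boundary_point p \<longleftrightarrow>
     (\<forall>u \<in> cube. p u \<in> cube_boundary \<and> (\<forall>v \<in> cube_boundary. dist u (p u) \<le> dist u v))"

definition sites :: "nat \<Rightarrow> (int ^ 'd::finite) set" where
  "sites n = {x. \<forall>i. 0 < x $ i \<and> x $ i < int n}"

definition boundary_sites :: "nat \<Rightarrow> (int ^ 'd::finite) set" where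
  "boundary_sites n = {x \<in> sites n. \<exists>i. x $ i = 1 \<or> x $ i = int n - 1}"

definition l1_norm :: "int ^ 'd::finite \<Rightarrow> int" where
  "l1_norm z = (\<Sum>i \<in> UNIV. \<bar>z $ i\<bar>)"

definition rescale :: "nat \<Rightarrow> int ^ 'd::finite \<Rightarrow> real ^ 'd" where
  "rescale n x = (\<chi> i. real_of_int (x $ i) / real n)"


section \<open>Dynamics\<close>

type_synonym 'd config = "int ^ 'd \<Rightarrow> nat"

definition configs :: "nat \<Rightarrow> 'd::finite config set" where
  "configs n = sites n \<rightarrow>\<^sub>E {0, 1}"

definition exchange :: "int ^ 'd \<Rightarrow> int ^ 'd \<Rightarrow> 'd::finite config \<Rightarrow> 'd config" where
  "exchange x y \<eta> = \<eta>(x := \<eta> y, y := \<eta> x)"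

definition flip :: "int ^ 'd \<Rightarrow> 'd::finite config \<Rightarrow> 'd config" where
  "flip z \<eta> = \<eta>(z := 1 - \<eta> z)"

(* The sum runs over ordered pairs, so each unordered bond occurs twice; hence the factor 1/2. *)
definition bulk_gen :: "nat \<Rightarrow> ('d::finite config \<Rightarrow> real) \<Rightarrow> 'd config \<Rightarrow> real" where
  "bulk_gen n f \<eta> =
     (1 / 2) * (\<Sum>(x, y) \<in> {(x, y). x \<in> sites n \<and> y \<in> sites n \<and> l1_norm (x - y) = 1}.
                  f (exchange x y \<eta>) - f \<eta>)"

definition boundary_gen ::
  "real \<Rightarrow> real \<Rightarrow> (real ^ 'd \<Rightarrow> real) \<Rightarrow> (real ^ 'd \<Rightarrow> real ^ 'd) \<Rightarrow> nat \<Rightarrow>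
   ('d::finite config \<Rightarrow> real) \<Rightarrow> 'd config \<Rightarrow> real" where
  "boundary_gen \<theta> c g p n f \<eta> =
     c * real n powr (- \<theta>) *
     (\<Sum>z \<in> boundary_sites n.
        (g (p (rescale n z)) * (1 - real (\<eta> z)) + (1 - g (p (rescale n z))) * real (\<eta> z))
        * (f (flip z \<eta>) - f \<eta>))"

definition generator ::
  "real \<Rightarrow> real \<Rightarrow> (real ^ 'd \<Rightarrow> real) \<Rightarrow> (real ^ 'd \<Rightarrow> real ^ 'd) \<Rightarrow> nat \<Rightarrow>
   ('d::finite config \<Rightarrow> real) \<Rightarrow> 'd config \<Rightarrow> real" where
  "generator \<theta> c g p n f \<eta> = bulk_gen n f \<eta> + boundary_gen \<theta> c g p n f \<eta>"


section \<open>Markov processes on a finite state space\<close>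

definition transition_function :: "'s set \<Rightarrow> (real \<Rightarrow> 's \<Rightarrow> 's pmf) \<Rightarrow> bool" where
  "transition_function S K \<longleftrightarrow>
     (\<forall>t \<ge> 0. \<forall>x \<in> S. set_pmf (K t x) \<subseteq> S) \<and>
     (\<forall>x \<in> S. K 0 x = return_pmf x) \<and>
     (\<forall>s \<ge> 0. \<forall>t \<ge> 0. \<forall>x \<in> S. K (s + t) x = bind_pmf (K s x) (K t))"

definition has_generator ::
  "'s set \<Rightarrow> (real \<Rightarrow> 's \<Rightarrow> 's pmf) \<Rightarrow> (('s \<Rightarrow> real) \<Rightarrow> 's \<Rightarrow> real) \<Rightarrow> bool" where
  "has_generator S K G \<longleftrightarrow>
     (\<forall>f. \<forall>x \<in> S.
        ((\<lambda>h. (measure_pmf.expectation (K h x) f - f x) / h) \<longlongrightarrow> G f x) (at_right 0))"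

(* The Markov property is stated in its elementary form for discrete state spaces: s is the
   present, the finite set J contains s and past times, and a is a prescribed history on J.
   The initial law is left free. *)
definition markov_process ::
  "'w measure \<Rightarrow> 's set \<Rightarrow> (real \<Rightarrow> 'w \<Rightarrow> 's) \<Rightarrow> (('s \<Rightarrow> real) \<Rightarrow> 's \<Rightarrow> real) \<Rightarrow> bool" where
  "markov_process M S X G \<longleftrightarrow>
     prob_space M \<and>
     (\<forall>t \<ge> 0. X t \<in> measurable M (count_space S)) \<and>
     (\<exists>K. transition_function S K \<and> has_generator S K G \<and>
        (\<forall>J s h. \<forall>a \<in> J \<rightarrow> S. \<forall>y \<in> S. finite J \<longrightarrow> J \<subseteq> {0..s} \<longrightarrow> s \<in> J \<longrightarrow> 0 \<le> h \<longrightarrow>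
           measure M {w \<in> space M. (\<forall>r \<in> J. X r w = a r) \<and> X (s + h) w = y} =
           measure M {w \<in> space M. \<forall>r \<in> J. X r w = a r} * pmf (K h (a s)) y))"


section \<open>Hydrodynamic equations\<close>

(* Derivatives are taken within S, so on a closed box with nonempty interior this means that
   partial derivatives of all orders exist up to the boundary (one-sided there).  Being
   coinductive, the rule can be unfolded arbitrarily often; D b is the partial derivative in
   direction b. *)
coinductive smooth_on :: "'a::euclidean_space set \<Rightarrow> ('a \<Rightarrow> real) \<Rightarrow> bool" for S where
  "\<lbrakk>\<forall>x \<in> S. (f has_derivative (\<lambda>v. \<Sum>b \<in> Basis. (v \<bullet> b) * D b x)) (at x within S);
    \<forall>b \<in> Basis. smooth_on S (D b)\<rbrakk> \<Longrightarrow> smooth_on S f"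

definition partial_deriv :: "'d \<Rightarrow> (real ^ 'd::finite \<Rightarrow> real) \<Rightarrow> real ^ 'd \<Rightarrow> real" where
  "partial_deriv i f u = deriv (\<lambda>h. f (u + h *\<^sub>R axis i 1)) 0"

definition laplacian :: "(real ^ 'd::finite \<Rightarrow> real) \<Rightarrow> real ^ 'd \<Rightarrow> real" where
  "laplacian f u = (\<Sum>i \<in> UNIV. partial_deriv i (partial_deriv i f) u)"

definition has_right_partial :: "'d \<Rightarrow> (real ^ 'd::finite \<Rightarrow> real) \<Rightarrow> real ^ 'd \<Rightarrow> real \<Rightarrow> bool" where
  "has_right_partial i f u D \<longleftrightarrow>
     ((\<lambda>h. f (u + h *\<^sub>R axis i 1)) has_real_derivative D) (at_right 0)"

definition has_left_partial :: "'d \<Rightarrow> (real ^ 'd::finite \<Rightarrow> real) \<Rightarrow> real ^ 'd \<Rightarrow> real \<Rightarrow> bool" where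
  "has_left_partial i f u D \<longleftrightarrow>
     ((\<lambda>h. f (u + h *\<^sub>R axis i 1)) has_real_derivative D) (at_left 0)"

definition dirichlet_bc :: "(real ^ 'd::finite \<Rightarrow> real) \<Rightarrow> (real ^ 'd \<Rightarrow> real) \<Rightarrow> bool" where
  "dirichlet_bc g f \<longleftrightarrow> (\<forall>u \<in> cube_boundary. f u = g u)"

definition robin_bc :: "real \<Rightarrow> (real ^ 'd::finite \<Rightarrow> real) \<Rightarrow> (real ^ 'd \<Rightarrow> real) \<Rightarrow> bool" where
  "robin_bc c g f \<longleftrightarrow>
     (\<forall>i. (\<forall>u \<in> face_plus i. has_right_partial i f u (c * (f u - g u))) \<and>
          (\<forall>u \<in> face_minus i. has_left_partial i f u (c * (g u - f u))))"

definition neumann_bc :: "(real ^ 'd::finite \<Rightarrow> real) \<Rightarrow> bool" where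
  "neumann_bc f \<longleftrightarrow>
     (\<forall>i. (\<forall>u \<in> face_plus i. has_right_partial i f u 0) \<and>
          (\<forall>u \<in> face_minus i. has_left_partial i f u 0))"

(* Used both for the boundary conditions of the equation at each time and for the compatibility
   of the initial profile, which is the same condition at time 0. *)
definition boundary_condition ::
  "real \<Rightarrow> real \<Rightarrow> (real ^ 'd::finite \<Rightarrow> real) \<Rightarrow> (real ^ 'd \<Rightarrow> real) \<Rightarrow> bool" where
  "boundary_condition \<theta> c g f \<longleftrightarrow>
     (if \<theta> < 1 then dirichlet_bc g f else if \<theta> = 1 then robin_bc c g f else neumann_bc f)"

definition hydrodynamic_solution ::
  "real \<Rightarrow> real \<Rightarrow> (real ^ 'd \<Rightarrow> real) \<Rightarrow> (real ^ 'd \<Rightarrow> real) \<Rightarrow> real \<Rightarrow>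
   (real \<Rightarrow> real ^ 'd::finite \<Rightarrow> real) \<Rightarrow> bool" where
  "hydrodynamic_solution \<theta> c g \<rho>\<^sub>0 T \<rho> \<longleftrightarrow>
     smooth_on ({0..T} \<times> closed_cube) (\<lambda>(t, u). \<rho> t u) \<and>
     (\<forall>t \<in> {0..T}. \<forall>u \<in> cube.
        ((\<lambda>s. \<rho> s u) has_real_derivative laplacian (\<rho> t) u) (at t within {0..T})) \<and>
     (\<forall>u \<in> closed_cube. \<rho> 0 u = \<rho>\<^sub>0 u) \<and>
     (\<forall>t \<in> {0..T}. boundary_condition \<theta> c g (\<rho> t))"


section \<open>Reference measure and relative entropy\<close>

(* For \<theta> < 1 the map takes values in the cube only for n large enough that
   2 n^(\<theta>-1) / c < 1; for smaller n its values are irrelevant. *)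
definition site_map :: "real \<Rightarrow> real \<Rightarrow> nat \<Rightarrow> int ^ 'd::finite \<Rightarrow> real ^ 'd" where
  "site_map \<theta> c n x =
     (if 1 \<le> \<theta> then rescale n x
      else (\<chi> i. real n powr (\<theta> - 1) / c +
                 (real_of_int (x $ i) - 1) * ((1 - 2 * (real n powr (\<theta> - 1) / c)) / (real n - 2))))"

definition reference_measure ::
  "real \<Rightarrow> real \<Rightarrow> nat \<Rightarrow> (real ^ 'd::finite \<Rightarrow> real) \<Rightarrow> 'd config measure" where
  "reference_measure \<theta> c n r =
     point_measure (configs n)
       (\<lambda>\<eta>. ennreal (\<Prod>x \<in> sites n. real (\<eta> x) * r (site_map \<theta> c n x)
                                      + (1 - real (\<eta> x)) * (1 - r (site_map \<theta> c n x))))"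

(* H(\<mu> | \<pi>) with the usual value \<infinity> when \<mu> is not absolutely continuous w.r.t. \<pi>.
   Note that KL_divergence takes the reference measure first. *)
definition rel_entropy :: "'a measure \<Rightarrow> 'a measure \<Rightarrow> ereal" where
  "rel_entropy \<mu> \<pi> =
     (if absolutely_continuous \<pi> \<mu> then ereal (KL_divergence (exp 1) \<pi> \<mu>) else \<infinity>)"

end

theory Submission
  imports Defs "HOL-Real_Asymp.Real_Asymp"
begin

text \<open>
  Write \<open>f\<close> for the density of the law at time \<open>t\<close> with respect to the reference product measure and
  \<open>\<omega>\<^sub>x = (\<eta>\<^sub>x - \<rho>\<^sub>x) / (\<rho>\<^sub>x (1 - \<rho>\<^sub>x))\<close>. The inequality \<open>a (ln b - ln a) \<le> (b - a) - (\<surd>b - \<surd>a)\<^sup>2\<close> bounds the time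
  derivative of the relative entropy by minus the Dirichlet energy of \<open>\<surd>f\<close> plus the expectation of
  terms linear and quadratic in the \<open>\<omega>\<^sub>x\<close>. By the hydrodynamic equation and its boundary conditions the
  coefficients of the linear terms are negligible, except at the boundary when \<open>\<theta> < 1\<close>, where the energy of
  the reservoirs absorbs them. The quadratic terms are \<open>- n\<^sup>2 (\<rho>\<^sub>x - \<rho>\<^sub>y)\<^sup>2 \<omega>\<^sub>x \<omega>\<^sub>y\<close> over the bonds. Replacing
  \<open>\<omega>\<^sub>x \<omega>\<^sub>y\<close> by the square of an average over a line of \<open>\<l>\<close> sites costs no more than the bulk energy up
  to errors of order \<open>n\<^sup>d / \<l>\<close>, and the square comes with the favourable sign. Hence the entropy grows
  by \<open>o(n\<^sup>d)\<close>, without any Gronwall argument.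
\<close>

section \<open>Entropy production of a single jump\<close>

text \<open>The obstacle is the boundary: its roughly n^(d-1) sites carry linear terms with
  coefficients up to order n, so bounding \<open>\<omega>\<close> by a constant only gives order
  n^d. For \<theta> < 1 the reservoirs act at rate of order n^(2-\<theta>), and Young's inequality
  against their energy leaves n^2 / n^(2-\<theta>) = n^\<theta> per site. For \<theta> \<ge> 1 the
  flux condition cancels the order n at sites with a single extreme coordinate. Where two
  coordinates are extreme, one reservoir term faces several normal fluxes and the bound stays at
  order n, but there are only about n^(d-2) such sites; this is where d \<ge> 2 enters. The length
  \<l> stays fixed while n tends to infinity and is sent to infinity afterwards: for fixed \<l> the
  cost of moving particles along lines, apart from the energy, is of order n^(d-1). The bounds
  \<epsilon> \<le> \<rho> \<le> 1 - \<epsilon>, on which \<open>\<omega>\<close> and every constant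
  depend, are not part of the notion of solution and come from a maximum principle. The differential
  inequality is proved for strictly positive laws and extended to all laws by continuity at fixed
  n.\<close>

lemma abs_diff_squares:
  fixes p q :: real assumes "0 \<le> p" "0 \<le> q"
  shows "\<bar>p\<^sup>2 - q\<^sup>2\<bar> = \<bar>q - p\<bar> * (p + q)"
proof -
  have "p\<^sup>2 - q\<^sup>2 = - ((q - p) * (p + q))" by (simp add: power2_eq_square algebra_simps)
  then show ?thesis using assms by (simp add: abs_mult)
qed

text \<open>Applied with \<open>p\<close> and \<open>q\<close> square roots of the density at two
  configurations. The difference of squares factors, and Young's inequality splits the product into
  a piece of Dirichlet energy and a piece whose total mass is bounded.\<close>

lemma young_diff_squares:
  fixes p q :: real assumes \<beta>: "0 < \<beta>"
  shows "Y * (\<bar>q - p\<bar> * (p + q)) \<le> \<beta> * (q - p)\<^sup>2 + Y\<^sup>2 * (p\<^sup>2 + q\<^sup>2) / (2 * \<beta>)"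
proof -
  define u v where "u = \<bar>q - p\<bar>" and "v = p + q"
  have "v\<^sup>2 \<le> 2 * (p\<^sup>2 + q\<^sup>2)"
    using sum_squares_bound[of p q] by (simp add: v_def power2_sum)
  then have "Y\<^sup>2 * v\<^sup>2 \<le> Y\<^sup>2 * (2 * (p\<^sup>2 + q\<^sup>2))" by (intro mult_left_mono) auto
  moreover have "4 * \<beta> * (Y * (u * v)) \<le> 4 * \<beta>\<^sup>2 * u\<^sup>2 + Y\<^sup>2 * v\<^sup>2"
    using sum_squares_bound[of "2 * \<beta> * u" "Y * v"] by (simp add: power_mult_distrib mult_ac)
  ultimately have "4 * \<beta> * (Y * (u * v)) \<le> 4 * \<beta>\<^sup>2 * u\<^sup>2 + Y\<^sup>2 * (2 * (p\<^sup>2 + q\<^sup>2))" by linarith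
  also have "\<dots> = 4 * \<beta> * (\<beta> * u\<^sup>2 + Y\<^sup>2 * (p\<^sup>2 + q\<^sup>2) / (2 * \<beta>))"
    using \<beta> by (simp add: field_simps power2_eq_square)
  finally show ?thesis using \<beta> by (simp add: u_def v_def)
qed

section \<open>Bernoulli weights and densities with respect to them\<close>

definition bernoulli_weight :: "'a set \<Rightarrow> ('a \<Rightarrow> real) \<Rightarrow> ('a \<Rightarrow> nat) \<Rightarrow> real" where
  "bernoulli_weight S r \<eta> = (\<Prod>x \<in> S. real (\<eta> x) * r x + (1 - real (\<eta> x)) * (1 - r x))"

lemma config_cases: "\<eta> \<in> S \<rightarrow>\<^sub>E {0, 1 :: nat} \<Longrightarrow> x \<in> S \<Longrightarrow> \<eta> x = 0 \<or> \<eta> x = 1"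
  by (auto simp: PiE_iff)

lemma bernoulli_weight_pos:
  assumes "\<eta> \<in> S \<rightarrow>\<^sub>E {0, 1 :: nat}" "\<And>x. x \<in> S \<Longrightarrow> 0 < r x \<and> r x < (1 :: real)"
  shows "0 < bernoulli_weight S r \<eta>"
  unfolding bernoulli_weight_def
proof (rule prod_pos)
  fix x assume x: "x \<in> S"
  then show "0 < real (\<eta> x) * r x + (1 - real (\<eta> x)) * (1 - r x)"
    using config_cases[OF assms(1) x] assms(2)[OF x] by auto
qed

lemma bernoulli_weight_sum:
  assumes "finite S" shows "(\<Sum>\<eta> \<in> S \<rightarrow>\<^sub>E {0, 1 :: nat}. bernoulli_weight S r \<eta>) = 1"
  unfolding bernoulli_weight_def
  by (subst prod_sum_PiE[of S "\<lambda>_. {0, 1}" "\<lambda>x k. real k * r x + (1 - real k) * (1 - r x)", symmetric])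
    (auto simp: assms)

text \<open>Time is frozen: \<open>r\<close> stands for the profile and \<open>m\<close> for the law
  at one instant. Strict positivity of \<open>m\<close> makes the logarithm of the density finite;
  \<open>\<epsilon>\<close> keeps the reference weights away from degeneracy.\<close>

locale bernoulli_density =
  fixes S :: "(int ^ 'd::finite) set" and r :: "int ^ 'd \<Rightarrow> real" and \<epsilon> :: real
    and m :: "'d config \<Rightarrow> real"
  assumes finite_S: "finite S" and \<epsilon>_pos: "0 < \<epsilon>"
    and r_ge: "\<And>x. x \<in> S \<Longrightarrow> \<epsilon> \<le> r x" and r_le: "\<And>x. x \<in> S \<Longrightarrow> r x \<le> 1 - \<epsilon>"
    and m_positive: "\<And>\<eta>. \<eta> \<in> S \<rightarrow>\<^sub>E {0, 1} \<Longrightarrow> 0 < m \<eta>"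
    and m_mass: "(\<Sum>\<eta> \<in> S \<rightarrow>\<^sub>E {0, 1}. m \<eta>) = 1"
begin

definition \<Omega> :: "'d config set" where "\<Omega> = S \<rightarrow>\<^sub>E {0, 1}"

lemma m_pos: "\<eta> \<in> \<Omega> \<Longrightarrow> 0 < m \<eta>" and m_sum: "(\<Sum>\<eta> \<in> \<Omega>. m \<eta>) = 1"
  using m_positive m_mass by (simp_all only: \<Omega>_def)

abbreviation \<nu> :: "'d config \<Rightarrow> real" where "\<nu> \<equiv> bernoulli_weight S r"

definition f :: "'d config \<Rightarrow> real" where "f \<eta> = m \<eta> / \<nu> \<eta>"

text \<open>\<open>\<omega> x\<close> is the derivative of the logarithm of the Bernoulli weight
  with respect to \<open>r x\<close>. Hence it has mean zero under the reference measure and appears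
  both in the adjoint of the dynamics and in the time derivative of the reference measure.\<close>

definition \<omega> :: "int ^ 'd \<Rightarrow> 'd config \<Rightarrow> real" where
  "\<omega> x \<eta> = (real (\<eta> x) - r x) / (r x * (1 - r x))"

definition E :: "('d config \<Rightarrow> real) \<Rightarrow> real" where "E \<phi> = (\<Sum>\<eta> \<in> \<Omega>. m \<eta> * \<phi> \<eta>)"

text \<open>The Dirichlet form of the square root of the density for the single jump
  \<open>\<tau>\<close> with rate \<open>k\<close>. The sum runs over all configurations, so both
  ends of a jump contribute.\<close>

definition energy :: "('d config \<Rightarrow> real) \<Rightarrow> ('d config \<Rightarrow> 'd config) \<Rightarrow> real" where
  "energy k \<tau> = (\<Sum>\<eta> \<in> \<Omega>. \<nu> \<eta> * k \<eta> * (sqrt (f (\<tau> \<eta>)) - sqrt (f \<eta>))\<^sup>2)"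

lemma value_cases:
  assumes "\<eta> \<in> \<Omega>" "x \<in> S" shows "\<eta> x = 0 \<or> \<eta> x = 1"
  using assms by (auto simp: PiE_iff \<Omega>_def)

lemma r_pos: "x \<in> S \<Longrightarrow> 0 < r x" and r_less: "x \<in> S \<Longrightarrow> r x < 1"
  using r_ge[of x] r_le[of x] \<epsilon>_pos by auto

lemma \<nu>_pos: "\<eta> \<in> \<Omega> \<Longrightarrow> 0 < \<nu> \<eta>"
  unfolding \<Omega>_def using r_pos r_less by (intro bernoulli_weight_pos) auto

lemma f_pos: "\<eta> \<in> \<Omega> \<Longrightarrow> 0 < f \<eta>"
  unfolding f_def using m_pos \<nu>_pos by simp

lemma \<nu>_f: "\<eta> \<in> \<Omega> \<Longrightarrow> \<nu> \<eta> * f \<eta> = m \<eta>"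
  using \<nu>_pos[of \<eta>] by (simp add: f_def)

lemma E_mono: "(\<And>\<eta>. \<eta> \<in> \<Omega> \<Longrightarrow> \<phi> \<eta> \<le> \<psi> \<eta>) \<Longrightarrow> E \<phi> \<le> E \<psi>"
  unfolding E_def by (intro sum_mono mult_left_mono) (auto intro: less_imp_le m_pos)

lemma E_cong: "(\<And>\<eta>. \<eta> \<in> \<Omega> \<Longrightarrow> \<phi> \<eta> = \<psi> \<eta>) \<Longrightarrow> E \<phi> = E \<psi>"
  unfolding E_def by (intro sum.cong) auto

lemma E_const: "E (\<lambda>_. a) = a"
  unfolding E_def by (simp flip: sum_distrib_right add: m_sum)

lemma E_add: "E (\<lambda>\<eta>. \<phi> \<eta> + \<psi> \<eta>) = E \<phi> + E \<psi>"
  unfolding E_def by (simp add: distrib_left sum.distrib)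

lemma E_diff: "E (\<lambda>\<eta>. \<phi> \<eta> - \<psi> \<eta>) = E \<phi> - E \<psi>"
  unfolding E_def by (simp add: right_diff_distrib sum_subtractf)

lemma E_cmult: "E (\<lambda>\<eta>. a * \<phi> \<eta>) = a * E \<phi>"
  unfolding E_def by (simp add: sum_distrib_left mult_ac)

lemma E_sum: "E (\<lambda>\<eta>. \<Sum>i \<in> I. \<phi> i \<eta>) = (\<Sum>i \<in> I. E (\<phi> i))"
  unfolding E_def by (simp add: sum_distrib_left) (rule sum.swap)

lemma abs_E_le:
  assumes "\<And>\<eta>. \<eta> \<in> \<Omega> \<Longrightarrow> \<bar>\<phi> \<eta>\<bar> \<le> a" shows "\<bar>E \<phi>\<bar> \<le> a"
proof -
  have "\<phi> \<eta> \<le> a" "- a \<le> \<phi> \<eta>" if "\<eta> \<in> \<Omega>" for \<eta>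
    using assms[OF that] by auto
  then have "E \<phi> \<le> E (\<lambda>_. a)" "E (\<lambda>_. - a) \<le> E \<phi>"
    by (auto intro!: E_mono)
  then show ?thesis by (simp add: E_const)
qed

lemma energy_nonneg: "(\<And>\<eta>. \<eta> \<in> \<Omega> \<Longrightarrow> 0 \<le> k \<eta>) \<Longrightarrow> 0 \<le> energy k \<tau>"
  unfolding energy_def by (intro sum_nonneg) (auto intro!: mult_nonneg_nonneg less_imp_le[OF \<nu>_pos])

lemma exchange_in: "x \<in> S \<Longrightarrow> y \<in> S \<Longrightarrow> \<eta> \<in> \<Omega> \<Longrightarrow> exchange x y \<eta> \<in> \<Omega>"
  by (auto simp: exchange_def \<Omega>_def PiE_iff extensional_def)

lemma flip_in: "z \<in> S \<Longrightarrow> \<eta> \<in> \<Omega> \<Longrightarrow> flip z \<eta> \<in> \<Omega>"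
  by (auto simp: flip_def \<Omega>_def PiE_iff extensional_def)

lemma exchange_exchange: "x \<noteq> y \<Longrightarrow> exchange x y (exchange x y \<eta>) = \<eta>"
  by (auto simp: exchange_def fun_eq_iff)

lemma flip_flip: "z \<in> S \<Longrightarrow> \<eta> \<in> \<Omega> \<Longrightarrow> flip z (flip z \<eta>) = \<eta>"
  by (auto simp: flip_def fun_eq_iff \<Omega>_def PiE_iff)

lemma sum_involution:
  assumes "\<And>\<eta>. \<eta> \<in> \<Omega> \<Longrightarrow> \<tau> \<eta> \<in> \<Omega>" "\<And>\<eta>. \<eta> \<in> \<Omega> \<Longrightarrow> \<tau> (\<tau> \<eta>) = \<eta>"
  shows "(\<Sum>\<eta> \<in> \<Omega>. \<phi> (\<tau> \<eta>)) = (\<Sum>\<eta> \<in> \<Omega>. \<phi> \<eta>)"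
  using assms by (intro sum.reindex_bij_witness[of _ \<tau> \<tau>]) auto

text \<open>Factors away from the two sites are untouched by the swap, so the four occupation
  patterns decide. The bracket is the ratio of the weights; for equal occupations its linear and
  quadratic terms cancel. These two terms are the defect of reversibility of the swap.\<close>

lemma \<nu>_exchange:
  assumes "\<eta> \<in> \<Omega>" "x \<in> S" "y \<in> S" "x \<noteq> y"
  shows "\<nu> (exchange x y \<eta>) =
    \<nu> \<eta> * (1 + (r y - r x) * (\<omega> x \<eta> - \<omega> y \<eta>) - (r x - r y)\<^sup>2 * (\<omega> x \<eta> * \<omega> y \<eta>))"
proof -
  let ?b = "\<lambda>\<eta> x. real (\<eta> x) * r x + (1 - real (\<eta> x)) * (1 - r x)"
  have split: "\<nu> \<xi> = ?b \<xi> x * (?b \<xi> y * (\<Prod>z \<in> S - {x} - {y}. ?b \<xi> z))" for \<xi> :: "'d config"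
    unfolding bernoulli_weight_def using assms finite_S
    by (subst prod.remove[of S x], simp, simp, subst prod.remove[of "S - {x}" y]) auto
  have rest: "(\<Prod>z \<in> S - {x} - {y}. ?b (exchange x y \<eta>) z) = (\<Prod>z \<in> S - {x} - {y}. ?b \<eta> z)"
    by (intro prod.cong) (auto simp: exchange_def)
  have vals: "exchange x y \<eta> x = \<eta> y" "exchange x y \<eta> y = \<eta> x"
    using assms by (auto simp: exchange_def)
  have pos: "r x \<noteq> 0" "1 - r x \<noteq> 0" "r y \<noteq> 0" "1 - r y \<noteq> 0"
    using r_pos r_less assms by (force)+
  have "\<eta> x = 0 \<or> \<eta> x = 1" "\<eta> y = 0 \<or> \<eta> y = 1"
    using value_cases[OF assms(1,2)] value_cases[OF assms(1,3)] by simp_all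
  then have key: "?b (exchange x y \<eta>) x * ?b (exchange x y \<eta>) y =
      ?b \<eta> x * ?b \<eta> y * (1 + (r y - r x) * (\<omega> x \<eta> - \<omega> y \<eta>) - (r x - r y)\<^sup>2 * (\<omega> x \<eta> * \<omega> y \<eta>))"
    unfolding vals \<omega>_def using pos
    by (elim disjE; simp add: divide_simps power2_eq_square; simp add: algebra_simps)
  show ?thesis
    unfolding split[of "exchange x y \<eta>"] split[of \<eta>] rest using key by (simp add: mult_ac)
qed

definition spin_rate :: "real \<Rightarrow> int ^ 'd \<Rightarrow> 'd config \<Rightarrow> real" where
  "spin_rate a z \<eta> = a * (1 - real (\<eta> z)) + (1 - a) * real (\<eta> z)"

text \<open>The defect \<open>(a - r z) * \<omega> z \<eta>\<close> vanishes for
  \<open>a = r z\<close>: a reservoir with the density of the profile is reversible. That instance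
  is the detailed balance relation used in \<open>boundary_replacement\<close>.\<close>

lemma \<nu>_flip:
  assumes "\<eta> \<in> \<Omega>" "z \<in> S"
  shows "\<nu> (flip z \<eta>) * spin_rate a z (flip z \<eta>) = \<nu> \<eta> * (spin_rate a z \<eta> + (a - r z) * \<omega> z \<eta>)"
proof -
  let ?b = "\<lambda>\<eta> x. real (\<eta> x) * r x + (1 - real (\<eta> x)) * (1 - r x)"
  have split: "\<nu> \<xi> = ?b \<xi> z * (\<Prod>x \<in> S - {z}. ?b \<xi> x)" for \<xi> :: "'d config"
    unfolding bernoulli_weight_def using assms finite_S by (simp add: prod.remove)
  have rest: "(\<Prod>x \<in> S - {z}. ?b (flip z \<eta>) x) = (\<Prod>x \<in> S - {z}. ?b \<eta> x)"
    by (intro prod.cong) (auto simp: flip_def)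
  have vals: "flip z \<eta> z = 1 - \<eta> z"
    by (auto simp: flip_def)
  have pos: "r z \<noteq> 0" "1 - r z \<noteq> 0"
    using r_pos r_less assms by force+
  have "\<eta> z = 0 \<or> \<eta> z = 1"
    using value_cases[OF assms] .
  then have key: "?b (flip z \<eta>) z * spin_rate a z (flip z \<eta>) = ?b \<eta> z * (spin_rate a z \<eta> + (a - r z) * \<omega> z \<eta>)"
    unfolding vals \<omega>_def spin_rate_def using pos
    by (elim disjE; simp add: divide_simps; simp add: algebra_simps)
  show ?thesis
    unfolding split[of "flip z \<eta>"] split[of \<eta>] rest using key by (simp add: mult_ac)
qed

text \<open>The bound ln s \<le> s - 1 is applied to s = sqrt b / sqrt a rather than to b / a; this
  keeps the square, the source of all energy terms.\<close>

lemma ln_diff_le_sqrt: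
  fixes a b :: real assumes "0 < a" "0 < b"
  shows "a * (ln b - ln a) \<le> (b - a) - (sqrt b - sqrt a)\<^sup>2"
proof -
  have "ln b - ln a = 2 * ln (sqrt b / sqrt a)"
    using assms by (simp add: ln_div ln_sqrt)
  also have "\<dots> \<le> 2 * (sqrt b / sqrt a - 1)"
    using assms ln_le_minus_one[of "sqrt b / sqrt a"] by simp
  finally have "a * (ln b - ln a) \<le> a * (2 * (sqrt b / sqrt a - 1))"
    using assms by (intro mult_left_mono) auto
  also have "\<dots> = 2 * (sqrt a * sqrt b) - 2 * a"
    using assms by (simp add: field_simps)
  also have "\<dots> = (b - a) - (sqrt b - sqrt a)\<^sup>2"
    using assms by (simp add: power2_diff)
  finally show ?thesis .
qed

text \<open>\<open>A\<close> is the defect of reversibility of the rate \<open>k\<close>. Since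
  \<open>\<tau>\<close> is an involution, the sum of the density after the jump can be moved back
  onto the density itself, and there only the defect survives; the squares of
  \<open>ln_diff_le_sqrt\<close> sum to the energy.\<close>

lemma jump_entropy_le:
  assumes in\<Omega>: "\<And>\<eta>. \<eta> \<in> \<Omega> \<Longrightarrow> \<tau> \<eta> \<in> \<Omega>" and inv: "\<And>\<eta>. \<eta> \<in> \<Omega> \<Longrightarrow> \<tau> (\<tau> \<eta>) = \<eta>"
    and k: "\<And>\<eta>. \<eta> \<in> \<Omega> \<Longrightarrow> 0 \<le> k \<eta>"
    and adj: "\<And>\<eta>. \<eta> \<in> \<Omega> \<Longrightarrow> \<nu> (\<tau> \<eta>) * k (\<tau> \<eta>) = \<nu> \<eta> * (k \<eta> + A \<eta>)"
  shows "E (\<lambda>\<eta>. k \<eta> * (ln (f (\<tau> \<eta>)) - ln (f \<eta>))) \<le> E A - energy k \<tau>"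
proof -
  have "E (\<lambda>\<eta>. k \<eta> * (ln (f (\<tau> \<eta>)) - ln (f \<eta>)))
      = (\<Sum>\<eta>\<in>\<Omega>. \<nu> \<eta> * k \<eta> * (f \<eta> * (ln (f (\<tau> \<eta>)) - ln (f \<eta>))))"
    unfolding E_def by (intro sum.cong refl) (simp add: \<nu>_f[symmetric] mult_ac)
  also have "\<dots> \<le> (\<Sum>\<eta>\<in>\<Omega>. \<nu> \<eta> * k \<eta> * (f (\<tau> \<eta>) - f \<eta> - (sqrt (f (\<tau> \<eta>)) - sqrt (f \<eta>))\<^sup>2))"
    using k in\<Omega> by (intro sum_mono mult_left_mono ln_diff_le_sqrt f_pos mult_nonneg_nonneg less_imp_le[OF \<nu>_pos]) auto
  also have "\<dots> = (\<Sum>\<eta>\<in>\<Omega>. \<nu> \<eta> * k \<eta> * f (\<tau> \<eta>)) - (\<Sum>\<eta>\<in>\<Omega>. \<nu> \<eta> * k \<eta> * f \<eta>) - energy k \<tau>"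
    unfolding energy_def by (simp add: right_diff_distrib sum_subtractf)
  also have "(\<Sum>\<eta>\<in>\<Omega>. \<nu> \<eta> * k \<eta> * f (\<tau> \<eta>)) = (\<Sum>\<eta>\<in>\<Omega>. \<nu> (\<tau> \<eta>) * k (\<tau> \<eta>) * f \<eta>)"
    by (subst sum_involution[OF in\<Omega> inv, symmetric]) (auto intro!: sum.cong simp: inv)
  also have "\<dots> = (\<Sum>\<eta>\<in>\<Omega>. \<nu> \<eta> * (k \<eta> + A \<eta>) * f \<eta>)"
    by (intro sum.cong) (auto simp: adj)
  also have "\<dots> - (\<Sum>\<eta>\<in>\<Omega>. \<nu> \<eta> * k \<eta> * f \<eta>) = E A"
    unfolding E_def sum_subtractf[symmetric]
    by (intro sum.cong refl) (simp add: \<nu>_f[symmetric] algebra_simps)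
  finally show ?thesis .
qed

lemma exchange_entropy_le:
  assumes "x \<in> S" "y \<in> S" "x \<noteq> y"
  shows "E (\<lambda>\<eta>. ln (f (exchange x y \<eta>)) - ln (f \<eta>)) \<le>
    (r y - r x) * (E (\<omega> x) - E (\<omega> y)) - (r x - r y)\<^sup>2 * E (\<lambda>\<eta>. \<omega> x \<eta> * \<omega> y \<eta>)
      - energy (\<lambda>_. 1) (exchange x y)"
proof -
  have "E (\<lambda>\<eta>. 1 * (ln (f (exchange x y \<eta>)) - ln (f \<eta>))) \<le>
      E (\<lambda>\<eta>. (r y - r x) * (\<omega> x \<eta> - \<omega> y \<eta>) - (r x - r y)\<^sup>2 * (\<omega> x \<eta> * \<omega> y \<eta>)) - energy (\<lambda>_. 1) (exchange x y)"
    using assms by (intro jump_entropy_le) (auto simp: exchange_in exchange_exchange \<nu>_exchange)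
  then show ?thesis by (simp add: E_diff E_cmult)
qed

lemma flip_entropy_le:
  assumes "z \<in> S" "0 \<le> a" "a \<le> 1"
  shows "E (\<lambda>\<eta>. spin_rate a z \<eta> * (ln (f (flip z \<eta>)) - ln (f \<eta>))) \<le>
    (a - r z) * E (\<omega> z) - energy (spin_rate a z) (flip z)"
proof -
  have "0 \<le> spin_rate a z \<eta>" if "\<eta> \<in> \<Omega>" for \<eta>
    using value_cases[OF that assms(1)] assms by (auto simp: spin_rate_def)
  then have "E (\<lambda>\<eta>. spin_rate a z \<eta> * (ln (f (flip z \<eta>)) - ln (f \<eta>))) \<le>
      E (\<lambda>\<eta>. (a - r z) * \<omega> z \<eta>) - energy (spin_rate a z) (flip z)"
    using assms by (intro jump_entropy_le) (auto simp: flip_in flip_flip \<nu>_flip)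
  then show ?thesis by (simp add: E_cmult)
qed

lemma \<omega>_bound:
  assumes "x \<in> S" "\<eta> \<in> \<Omega>"
  shows "\<bar>\<omega> x \<eta>\<bar> \<le> 1 / \<epsilon>"
proof -
  have "\<eta> x = 0 \<or> \<eta> x = 1" using value_cases[OF assms(2,1)] .
  moreover have "\<omega> x \<eta> = 1 / r x" if "\<eta> x = 1"
    using that r_pos[OF assms(1)] r_less[OF assms(1)] by (simp add: \<omega>_def)
  moreover have "\<omega> x \<eta> = - 1 / (1 - r x)" if "\<eta> x = 0"
    using that r_pos[OF assms(1)] r_less[OF assms(1)] by (simp add: \<omega>_def)
  moreover have "1 / r x \<le> 1 / \<epsilon>" "1 / (1 - r x) \<le> 1 / \<epsilon>"
    using r_ge[OF assms(1)] r_le[OF assms(1)] \<epsilon>_pos by (auto intro!: divide_left_mono)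
  ultimately show ?thesis
    using r_pos[OF assms(1)] r_less[OF assms(1)] by auto
qed

text \<open>Pairing \<open>\<eta>\<close> with its image, the expectation becomes a sum of the differences of \<open>m\<close> across
  the bond, which the energy of the bond controls.\<close>

lemma exchange_replacement:
  assumes xy: "x \<in> S" "y \<in> S" "x \<noteq> y" and \<delta>: "\<bar>r x - r y\<bar> \<le> \<delta>" "\<delta> \<le> 1" and \<alpha>: "0 < \<alpha>"
    and h: "\<And>\<eta>. \<eta> \<in> \<Omega> \<Longrightarrow> \<bar>h \<eta>\<bar> \<le> 1"
    and inv: "\<And>\<eta>. \<eta> \<in> \<Omega> \<Longrightarrow> h (exchange x y \<eta>) = h \<eta>"
  shows "\<bar>E (\<lambda>\<eta>. h \<eta> * (real (\<eta> x) - real (\<eta> y)))\<bar>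
    \<le> \<alpha> * energy (\<lambda>_. 1) (exchange x y) + 3 / \<epsilon>\<^sup>2 * (1 / \<alpha> + \<delta>)"
proof -
  let ?\<tau> = "exchange x y"
  have in\<Omega>: "?\<tau> \<eta> \<in> \<Omega>" and involution: "?\<tau> (?\<tau> \<eta>) = \<eta>" if "\<eta> \<in> \<Omega>" for \<eta>
    using that xy by (auto simp: exchange_in exchange_exchange)
  have vals: "?\<tau> \<eta> x = \<eta> y" "?\<tau> \<eta> y = \<eta> x" for \<eta> :: "'d config"
    using xy by (auto simp: exchange_def)
  have \<epsilon>1: "\<epsilon> \<le> 1" using r_ge[OF xy(1)] r_less[OF xy(1)] by simp
  have \<delta>0: "0 \<le> \<delta>" using \<delta> by linarith
  have \<nu>_diff: "\<bar>\<nu> \<eta> - \<nu> (?\<tau> \<eta>)\<bar> \<le> 3 / \<epsilon>\<^sup>2 * \<delta> * \<nu> (?\<tau> \<eta>)" if \<eta>: "\<eta> \<in> \<Omega>" for \<eta>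
  proof -
    let ?\<xi> = "?\<tau> \<eta>"
    \<comment> \<open>Expanding around the swapped configuration bounds the change of weight by a
      multiple of \<open>\<nu> (?\<tau> \<eta>)\<close>, the weight that later multiplies the
      density at that configuration and sums with it to total mass 1.\<close>
    let ?A = "(r y - r x) * (\<omega> x ?\<xi> - \<omega> y ?\<xi>) - (r x - r y)\<^sup>2 * (\<omega> x ?\<xi> * \<omega> y ?\<xi>)"
    have "\<nu> \<eta> = \<nu> ?\<xi> * (1 + ?A)"
      using \<nu>_exchange[OF in\<Omega>[OF \<eta>] xy] involution[OF \<eta>] by (simp add: algebra_simps)
    then have "\<nu> \<eta> - \<nu> ?\<xi> = \<nu> ?\<xi> * ?A" by (simp add: algebra_simps)
    then have eq: "\<bar>\<nu> \<eta> - \<nu> ?\<xi>\<bar> = \<bar>?A\<bar> * \<nu> ?\<xi>"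
      using \<nu>_pos[OF in\<Omega>[OF \<eta>]] by (simp add: abs_mult)
    have A1: "\<bar>?A\<bar> \<le> \<delta> * (1 / \<epsilon> + 1 / \<epsilon>) + \<delta> * (1 / \<epsilon> * (1 / \<epsilon>))"
    proof -
      have "\<bar>(r y - r x) * (\<omega> x ?\<xi> - \<omega> y ?\<xi>)\<bar> \<le> \<delta> * (1 / \<epsilon> + 1 / \<epsilon>)"
        unfolding abs_mult using \<delta> \<omega>_bound[OF xy(1) in\<Omega>[OF \<eta>]] \<omega>_bound[OF xy(2) in\<Omega>[OF \<eta>]] \<epsilon>_pos
        by (intro mult_mono) (auto simp: abs_minus_commute intro: order_trans[OF abs_triangle_ineq4])
      moreover have "\<bar>(r x - r y)\<^sup>2 * (\<omega> x ?\<xi> * \<omega> y ?\<xi>)\<bar> \<le> \<delta> * (1 / \<epsilon> * (1 / \<epsilon>))"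
        unfolding abs_mult
      proof (intro mult_mono)
        have "\<bar>r x - r y\<bar>\<^sup>2 \<le> \<delta>\<^sup>2" using \<delta> by (intro power_mono) auto
        also have "\<delta>\<^sup>2 \<le> \<delta>" using \<delta> \<delta>0 by (simp add: power2_eq_square mult_left_le)
        finally show "\<bar>(r x - r y)\<^sup>2\<bar> \<le> \<delta>" by simp
      qed (use \<omega>_bound[OF xy(1) in\<Omega>[OF \<eta>]] \<omega>_bound[OF xy(2) in\<Omega>[OF \<eta>]] \<epsilon>_pos \<delta>0 in auto)
      ultimately show ?thesis by linarith
    qed
    have A2: "\<delta> * (1 / \<epsilon> + 1 / \<epsilon>) + \<delta> * (1 / \<epsilon> * (1 / \<epsilon>)) \<le> 3 / \<epsilon>\<^sup>2 * \<delta>"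
    proof -
      have "1 / \<epsilon> \<le> 1 / \<epsilon>\<^sup>2" using \<epsilon>_pos \<epsilon>1 by (simp add: divide_simps power2_eq_square)
      then have "\<delta> * (1 / \<epsilon> + 1 / \<epsilon>) \<le> \<delta> * (1 / \<epsilon>\<^sup>2 + 1 / \<epsilon>\<^sup>2)" using \<delta>0 by (intro mult_left_mono) auto
      moreover have "3 / \<epsilon>\<^sup>2 * \<delta> = \<delta> * (1 / \<epsilon>\<^sup>2 + 1 / \<epsilon>\<^sup>2) + \<delta> * (1 / \<epsilon> * (1 / \<epsilon>))"
        by (simp add: power2_eq_square)
      ultimately show ?thesis by linarith
    qed
    show ?thesis
      unfolding eq by (rule mult_right_mono) (use order_trans[OF A1 A2] \<nu>_pos[OF in\<Omega>[OF \<eta>]] in auto)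
  qed
  have sum1: "(\<Sum>\<eta>\<in>\<Omega>. \<nu> (?\<tau> \<eta>) * f (?\<tau> \<eta>)) = 1"
    using sum_involution[OF in\<Omega> involution, of "\<lambda>\<eta>. \<nu> \<eta> * f \<eta>"] by (simp add: \<nu>_f m_sum cong: sum.cong)
  have "2 * E (\<lambda>\<eta>. h \<eta> * (real (\<eta> x) - real (\<eta> y))) =
      (\<Sum>\<eta>\<in>\<Omega>. m \<eta> * (h \<eta> * (real (\<eta> x) - real (\<eta> y)))) +
      (\<Sum>\<eta>\<in>\<Omega>. m (?\<tau> \<eta>) * (h (?\<tau> \<eta>) * (real (?\<tau> \<eta> x) - real (?\<tau> \<eta> y))))"
    using sum_involution[OF in\<Omega> involution, of "\<lambda>\<eta>. m \<eta> * (h \<eta> * (real (\<eta> x) - real (\<eta> y)))"]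
    by (simp add: E_def)
  also have "\<dots> = (\<Sum>\<eta>\<in>\<Omega>. (m \<eta> - m (?\<tau> \<eta>)) * (h \<eta> * (real (\<eta> x) - real (\<eta> y))))"
    unfolding sum.distrib[symmetric] by (intro sum.cong) (auto simp: inv vals algebra_simps)
  finally have two_E: "2 * E (\<lambda>\<eta>. h \<eta> * (real (\<eta> x) - real (\<eta> y))) =
      (\<Sum>\<eta>\<in>\<Omega>. (m \<eta> - m (?\<tau> \<eta>)) * (h \<eta> * (real (\<eta> x) - real (\<eta> y))))" .
  have "2 * \<bar>E (\<lambda>\<eta>. h \<eta> * (real (\<eta> x) - real (\<eta> y)))\<bar> =
      \<bar>2 * E (\<lambda>\<eta>. h \<eta> * (real (\<eta> x) - real (\<eta> y)))\<bar>"
    by (simp only: abs_mult abs_numeral)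
  also have "\<dots> \<le> (\<Sum>\<eta>\<in>\<Omega>. \<bar>(m \<eta> - m (?\<tau> \<eta>)) * (h \<eta> * (real (\<eta> x) - real (\<eta> y)))\<bar>)"
    unfolding two_E by (rule sum_abs)
  also have "\<dots> \<le> (\<Sum>\<eta>\<in>\<Omega>. \<bar>m \<eta> - m (?\<tau> \<eta>)\<bar>)"
  proof (rule sum_mono)
    fix \<eta> assume \<eta>: "\<eta> \<in> \<Omega>"
    have "\<bar>real (\<eta> x) - real (\<eta> y)\<bar> \<le> 1"
      using value_cases[OF \<eta> xy(1)] value_cases[OF \<eta> xy(2)] by fastforce
    then have "\<bar>h \<eta> * (real (\<eta> x) - real (\<eta> y))\<bar> \<le> 1"
      unfolding abs_mult using h[OF \<eta>] by (intro mult_le_one) auto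
    then show "\<bar>(m \<eta> - m (?\<tau> \<eta>)) * (h \<eta> * (real (\<eta> x) - real (\<eta> y)))\<bar> \<le> \<bar>m \<eta> - m (?\<tau> \<eta>)\<bar>"
      unfolding abs_mult[of "m \<eta> - m (?\<tau> \<eta>)"] by (intro mult_left_le) auto
  qed
  also have "\<dots> \<le> (\<Sum>\<eta>\<in>\<Omega>. 2 * \<alpha> * (\<nu> \<eta> * 1 * (sqrt (f (?\<tau> \<eta>)) - sqrt (f \<eta>))\<^sup>2)
      + 1 / (4 * \<alpha>) * (m \<eta> + (1 + 3 / \<epsilon>\<^sup>2 * \<delta>) * (\<nu> (?\<tau> \<eta>) * f (?\<tau> \<eta>)))
      + 3 / \<epsilon>\<^sup>2 * \<delta> * (\<nu> (?\<tau> \<eta>) * f (?\<tau> \<eta>)))"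
  proof (rule sum_mono)
    fix \<eta> assume \<eta>: "\<eta> \<in> \<Omega>"
    define p q where "p = sqrt (f \<eta>)" and "q = sqrt (f (?\<tau> \<eta>))"
    have p2: "f \<eta> = p\<^sup>2" and q2: "f (?\<tau> \<eta>) = q\<^sup>2" and pq: "0 \<le> p" "0 \<le> q"
      using f_pos[OF \<eta>] f_pos[OF in\<Omega>[OF \<eta>]] by (auto simp: p_def q_def)
    have n1: "0 < \<nu> \<eta>" and n2: "0 < \<nu> (?\<tau> \<eta>)" using \<nu>_pos \<eta> in\<Omega> by auto
    \<comment> \<open>The change of \<open>m\<close> is split into a change of the density at fixed
      weight, paid by energy, and a change of the weight, which is of order \<delta>.\<close>
    have "\<bar>m \<eta> - m (?\<tau> \<eta>)\<bar> = \<bar>\<nu> \<eta> * (p\<^sup>2 - q\<^sup>2) + (\<nu> \<eta> - \<nu> (?\<tau> \<eta>)) * q\<^sup>2\<bar>"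
      using \<nu>_f[OF \<eta>] \<nu>_f[OF in\<Omega>[OF \<eta>]] by (simp add: p2 q2 algebra_simps)
    also have "\<dots> \<le> \<nu> \<eta> * \<bar>p\<^sup>2 - q\<^sup>2\<bar> + \<bar>\<nu> \<eta> - \<nu> (?\<tau> \<eta>)\<bar> * q\<^sup>2"
      using n1 by (intro order_trans[OF abs_triangle_ineq]) (simp add: abs_mult)
    \<comment> \<open>The parameter is 2 \<alpha> because twice the expectation is being
      estimated.\<close>
    also have "\<bar>p\<^sup>2 - q\<^sup>2\<bar> \<le> 2 * \<alpha> * (q - p)\<^sup>2 + 1 / (4 * \<alpha>) * (p\<^sup>2 + q\<^sup>2)"
      using young_diff_squares[of "2 * \<alpha>" 1 q p] \<alpha> by (simp add: abs_diff_squares[OF pq])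
    also have "\<nu> \<eta> * (2 * \<alpha> * (q - p)\<^sup>2 + 1 / (4 * \<alpha>) * (p\<^sup>2 + q\<^sup>2)) + \<bar>\<nu> \<eta> - \<nu> (?\<tau> \<eta>)\<bar> * q\<^sup>2 \<le>
       2 * \<alpha> * (\<nu> \<eta> * 1 * (q - p)\<^sup>2) + 1 / (4 * \<alpha>) * (m \<eta> + (1 + 3 / \<epsilon>\<^sup>2 * \<delta>) * (\<nu> (?\<tau> \<eta>) * q\<^sup>2))
      + 3 / \<epsilon>\<^sup>2 * \<delta> * (\<nu> (?\<tau> \<eta>) * q\<^sup>2)"
    proof -
      have "\<bar>\<nu> \<eta> - \<nu> (?\<tau> \<eta>)\<bar> * q\<^sup>2 \<le> 3 / \<epsilon>\<^sup>2 * \<delta> * \<nu> (?\<tau> \<eta>) * q\<^sup>2"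
        using \<nu>_diff[OF \<eta>] by (intro mult_right_mono) auto
      moreover have "\<nu> \<eta> * q\<^sup>2 \<le> (1 + 3 / \<epsilon>\<^sup>2 * \<delta>) * \<nu> (?\<tau> \<eta>) * q\<^sup>2"
        using \<nu>_diff[OF \<eta>] by (intro mult_right_mono) (auto simp: algebra_simps abs_le_iff)
      then have "1 / (4 * \<alpha>) * (\<nu> \<eta> * q\<^sup>2) \<le> 1 / (4 * \<alpha>) * ((1 + 3 / \<epsilon>\<^sup>2 * \<delta>) * \<nu> (?\<tau> \<eta>) * q\<^sup>2)"
        using \<alpha> by (intro mult_left_mono) auto
      moreover have "m \<eta> = \<nu> \<eta> * p\<^sup>2" using \<nu>_f[OF \<eta>] p2 by simp
      ultimately show ?thesis by (simp add: distrib_left mult_ac)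
    qed
    finally have "\<bar>m \<eta> - m (?\<tau> \<eta>)\<bar> \<le>
       2 * \<alpha> * (\<nu> \<eta> * 1 * (q - p)\<^sup>2) + 1 / (4 * \<alpha>) * (m \<eta> + (1 + 3 / \<epsilon>\<^sup>2 * \<delta>) * (\<nu> (?\<tau> \<eta>) * q\<^sup>2))
      + 3 / \<epsilon>\<^sup>2 * \<delta> * (\<nu> (?\<tau> \<eta>) * q\<^sup>2)"
      using n1 by (simp add: mult_left_mono)
    then show "\<bar>m \<eta> - m (?\<tau> \<eta>)\<bar> \<le> 2 * \<alpha> * (\<nu> \<eta> * 1 * (sqrt (f (?\<tau> \<eta>)) - sqrt (f \<eta>))\<^sup>2)
      + 1 / (4 * \<alpha>) * (m \<eta> + (1 + 3 / \<epsilon>\<^sup>2 * \<delta>) * (\<nu> (?\<tau> \<eta>) * f (?\<tau> \<eta>)))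
      + 3 / \<epsilon>\<^sup>2 * \<delta> * (\<nu> (?\<tau> \<eta>) * f (?\<tau> \<eta>))"
      unfolding q2[symmetric] unfolding p_def q_def .
  qed
  also have "\<dots> = 2 * \<alpha> * energy (\<lambda>_. 1) ?\<tau> + 1 / (4 * \<alpha>) * (2 + 3 / \<epsilon>\<^sup>2 * \<delta>) + 3 / \<epsilon>\<^sup>2 * \<delta>"
    by (simp only: sum.distrib sum_distrib_left[symmetric] sum1 m_sum energy_def) simp
  \<comment> \<open>Since 1 / \<epsilon>^2 is at least 1, a generous multiple of 3 / \<epsilon>^2
    also swallows the constant 2, and \<epsilon> enters through a single factor.\<close>
  also have "1 / (4 * \<alpha>) * (2 + 3 / \<epsilon>\<^sup>2 * \<delta>) \<le> 3 / \<epsilon>\<^sup>2 * (2 / \<alpha>)"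
  proof -
    have "1 \<le> 1 / \<epsilon>\<^sup>2" using \<epsilon>_pos \<epsilon>1 by (simp add: power_le_one)
    then have "2 + 3 / \<epsilon>\<^sup>2 * \<delta> \<le> 8 * (3 / \<epsilon>\<^sup>2)"
      using \<delta> \<delta>0 mult_left_mono[of \<delta> 1 "3 / \<epsilon>\<^sup>2"] by simp
    then have "1 / (4 * \<alpha>) * (2 + 3 / \<epsilon>\<^sup>2 * \<delta>) \<le> 1 / (4 * \<alpha>) * (8 * (3 / \<epsilon>\<^sup>2))"
      using \<alpha> by (intro mult_left_mono) auto
    then show ?thesis by (simp add: mult_ac)
  qed
  also have "2 * \<alpha> * energy (\<lambda>_. 1) ?\<tau> + 3 / \<epsilon>\<^sup>2 * (2 / \<alpha>) + 3 / \<epsilon>\<^sup>2 * \<delta> \<le>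
      2 * (\<alpha> * energy (\<lambda>_. 1) ?\<tau> + 3 / \<epsilon>\<^sup>2 * (1 / \<alpha> + \<delta>))"
    using \<delta>0 by (simp add: distrib_left divide_right_mono)
  finally have "2 * \<bar>E (\<lambda>\<eta>. h \<eta> * (real (\<eta> x) - real (\<eta> y)))\<bar> \<le>
      2 * (\<alpha> * energy (\<lambda>_. 1) ?\<tau> + 3 / \<epsilon>\<^sup>2 * (1 / \<alpha> + \<delta>))"
    by simp
  then show ?thesis by (rule mult_left_le_imp_le) simp
qed

text \<open>The flip changes the sign of \<open>\<nu> \<eta> * \<omega> z \<eta>\<close>, so the
  expectation sees only the difference of the density across the flip, which the reservoir energy
  controls. The price is quadratic in \<open>B\<close> but divided by \<open>\<alpha>\<close>, a
  gain when the reservoir is fast. The power \<epsilon>^4 collects two factors from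
  \<open>\<omega>_bound\<close>, one from the lower bound on the rates and one from the ratio of the
  weights.\<close>

lemma boundary_replacement:
  assumes z: "z \<in> S" and a: "\<epsilon> \<le> a" "a \<le> 1 - \<epsilon>" and \<alpha>: "0 < \<alpha>"
  shows "B * E (\<omega> z) \<le> \<alpha> * energy (spin_rate a z) (flip z) + B\<^sup>2 / (\<alpha> * \<epsilon> ^ 4)"
proof -
  let ?\<tau> = "flip z"
  have in\<Omega>: "?\<tau> \<eta> \<in> \<Omega>" and involution: "?\<tau> (?\<tau> \<eta>) = \<eta>" if "\<eta> \<in> \<Omega>" for \<eta>
    using that z by (auto simp: flip_in flip_flip)
  have \<epsilon>1: "\<epsilon> \<le> 1" using r_ge[OF z] r_less[OF z] by simp
  have rate: "\<epsilon> \<le> spin_rate a z \<eta>" if "\<eta> \<in> \<Omega>" for \<eta>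
    using value_cases[OF that z] a by (auto simp: spin_rate_def)
  have odd: "\<nu> (?\<tau> \<eta>) * \<omega> z (?\<tau> \<eta>) = - (\<nu> \<eta> * \<omega> z \<eta>)" if \<eta>: "\<eta> \<in> \<Omega>" for \<eta>
  proof -
    have pos: "0 < r z" "r z < 1" using r_pos r_less z by auto
    have bal: "\<nu> (?\<tau> \<eta>) * spin_rate (r z) z (?\<tau> \<eta>) = \<nu> \<eta> * spin_rate (r z) z \<eta>"
      using \<nu>_flip[OF \<eta> z, of "r z"] by simp
    have "\<nu> (?\<tau> \<eta>) * (real (?\<tau> \<eta> z) - r z) = - (\<nu> \<eta> * (real (\<eta> z) - r z))"
      using value_cases[OF \<eta> z] bal by (auto simp: spin_rate_def flip_def algebra_simps)
    then show ?thesis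
      unfolding \<omega>_def times_divide_eq_right by (simp only: minus_divide_left)
  qed
  have ratio: "\<nu> \<eta> \<le> \<nu> (?\<tau> \<eta>) / \<epsilon>" if \<eta>: "\<eta> \<in> \<Omega>" for \<eta>
  proof -
    have 1: "\<epsilon> \<le> spin_rate (r z) z \<eta>" "spin_rate (r z) z (?\<tau> \<eta>) \<le> 1"
      using value_cases[OF \<eta> z] value_cases[OF in\<Omega>[OF \<eta>] z] r_ge[OF z] r_le[OF z] \<epsilon>_pos
      by (auto simp: spin_rate_def)
    have "\<nu> \<eta> * \<epsilon> \<le> \<nu> \<eta> * spin_rate (r z) z \<eta>"
      using 1 \<nu>_pos[OF \<eta>] by (intro mult_left_mono) auto
    also have "\<dots> = \<nu> (?\<tau> \<eta>) * spin_rate (r z) z (?\<tau> \<eta>)"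
      using \<nu>_flip[OF \<eta> z, of "r z"] by simp
    also have "\<dots> \<le> \<nu> (?\<tau> \<eta>)"
      using 1 \<nu>_pos[OF in\<Omega>[OF \<eta>]] by (simp add: mult_left_le)
    finally show ?thesis using \<epsilon>_pos by (simp add: pos_le_divide_eq)
  qed
  have "2 * (B * E (\<omega> z)) = (\<Sum>\<eta>\<in>\<Omega>. B * (\<nu> \<eta> * \<omega> z \<eta>) * f \<eta>) + (\<Sum>\<eta>\<in>\<Omega>. B * (\<nu> (?\<tau> \<eta>) * \<omega> z (?\<tau> \<eta>)) * f (?\<tau> \<eta>))"
    using sum_involution[OF in\<Omega> involution, of "\<lambda>\<eta>. B * (\<nu> \<eta> * \<omega> z \<eta>) * f \<eta>"]
    by (simp add: E_def sum_distrib_left \<nu>_f[symmetric] mult_ac cong: sum.cong)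
  also have "\<dots> = (\<Sum>\<eta>\<in>\<Omega>. \<nu> \<eta> * (B * \<omega> z \<eta> * (f \<eta> - f (?\<tau> \<eta>))))"
    unfolding sum.distrib[symmetric] by (intro sum.cong refl, simp only: odd) (simp add: algebra_simps)
  also have "\<dots> \<le> (\<Sum>\<eta>\<in>\<Omega>. \<alpha> * (\<nu> \<eta> * spin_rate a z \<eta> * (sqrt (f (?\<tau> \<eta>)) - sqrt (f \<eta>))\<^sup>2)
     + B\<^sup>2 / (2 * \<alpha> * \<epsilon> ^ 3) * (m \<eta> + 1 / \<epsilon> * m (?\<tau> \<eta>)))"
  proof (rule sum_mono)
    fix \<eta> assume \<eta>: "\<eta> \<in> \<Omega>"
    define p q where "p = sqrt (f \<eta>)" and "q = sqrt (f (?\<tau> \<eta>))"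
    have p2: "f \<eta> = p\<^sup>2" and q2: "f (?\<tau> \<eta>) = q\<^sup>2" and pq: "0 \<le> p" "0 \<le> q"
      using f_pos[OF \<eta>] f_pos[OF in\<Omega>[OF \<eta>]] by (auto simp: p_def q_def)
    define X where "X = \<bar>B * \<omega> z \<eta>\<bar>"
    have X: "0 \<le> X" "X \<le> \<bar>B\<bar> / \<epsilon>"
      using mult_left_mono[OF \<omega>_bound[OF z \<eta>], of "\<bar>B\<bar>"] by (auto simp: X_def abs_mult)
    have "B * \<omega> z \<eta> * (f \<eta> - f (?\<tau> \<eta>)) \<le> \<bar>B * \<omega> z \<eta> * (f \<eta> - f (?\<tau> \<eta>))\<bar>" by simp
    also have "\<dots> = X * (\<bar>q - p\<bar> * (p + q))"
      unfolding X_def abs_mult[of "B * \<omega> z \<eta>"] p2 q2 abs_diff_squares[OF pq] ..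
    \<comment> \<open>Young's inequality with parameter \<alpha> \<epsilon>: the energy carries the
      rate, which is at least \<epsilon>.\<close>
    also have "\<dots> \<le> \<alpha> * \<epsilon> * (q - p)\<^sup>2 + X\<^sup>2 * (p\<^sup>2 + q\<^sup>2) / (2 * \<alpha> * \<epsilon>)"
      using young_diff_squares[of "\<alpha> * \<epsilon>" X q p] \<alpha> \<epsilon>_pos by (simp add: mult_ac)
    also have "\<dots> \<le> \<alpha> * (spin_rate a z \<eta> * (q - p)\<^sup>2) + B\<^sup>2 / (2 * \<alpha> * \<epsilon> ^ 3) * (p\<^sup>2 + q\<^sup>2)"
    proof (rule add_mono)
      show "\<alpha> * \<epsilon> * (q - p)\<^sup>2 \<le> \<alpha> * (spin_rate a z \<eta> * (q - p)\<^sup>2)"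
        using rate[OF \<eta>] \<alpha> by (simp add: mult_right_mono)
      have "X\<^sup>2 \<le> (\<bar>B\<bar> / \<epsilon>)\<^sup>2" using X by (intro power_mono) auto
      then have "X\<^sup>2 * (p\<^sup>2 + q\<^sup>2) / (2 * \<alpha> * \<epsilon>) \<le> (\<bar>B\<bar> / \<epsilon>)\<^sup>2 * (p\<^sup>2 + q\<^sup>2) / (2 * \<alpha> * \<epsilon>)"
        using \<alpha> \<epsilon>_pos by (intro divide_right_mono mult_right_mono) auto
      then show "X\<^sup>2 * (p\<^sup>2 + q\<^sup>2) / (2 * \<alpha> * \<epsilon>) \<le> B\<^sup>2 / (2 * \<alpha> * \<epsilon> ^ 3) * (p\<^sup>2 + q\<^sup>2)"
        by (simp add: power_divide power2_eq_square power3_eq_cube mult_ac)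
    qed
    finally have "\<nu> \<eta> * (B * \<omega> z \<eta> * (f \<eta> - f (?\<tau> \<eta>))) \<le>
        \<nu> \<eta> * (\<alpha> * (spin_rate a z \<eta> * (q - p)\<^sup>2) + B\<^sup>2 / (2 * \<alpha> * \<epsilon> ^ 3) * (p\<^sup>2 + q\<^sup>2))"
      using \<nu>_pos[OF \<eta>] by (intro mult_left_mono) auto
    also have "\<dots> = \<alpha> * (\<nu> \<eta> * spin_rate a z \<eta> * (q - p)\<^sup>2) + B\<^sup>2 / (2 * \<alpha> * \<epsilon> ^ 3) * (\<nu> \<eta> * p\<^sup>2 + \<nu> \<eta> * q\<^sup>2)"
      by (simp add: algebra_simps add_divide_distrib)
    also have "\<dots> \<le> \<alpha> * (\<nu> \<eta> * spin_rate a z \<eta> * (q - p)\<^sup>2) + B\<^sup>2 / (2 * \<alpha> * \<epsilon> ^ 3) * (m \<eta> + 1 / \<epsilon> * m (?\<tau> \<eta>))"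
    proof -
      have "\<nu> \<eta> * q\<^sup>2 \<le> \<nu> (?\<tau> \<eta>) / \<epsilon> * q\<^sup>2" using ratio[OF \<eta>] by (intro mult_right_mono) auto
      also have "\<dots> = 1 / \<epsilon> * m (?\<tau> \<eta>)" using \<nu>_f[OF in\<Omega>[OF \<eta>]] by (simp add: q2)
      finally show ?thesis
        using \<nu>_f[OF \<eta>] \<alpha> \<epsilon>_pos by (intro add_left_mono mult_left_mono) (auto simp: p2)
    qed
    finally show "\<nu> \<eta> * (B * \<omega> z \<eta> * (f \<eta> - f (?\<tau> \<eta>))) \<le>
      \<alpha> * (\<nu> \<eta> * spin_rate a z \<eta> * (sqrt (f (?\<tau> \<eta>)) - sqrt (f \<eta>))\<^sup>2)
       + B\<^sup>2 / (2 * \<alpha> * \<epsilon> ^ 3) * (m \<eta> + 1 / \<epsilon> * m (?\<tau> \<eta>))"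
      by (simp add: p_def q_def)
  qed
  also have "\<dots> = \<alpha> * energy (spin_rate a z) ?\<tau> + B\<^sup>2 / (2 * \<alpha> * \<epsilon> ^ 3) * (1 + 1 / \<epsilon>)"
    by (simp only: sum.distrib sum_distrib_left[symmetric] sum_involution[OF in\<Omega> involution] m_sum energy_def) simp
  also have "B\<^sup>2 / (2 * \<alpha> * \<epsilon> ^ 3) * (1 + 1 / \<epsilon>) \<le> B\<^sup>2 / (2 * \<alpha> * \<epsilon> ^ 3) * (2 / \<epsilon>)"
    using \<alpha> \<epsilon>_pos \<epsilon>1 by (intro mult_left_mono) (auto simp: field_simps)
  also have "\<dots> = B\<^sup>2 / (\<alpha> * \<epsilon> ^ 4)" by (simp add: power3_eq_cube power4_eq_xxxx mult_ac)
  finally have "2 * (B * E (\<omega> z)) \<le> \<alpha> * energy (spin_rate a z) ?\<tau> + B\<^sup>2 / (\<alpha> * \<epsilon> ^ 4)" by simp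
  moreover have "0 \<le> \<alpha> * energy (spin_rate a z) ?\<tau>"
    using \<alpha> rate \<epsilon>_pos by (intro mult_nonneg_nonneg energy_nonneg) (auto intro: order_trans less_imp_le)
  moreover have "0 \<le> B\<^sup>2 / (\<alpha> * \<epsilon> ^ 4)" using \<alpha> \<epsilon>_pos by simp
  ultimately show ?thesis by linarith
qed

end

section \<open>Correlations along a line\<close>

lemma card_vec_box:
  fixes A :: "'d::finite \<Rightarrow> 'a set"
  shows "card {x :: 'a ^ 'd. \<forall>k. x $ k \<in> A k} = (\<Prod>k \<in> UNIV. card (A k))"
proof -
  have "{x :: 'a ^ 'd. \<forall>k. x $ k \<in> A k} = vec_lambda ` (Pi\<^sub>E UNIV A)"
    by (auto simp: image_iff PiE_iff intro!: bexI[of _ "vec_nth _"])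
  moreover have "inj_on (vec_lambda :: ('d \<Rightarrow> 'a) \<Rightarrow> 'a ^ 'd) (Pi\<^sub>E UNIV A)"
    by (auto intro!: inj_onI simp: vec_lambda_inject)
  ultimately show ?thesis
    by (simp add: card_image card_PiE)
qed

lemma finite_vec_box:
  fixes A :: "'d::finite \<Rightarrow> 'a set"
  assumes "\<And>k. finite (A k)" shows "finite {x :: 'a ^ 'd. \<forall>k. x $ k \<in> A k}"
proof -
  have "{x :: 'a ^ 'd. \<forall>k. x $ k \<in> A k} = vec_lambda ` (Pi\<^sub>E UNIV A)"
    by (auto simp: image_iff PiE_iff intro!: bexI[of _ "vec_nth _"])
  then show ?thesis using assms by (simp add: finite_PiE)
qed

lemma finite_sites: "finite (sites n :: (int ^ 'd::finite) set)"
  using finite_vec_box[of "\<lambda>_ :: 'd. {0<..<int n}"] by (simp add: sites_def)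

lemma card_sites_slab:
  assumes "finite J"
  shows "card {x \<in> (sites n :: (int ^ 'd::finite) set). x $ i \<in> J} \<le> card J * n ^ (CARD('d) - 1)"
proof -
  define A :: "'d \<Rightarrow> int set" where "A k = (if k = i then J else {0<..<int n})" for k
  have "finite {x :: int ^ 'd. \<forall>k. x $ k \<in> A k}"
    using assms by (intro finite_vec_box) (simp add: A_def)
  then have "card {x \<in> (sites n :: (int ^ 'd) set). x $ i \<in> J} \<le> card {x :: int ^ 'd. \<forall>k. x $ k \<in> A k}"
    by (intro card_mono) (auto simp: sites_def A_def)
  also have "\<dots> = card (A i) * (\<Prod>k \<in> UNIV - {i}. card (A k))"
    by (simp add: card_vec_box prod.remove[of UNIV i])
  also have "(\<Prod>k \<in> UNIV - {i}. card (A k)) \<le> (\<Prod>k \<in> UNIV - {i}. n)"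
    by (intro prod_mono) (auto simp: A_def)
  also have "\<dots> = n ^ (CARD('d) - 1)" by (simp add: card_Diff_singleton)
  finally show ?thesis by (simp add: A_def)
qed

lemma card_sites: "card (sites n :: (int ^ 'd::finite) set) \<le> n ^ CARD('d)"
proof -
  have "(sites n :: (int ^ 'd) set) = {x. \<forall>k. x $ k \<in> {0<..<int n}}" by (auto simp: sites_def)
  then have "card (sites n :: (int ^ 'd) set) = (n - 1) ^ CARD('d)"
    by (simp only: card_vec_box) (simp add: nat_diff_distrib')
  then show ?thesis by (simp add: power_mono)
qed

lemma card_subset_sites:
  assumes "A \<subseteq> (sites n :: (int ^ 'd::finite) set)" shows "real (card A) \<le> real n ^ CARD('d)"
  using order_trans[OF card_mono[OF finite_sites assms] card_sites] by (metis of_nat_le_iff of_nat_power)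

lemma card_sites_edge:
  assumes "finite J" "i \<noteq> j"
  shows "card {x \<in> (sites n :: (int ^ 'd::finite) set). x $ i \<in> J \<and> x $ j \<in> J} \<le> (card J)\<^sup>2 * n ^ (CARD('d) - 2)"
proof -
  define A :: "'d \<Rightarrow> int set" where "A k = (if k = i \<or> k = j then J else {0<..<int n})" for k
  have "finite {x :: int ^ 'd. \<forall>k. x $ k \<in> A k}"
    using assms by (intro finite_vec_box) (simp add: A_def)
  then have "card {x \<in> (sites n :: (int ^ 'd) set). x $ i \<in> J \<and> x $ j \<in> J} \<le> card {x :: int ^ 'd. \<forall>k. x $ k \<in> A k}"
    by (intro card_mono) (auto simp: sites_def A_def)
  also have "\<dots> = card (A i) * (card (A j) * (\<Prod>k \<in> UNIV - {i} - {j}. card (A k)))"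
    using assms by (simp add: card_vec_box prod.remove[of UNIV i] prod.remove[of "UNIV - {i}" j])
  also have "(\<Prod>k \<in> UNIV - {i} - {j}. card (A k)) \<le> (\<Prod>k \<in> UNIV - {i} - {j}. n)"
    by (intro prod_mono) (auto simp: A_def)
  also have "\<dots> = n ^ (CARD('d) - 2)"
    using assms by (simp add: card_Diff_singleton numeral_2_eq_2)
  finally show ?thesis by (simp add: A_def power2_eq_square mult.assoc)
qed

text \<open>A bond in direction \<open>i\<close> is represented by its lower end, so that every
  unordered nearest-neighbour pair occurs exactly once over all directions.\<close>

definition bonds :: "nat \<Rightarrow> 'd \<Rightarrow> (int ^ 'd::finite) set" where
  "bonds n i = {x \<in> sites n. x + axis i 1 \<in> sites n}"

lemma finite_bonds: "finite (bonds n i)"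
  by (rule finite_subset[OF _ finite_sites[of n]]) (auto simp: bonds_def)

context bernoulli_density
begin

abbreviation bond_energy :: "int ^ 'd \<Rightarrow> int ^ 'd \<Rightarrow> real" where
  "bond_energy x y \<equiv> energy (\<lambda>_. 1) (exchange x y)"

text \<open>Expand \<open>E (\<Sum>j < \<l>. \<eta> (y j) - q)\<^sup>2 \<ge> 0\<close>. Every off-diagonal correlation can be carried to the
  first bond by moving one particle at a time along the line, without crossing the other, at the
  cost of the energies of the bonds passed.\<close>

lemma line_correlation_ge:
  fixes y :: "nat \<Rightarrow> int ^ 'd"
  assumes \<l>: "2 \<le> \<l>" and inj: "inj_on y {..<\<l>}" and S: "\<And>j. j < \<l> \<Longrightarrow> y j \<in> S"
    and \<delta>: "\<And>j. Suc j < \<l> \<Longrightarrow> \<bar>r (y j) - r (y (Suc j))\<bar> \<le> \<delta>" "\<delta> \<le> 1"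
    and \<alpha>: "0 < \<alpha>" and q: "0 \<le> q" "q \<le> 1"
  shows "- 1 / real (\<l> - 1) - 2 * (\<Sum>j < \<l> - 1. \<alpha> * bond_energy (y j) (y (Suc j)) + 3 / \<epsilon>\<^sup>2 * (1 / \<alpha> + \<delta>))
    \<le> E (\<lambda>\<eta>. (real (\<eta> (y 0)) - q) * (real (\<eta> (y 1)) - q))"
proof -
  define err where "err j = \<alpha> * bond_energy (y j) (y (Suc j)) + 3 / \<epsilon>\<^sup>2 * (1 / \<alpha> + \<delta>)" for j
  define W where "W = (\<Sum>j < \<l> - 1. err j)"
  \<comment> \<open>One common \<open>q\<close> for both points: sliding a point along the line then
    changes an occupation number and nothing else. The exact centring at the second site is restored
    in \<open>bulk_quadratic_bound\<close> at cost \<delta>.\<close>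
  define C where "C j k = E (\<lambda>\<eta>. (real (\<eta> (y j)) - q) * (real (\<eta> (y k)) - q))" for j k
  have \<delta>0: "0 \<le> \<delta>" using \<delta>(1)[of 0] \<l> by (auto intro: order_trans[OF abs_ge_zero])
  have err0: "0 \<le> err j" for j
    unfolding err_def using \<alpha> \<delta>0 by (intro add_nonneg_nonneg mult_nonneg_nonneg energy_nonneg) auto
  have neq: "y j \<noteq> y k" if "j \<noteq> k" "j < \<l>" "k < \<l>" for j k
    using inj that by (auto dest: inj_onD)
  have bd: "\<bar>real (\<eta> (y k)) - q\<bar> \<le> 1" if "\<eta> \<in> \<Omega>" "k < \<l>" for \<eta> k
    using value_cases[OF that(1) S[OF that(2)]] q by auto
  have sym: "C j k = C k j" for j k unfolding C_def by (simp add: mult.commute)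
  have step: "\<bar>C j k - C (Suc j) k\<bar> \<le> err j" if "Suc j < \<l>" "k < \<l>" "k \<noteq> j" "k \<noteq> Suc j" for j k
  proof -
    have "C j k - C (Suc j) k = E (\<lambda>\<eta>. (real (\<eta> (y k)) - q) * (real (\<eta> (y j)) - real (\<eta> (y (Suc j)))))"
      unfolding C_def E_diff[symmetric] by (intro E_cong) (simp add: algebra_simps)
    also have "\<bar>\<dots>\<bar> \<le> err j"
      unfolding err_def
      \<comment> \<open>The factor at \<open>y k\<close> plays the role of \<open>h\<close>; it is
        invariant under the swap because \<open>k\<close> is neither \<open>j\<close> nor
        \<open>Suc j\<close>.\<close>
      using that neq[of k j] neq[of k "Suc j"] neq[of j "Suc j"]
      by (intro exchange_replacement S \<delta> \<alpha> bd) (auto simp: exchange_def)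
    finally show ?thesis .
  qed
  have sum_le: "(\<Sum>i \<in> I. err i) \<le> W" if "I \<subseteq> {..<\<l> - 1}" for I
    unfolding W_def using that err0 by (intro sum_mono2) auto
  \<comment> \<open>For \<open>j < k\<close> the left point slides down to 0 while the right one
    rests; afterwards the right point slides down to 1 while the left one rests at 0. The two never
    meet, and each leg costs at most \<open>W\<close>.\<close>
  have left: "C j k \<le> C 0 k + (\<Sum>i < j. err i)" if "j < k" "k < \<l>" for j k
    using that
  proof (induction j)
    case (Suc j)
    then show ?case using step[of j k] by (auto simp: abs_le_iff)
  qed simp
  have right: "C 0 (Suc k) \<le> C 0 1 + (\<Sum>i = 1..<Suc k. err i)" if "Suc k < \<l>" for k
    using that
  proof (induction k)
    case (Suc k)
    then show ?case using step[of "Suc k" 0] by (auto simp: abs_le_iff sym[of 0])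
  qed simp
  have less: "C j k \<le> C 0 1 + 2 * W" if "j < k" "k < \<l>" for j k
  proof -
    obtain k' where k': "k = Suc k'" using \<open>j < k\<close> by (metis not0_implies_Suc not_less_zero)
    have "j \<le> \<l> - 1" using that by arith
    then have "C j k \<le> C 0 k + W"
      using left[OF that] sum_le[of "{..<j}"] by simp
    moreover have sub: "{1..<Suc k'} \<subseteq> {..<\<l> - 1}" using that k' by auto
    have "C 0 k \<le> C 0 1 + W"
      using right[of k'] sum_le[OF sub] that k' by simp
    ultimately show ?thesis by simp
  qed
  have off: "C j k \<le> C 0 1 + 2 * W" if "j \<noteq> k" "j < \<l>" "k < \<l>" for j k
    using that less[of j k] less[of k j] sym[of j k] by (cases "j < k") auto
  have diag: "C j j \<le> 1" if "j < \<l>" for j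
  proof -
    have "\<bar>C j j\<bar> \<le> 1"
      unfolding C_def
    proof (rule abs_E_le)
      fix \<eta> assume "\<eta> \<in> \<Omega>"
      then show "\<bar>(real (\<eta> (y j)) - q) * (real (\<eta> (y j)) - q)\<bar> \<le> 1"
        unfolding abs_mult using bd[OF _ that] by (intro mult_le_one) auto
    qed
    then show ?thesis by simp
  qed
  have "0 \<le> E (\<lambda>\<eta>. (\<Sum>j < \<l>. real (\<eta> (y j)) - q)\<^sup>2)"
    using E_mono[of "\<lambda>_. 0" "\<lambda>\<eta>. (\<Sum>j < \<l>. real (\<eta> (y j)) - q)\<^sup>2"] by (simp add: E_const)
  also have "\<dots> = (\<Sum>j < \<l>. \<Sum>k < \<l>. C j k)"
    unfolding power2_eq_square sum_product C_def E_sum ..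
  \<comment> \<open>Each row has one diagonal entry, at most 1, and \<l> - 1 off-diagonal ones;
    their ratio is the error 1 / (\<l> - 1).\<close>
  also have "\<dots> \<le> (\<Sum>j < \<l>. 1 + real (\<l> - 1) * (C 0 1 + 2 * W))"
  proof (rule sum_mono)
    fix j assume "j \<in> {..<\<l>}"
    then have "(\<Sum>k < \<l>. C j k) = C j j + (\<Sum>k \<in> {..<\<l>} - {j}. C j k)"
      by (simp add: sum.remove)
    also have "\<dots> \<le> 1 + (\<Sum>k \<in> {..<\<l>} - {j}. C 0 1 + 2 * W)"
      using \<open>j \<in> _\<close> by (intro add_mono diag sum_mono off) auto
    also have "\<dots> = 1 + real (\<l> - 1) * (C 0 1 + 2 * W)"
      using \<open>j \<in> _\<close> \<l> by (simp add: card_Diff_singleton of_nat_diff)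
    finally show "(\<Sum>k < \<l>. C j k) \<le> 1 + real (\<l> - 1) * (C 0 1 + 2 * W)" .
  qed
  also have "\<dots> = real \<l> * (1 + real (\<l> - 1) * (C 0 1 + 2 * W))"
    by (simp only: sum_constant card_lessThan)
  finally have "0 \<le> 1 + real (\<l> - 1) * (C 0 1 + 2 * W)"
    using \<l> by (simp add: zero_le_mult_iff)
  then have "- 1 \<le> (C 0 1 + 2 * W) * real (\<l> - 1)" by (simp add: mult.commute)
  then have "- 1 / real (\<l> - 1) \<le> C 0 1 + 2 * W"
    using \<l> by (subst pos_divide_le_eq) auto
  then show ?thesis
    by (simp add: C_def W_def err_def)
qed

text \<open>The energy on the right is exactly the one that the exchange dynamics dissipates; bonds too
  close to the far face for a line of length \<open>\<l>\<close> are bounded trivially and contribute the term of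
  order \<open>n ^ (d - 1)\<close>.\<close>

lemma bulk_quadratic_bound:
  assumes S: "S = sites n" and L: "1 \<le> L" "L \<le> real n" and \<l>: "2 \<le> \<l>"
    and lip: "\<And>x. x \<in> bonds n i \<Longrightarrow> real n * \<bar>r x - r (x + axis i 1)\<bar> \<le> L"
    and c: "c = L\<^sup>2 / \<epsilon> ^ 4"
  shows "- (\<Sum>x \<in> bonds n i. (real n * (r x - r (x + axis i 1)))\<^sup>2 * E (\<lambda>\<eta>. \<omega> x \<eta> * \<omega> (x + axis i 1) \<eta>))
    \<le> (real n)\<^sup>2 * (\<Sum>x \<in> bonds n i. bond_energy x (x + axis i 1))
      + c / real (\<l> - 1) * real n ^ CARD('d)
      + c * (6 * real \<l> / \<epsilon>\<^sup>2 * (2 * real \<l> * c + L) + L + real \<l>) * real n ^ (CARD('d) - 1)"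
proof -
  define e :: "int ^ 'd" where "e = axis i 1"
  \<comment> \<open>A line of \<l> sites starting at such an \<open>x\<close> ends at coordinate x_i
    + \<l> - 1 \<le> n - 1, the last one inside the box.\<close>
  define fit where "fit = {x \<in> bonds n i. x $ i + int \<l> \<le> int n}"
  \<comment> \<open>The solution of 2 c \<l> \<alpha> = n^2: the squared gradient with its variances
    is at most \<open>c\<close>, a correlation costs 2 \<open>W\<close>, and each bond is passed by
    at most \<l> lines, so the energy spent has coefficient n^2.\<close>
  define \<alpha> where "\<alpha> = (real n)\<^sup>2 / (2 * real \<l> * c)"
  define \<delta> where "\<delta> = L / real n"
  define \<kappa> where "\<kappa> = 3 / \<epsilon>\<^sup>2 * (1 / \<alpha> + \<delta>)"
  define W where "W x = (\<Sum>j < \<l> - 1. \<alpha> * bond_energy (x + of_nat j *s e) (x + of_nat (Suc j) *s e) + \<kappa>)" for x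
  have n: "0 < n" using L by (cases n) auto
  have c0: "0 < c" using L \<epsilon>_pos by (simp add: c)
  have \<alpha>: "0 < \<alpha>" using n \<l> c0 by (simp add: \<alpha>_def)
  have bonds_in: "x \<in> S" "x + e \<in> S" if "x \<in> bonds n i" for x
    using that by (auto simp: bonds_def S e_def)
  have xe: "x \<noteq> x + e" for x by (auto simp: e_def axis_eq_0_iff)
  have \<delta>0: "0 \<le> \<delta>" using L by (simp add: \<delta>_def)
  have \<kappa>0: "0 \<le> \<kappa>" using \<alpha> \<delta>0 by (simp add: \<kappa>_def)
  have en0: "0 \<le> bond_energy x y" for x y by (intro energy_nonneg) auto
  have shift: "x + of_nat j *s e \<in> bonds n i" if "x \<in> fit" "Suc j < \<l>" for x j
    using that unfolding fit_def bonds_def sites_def e_def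
    by (auto simp: axis_def intro!: add_pos_nonneg add_nonneg_nonneg intro: less_imp_le)
  have fin: "finite (bonds n i)" by (rule finite_bonds)
  have lip': "\<bar>r x - r (x + e)\<bar> \<le> \<delta>" if "x \<in> bonds n i" for x
    using lip[OF that] n by (simp add: \<delta>_def e_def field_simps)
  define Q where "Q x = E (\<lambda>\<eta>. (real (\<eta> x) - r x) * (real (\<eta> (x + e)) - r (x + e)))" for x
  \<comment> \<open>\<open>c\<close> bounds the squared discrete gradient, at most L^2, divided by
    the two variances r (1 - r), each at least \<epsilon>^2.\<close>
  have coeff: "- ((real n * (r x - r (x + e)))\<^sup>2 * E (\<lambda>\<eta>. \<omega> x \<eta> * \<omega> (x + e) \<eta>)) \<le> c * b"
    if x: "x \<in> bonds n i" and b: "- Q x \<le> b" "0 \<le> b" for x b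
  proof -
    have sq: "(real n * (r x - r (x + e)))\<^sup>2 \<le> L\<^sup>2"
      using lip[OF x] L by (intro power2_le_iff_abs_le[THEN iffD2]) (auto simp: abs_mult e_def)
    define v where "v y = r y * (1 - r y)" for y
    have v: "\<epsilon>\<^sup>2 \<le> v y" if "y \<in> S" for y
      unfolding v_def power2_eq_square using r_ge[OF that] r_le[OF that] \<epsilon>_pos by (intro mult_mono) auto
    have v0: "0 < v x" "0 < v (x + e)"
      using v[OF bonds_in(1)[OF x]] v[OF bonds_in(2)[OF x]] zero_less_power[OF \<epsilon>_pos] order_less_le_trans by blast+
    have "E (\<lambda>\<eta>. \<omega> x \<eta> * \<omega> (x + e) \<eta>) = E (\<lambda>\<eta>. 1 / (v x * v (x + e)) * ((real (\<eta> x) - r x) * (real (\<eta> (x + e)) - r (x + e))))"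
      by (simp add: \<omega>_def v_def)
    also have "\<dots> = 1 / (v x * v (x + e)) * Q x" unfolding Q_def by (rule E_cmult)
    finally have "- E (\<lambda>\<eta>. \<omega> x \<eta> * \<omega> (x + e) \<eta>) = 1 / (v x * v (x + e)) * (- Q x)" by simp
    also have "\<dots> \<le> 1 / (v x * v (x + e)) * b"
      using b v0 by (intro mult_left_mono) auto
    also have "\<dots> \<le> 1 / (\<epsilon>\<^sup>2 * \<epsilon>\<^sup>2) * b"
    proof -
      have "\<epsilon>\<^sup>2 * \<epsilon>\<^sup>2 \<le> v x * v (x + e)"
        using v0 by (intro mult_mono v bonds_in x) auto
      then show ?thesis
        using b v0 \<epsilon>_pos by (intro mult_right_mono divide_left_mono) auto
    qed
    finally have "- E (\<lambda>\<eta>. \<omega> x \<eta> * \<omega> (x + e) \<eta>) \<le> b / \<epsilon> ^ 4" by (simp add: power4_eq_xxxx power2_eq_square mult.assoc)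
    then have "(real n * (r x - r (x + e)))\<^sup>2 * - E (\<lambda>\<eta>. \<omega> x \<eta> * \<omega> (x + e) \<eta>) \<le>
        (real n * (r x - r (x + e)))\<^sup>2 * (b / \<epsilon> ^ 4)"
      by (intro mult_left_mono) auto
    also have "\<dots> \<le> L\<^sup>2 * (b / \<epsilon> ^ 4)"
      using sq b \<epsilon>_pos by (intro mult_right_mono) auto
    finally show ?thesis by (simp add: c)
  qed
  have Q_abs: "\<bar>E (\<lambda>\<eta>. (real (\<eta> x) - q) * (real (\<eta> y) - q'))\<bar> \<le> 1"
    if "x \<in> S" "y \<in> S" "0 \<le> q" "q \<le> 1" "0 \<le> q'" "q' \<le> 1" for x y q q'
  proof (rule abs_E_le)
    fix \<eta> assume "\<eta> \<in> \<Omega>"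
    then have "\<bar>real (\<eta> x) - q\<bar> \<le> 1" "\<bar>real (\<eta> y) - q'\<bar> \<le> 1"
      using value_cases[of \<eta> x] value_cases[of \<eta> y] that by auto
    then show "\<bar>(real (\<eta> x) - q) * (real (\<eta> y) - q')\<bar> \<le> 1" by (simp add: abs_mult mult_le_one)
  qed
  have r01: "0 \<le> r x" "r x \<le> 1" if "x \<in> S" for x
    using r_pos[OF that] r_less[OF that] by auto
  have fit_bound: "- Q x \<le> 1 / real (\<l> - 1) + 2 * W x + \<delta>" if x: "x \<in> fit" for x
  proof -
    have xb: "x \<in> bonds n i" using x by (simp add: fit_def)
    have inS: "x + of_nat j *s e \<in> S" if "j < \<l>" for j
    proof (cases j)
      case 0 then show ?thesis using bonds_in(1)[OF xb] by simp
    next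
      case (Suc k)
      then have "x + of_nat k *s e + e \<in> S" using shift[OF x, of k] bonds_in that by auto
      then show ?thesis using Suc by (simp add: algebra_simps vec_eq_iff)
    qed
    have "- 1 / real (\<l> - 1) - 2 * W x \<le>
        E (\<lambda>\<eta>. (real (\<eta> (x + of_nat 0 *s e)) - r x) * (real (\<eta> (x + of_nat 1 *s e)) - r x))"
      unfolding W_def \<kappa>_def
    proof (rule line_correlation_ge[OF \<l> _ inS])
      show "inj_on (\<lambda>j. x + of_nat j *s e) {..<\<l>}"
        by (rule inj_onI) (auto simp: e_def vec_eq_iff axis_def dest: spec[of _ i])
      show "\<bar>r (x + of_nat j *s e) - r (x + of_nat (Suc j) *s e)\<bar> \<le> \<delta>" if "Suc j < \<l>" for j
        using lip'[OF shift[OF x that]] by (simp add: algebra_simps vector_sadd_rdistrib)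
      show "\<delta> \<le> 1" using L n by (simp add: \<delta>_def)
    qed (use \<alpha> r01 bonds_in(1)[OF xb] in auto)
    also have "\<dots> = E (\<lambda>\<eta>. (real (\<eta> x) - r x) * (real (\<eta> (x + e)) - r x))" by simp
    \<comment> \<open>Recentres the second factor from \<open>r x\<close> to
      \<open>r (x + e)\<close>; the correction is at most \<delta>.\<close>
    also have "\<dots> = Q x + (r (x + e) - r x) * E (\<lambda>\<eta>. real (\<eta> x) - r x)"
      unfolding Q_def E_cmult[symmetric] E_add[symmetric] by (intro E_cong) (simp add: algebra_simps)
    also have "(r (x + e) - r x) * E (\<lambda>\<eta>. real (\<eta> x) - r x) \<le> \<bar>r (x + e) - r x\<bar> * \<bar>E (\<lambda>\<eta>. real (\<eta> x) - r x)\<bar>"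
      using abs_ge_self by (metis abs_mult)
    also have "\<dots> \<le> \<delta> * 1"
    proof (rule mult_mono)
      show "\<bar>r (x + e) - r x\<bar> \<le> \<delta>" using lip'[OF xb] by (simp add: abs_minus_commute)
      show "\<bar>E (\<lambda>\<eta>. real (\<eta> x) - r x)\<bar> \<le> 1"
        using value_cases[OF _ bonds_in(1)[OF xb]] r01[OF bonds_in(1)[OF xb]]
        by (intro abs_E_le) fastforce
    qed (use \<delta>0 in auto)
    finally show ?thesis by simp
  qed
  have W0: "0 \<le> W x" for x
    unfolding W_def using \<alpha> \<kappa>0 en0 by (intro sum_nonneg add_nonneg_nonneg mult_nonneg_nonneg) auto
  have card_fit: "real (card fit) \<le> real n ^ CARD('d)"
    by (rule card_subset_sites) (auto simp: fit_def bonds_def)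
  have sumW: "(\<Sum>x \<in> fit. W x) \<le> real \<l> * (\<alpha> * (\<Sum>x \<in> bonds n i. bond_energy x (x + e))) + real \<l> * \<kappa> * real n ^ CARD('d)"
  proof -
    have "(\<Sum>x \<in> fit. W x) = (\<Sum>j < \<l> - 1. \<Sum>x \<in> fit. \<alpha> * bond_energy (x + of_nat j *s e) (x + of_nat (Suc j) *s e) + \<kappa>)"
      unfolding W_def by (rule sum.swap)
    also have "\<dots> \<le> (\<Sum>j < \<l> - 1. \<alpha> * (\<Sum>x \<in> bonds n i. bond_energy x (x + e)) + \<kappa> * real n ^ CARD('d))"
    proof (rule sum_mono)
      fix j assume j: "j \<in> {..<\<l> - 1}"
      \<comment> \<open>For a fixed offset the translation is injective, so every bond occurs at
        most once; all \<l> - 1 offsets together count it fewer than \<l> times.\<close>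
      have "(\<Sum>x \<in> fit. bond_energy (x + of_nat j *s e) (x + of_nat (Suc j) *s e)) =
          (\<Sum>x \<in> (\<lambda>x. x + of_nat j *s e) ` fit. bond_energy x (x + e))"
        by (subst sum.reindex) (auto simp: inj_on_def algebra_simps vector_sadd_rdistrib)
      also have "\<dots> \<le> (\<Sum>x \<in> bonds n i. bond_energy x (x + e))"
        using shift j by (intro sum_mono2 fin en0) auto
      finally have 1: "\<alpha> * (\<Sum>x \<in> fit. bond_energy (x + of_nat j *s e) (x + of_nat (Suc j) *s e)) \<le> \<alpha> * (\<Sum>x \<in> bonds n i. bond_energy x (x + e))"
        using \<alpha> by (intro mult_left_mono) auto
      have 2: "real (card fit) * \<kappa> \<le> \<kappa> * real n ^ CARD('d)"
        using \<kappa>0 card_fit by (simp add: mult.commute mult_left_mono)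
      show "(\<Sum>x \<in> fit. \<alpha> * bond_energy (x + of_nat j *s e) (x + of_nat (Suc j) *s e) + \<kappa>)
        \<le> \<alpha> * (\<Sum>x \<in> bonds n i. bond_energy x (x + e)) + \<kappa> * real n ^ CARD('d)"
        using 1 2 by (simp add: sum.distrib sum_distrib_left[symmetric])
    qed
    also have "\<dots> = real (\<l> - 1) * (\<alpha> * (\<Sum>x \<in> bonds n i. bond_energy x (x + e)) + \<kappa> * real n ^ CARD('d))"
      by simp
    also have "\<dots> \<le> real \<l> * (\<alpha> * (\<Sum>x \<in> bonds n i. bond_energy x (x + e)) + \<kappa> * real n ^ CARD('d))"
      using \<alpha> \<kappa>0 en0 by (intro mult_right_mono add_nonneg_nonneg mult_nonneg_nonneg sum_nonneg) auto
    finally show ?thesis by (simp add: distrib_left mult_ac)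
  qed
  have card_nonfit: "real (card (bonds n i - fit)) \<le> real \<l> * real n ^ (CARD('d) - 1)"
  proof -
    have "card (bonds n i - fit) \<le> card {x \<in> (sites n :: (int ^ 'd) set). x $ i \<in> {int n - int \<l> <..< int n}}"
      by (intro card_mono finite_subset[OF _ finite_sites[of n]]) (auto simp: fit_def bonds_def sites_def)
    also have "\<dots> \<le> card {int n - int \<l> <..< int n} * n ^ (CARD('d) - 1)"
      by (rule card_sites_slab) simp
    also have "\<dots> \<le> \<l> * n ^ (CARD('d) - 1)" by (intro mult_right_mono) auto
    finally show ?thesis by (metis of_nat_le_iff of_nat_mult of_nat_power)
  qed
  let ?T = "\<lambda>x. - ((real n * (r x - r (x + e)))\<^sup>2 * E (\<lambda>\<eta>. \<omega> x \<eta> * \<omega> (x + e) \<eta>))"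
  have "(\<Sum>x \<in> bonds n i. ?T x) = (\<Sum>x \<in> bonds n i - fit. ?T x) + (\<Sum>x \<in> fit. ?T x)"
    using fin by (intro sum.subset_diff) (auto simp: fit_def)
  also have "(\<Sum>x \<in> bonds n i - fit. ?T x) \<le> (\<Sum>x \<in> bonds n i - fit. c * 1)"
  proof (intro sum_mono coeff)
    fix x assume "x \<in> bonds n i - fit"
    then show "- Q x \<le> 1"
      using Q_abs[of x "x + e" "r x" "r (x + e)"] bonds_in[of x] r01 unfolding Q_def by (auto simp: abs_le_iff)
  qed auto
  also have "\<dots> \<le> c * (real \<l> * real n ^ (CARD('d) - 1))"
    using card_nonfit c0 by simp
  also have "(\<Sum>x \<in> fit. ?T x) \<le> (\<Sum>x \<in> fit. c * (1 / real (\<l> - 1) + 2 * W x + \<delta>))"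
    using W0 \<delta>0 by (intro sum_mono coeff fit_bound) (auto simp: fit_def)
  also have "\<dots> = c * (real (card fit) * (1 / real (\<l> - 1) + \<delta>) + 2 * (\<Sum>x \<in> fit. W x))"
    by (simp only: sum_distrib_left[symmetric] sum.distrib sum_constant) (simp add: algebra_simps)
  also have "\<dots> \<le> c * (real n ^ CARD('d) * (1 / real (\<l> - 1) + \<delta>) +
      2 * (real \<l> * (\<alpha> * (\<Sum>x \<in> bonds n i. bond_energy x (x + e))) + real \<l> * \<kappa> * real n ^ CARD('d)))"
    using c0 \<delta>0 card_fit sumW by (intro mult_left_mono add_mono mult_right_mono) auto
  also have "\<dots> = (real n)\<^sup>2 * (\<Sum>x \<in> bonds n i. bond_energy x (x + e))
      + c / real (\<l> - 1) * real n ^ CARD('d) + c * (2 * real \<l> * \<kappa> + \<delta>) * real n ^ CARD('d)"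
    using c0 \<l> by (simp add: \<alpha>_def field_simps)
  also have "c * (2 * real \<l> * \<kappa> + \<delta>) * real n ^ CARD('d) \<le>
      c * (6 * real \<l> / \<epsilon>\<^sup>2 * (2 * real \<l> * c + L) + L) * real n ^ (CARD('d) - 1)"
  proof -
    have nd: "real n ^ CARD('d) = real n * real n ^ (CARD('d) - 1)"
      by (simp add: power_eq_if[of _ "CARD('d)"])
    \<comment> \<open>\<alpha> is of order n^2 and \<delta> of order 1 / n, so \<kappa> is of order
      1 / n: for fixed \<l> the transport errors gain a full power of n.\<close>
    have "1 / \<alpha> * real n = 2 * real \<l> * c / real n"
      using n by (simp add: \<alpha>_def power2_eq_square)
    also have "\<dots> \<le> 2 * real \<l> * c" 
      using mult_left_mono[of 1 "real n" "2 * real \<l> * c"] n c0 by (simp add: divide_le_eq)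
    finally have "3 / \<epsilon>\<^sup>2 * (1 / \<alpha> * real n + L) \<le> 3 / \<epsilon>\<^sup>2 * (2 * real \<l> * c + L)"
      by (intro mult_left_mono) auto
    then have "\<kappa> * real n \<le> 3 / \<epsilon>\<^sup>2 * (2 * real \<l> * c + L)"
      using n by (simp add: \<kappa>_def \<delta>_def algebra_simps)
    then have "2 * real \<l> * (\<kappa> * real n) \<le> 2 * real \<l> * (3 / \<epsilon>\<^sup>2 * (2 * real \<l> * c + L))"
      by (intro mult_left_mono) auto
    then have "(2 * real \<l> * \<kappa> + \<delta>) * real n \<le> 6 * real \<l> / \<epsilon>\<^sup>2 * (2 * real \<l> * c + L) + L"
      using n by (simp add: \<delta>_def algebra_simps add_divide_distrib)
    then have "c * ((2 * real \<l> * \<kappa> + \<delta>) * real n) * real n ^ (CARD('d) - 1) \<le>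
        c * (6 * real \<l> / \<epsilon>\<^sup>2 * (2 * real \<l> * c + L) + L) * real n ^ (CARD('d) - 1)"
      using c0 by (intro mult_right_mono mult_left_mono) auto
    then show ?thesis by (simp add: nd mult_ac)
  qed
  finally show ?thesis
    by (simp add: e_def[symmetric] sum_negf[symmetric] algebra_simps)
qed

end

section \<open>Entropy production of the dynamics\<close>

lemma l1_norm_eq_1_iff:
  fixes x y :: "int ^ 'd::finite"
  shows "l1_norm (x - y) = 1 \<longleftrightarrow> (\<exists>i. y = x + axis i 1 \<or> x = y + axis i 1)"
proof
  assume l: "l1_norm (x - y) = 1"
  define z where "z = x - y"
  have sum: "(\<Sum>i \<in> UNIV. \<bar>z $ i\<bar>) = 1" using l by (simp add: z_def l1_norm_def)
  then obtain i where i: "z $ i \<noteq> 0" by (metis abs_zero sum.neutral zero_neq_one)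
  have split: "\<bar>z $ i\<bar> + (\<Sum>k \<in> UNIV - {i}. \<bar>z $ k\<bar>) = 1"
    using sum by (simp add: sum.remove[of UNIV i])
  have "0 \<le> (\<Sum>k \<in> UNIV - {i}. \<bar>z $ k\<bar>)" by (intro sum_nonneg) auto
  then have zi: "\<bar>z $ i\<bar> = 1" and rest: "(\<Sum>k \<in> UNIV - {i}. \<bar>z $ k\<bar>) = 0"
    using split i by linarith+
  have zk: "z $ k = 0" if "k \<noteq> i" for k
    using rest that by (subst (asm) sum_nonneg_eq_0_iff) auto
  show "\<exists>i. y = x + axis i 1 \<or> x = y + axis i 1"
  proof (cases "z $ i = 1")
    case True
    then have "z = axis i 1" using zk by (auto simp: vec_eq_iff axis_def)
    then show ?thesis by (auto simp: z_def algebra_simps intro!: exI[of _ i])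
  next
    case False
    then have "z = - axis i 1" using zk zi by (auto simp: vec_eq_iff axis_def)
    then show ?thesis by (auto simp: z_def algebra_simps intro!: exI[of _ i])
  qed
next
  have [simp]: "(\<Sum>k \<in> UNIV. \<bar>axis i (1 :: int) $ k\<bar>) = 1" for i :: 'd
    by (simp add: axis_def if_distrib[of abs] cong: if_cong)
  assume "\<exists>i. y = x + axis i 1 \<or> x = y + axis i 1"
  then show "l1_norm (x - y) = 1" by (auto simp: l1_norm_def)
qed

text \<open>The ordered neighbour pairs are two images of the bonds, one for each orientation. They
  are disjoint because two positive unit steps never return to the starting point.\<close>

lemma sum_neighbours:
  fixes h :: "int ^ 'd::finite \<Rightarrow> int ^ 'd \<Rightarrow> real"
  shows "(\<Sum>(x, y) \<in> {(x, y). x \<in> sites n \<and> y \<in> sites n \<and> l1_norm (x - y) = 1}. h x y) =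
    (\<Sum>i \<in> UNIV. \<Sum>x \<in> bonds n i. h x (x + axis i 1) + h (x + axis i 1) x)"
proof -
  let ?P = "{(x, y). x \<in> (sites n :: (int ^ 'd) set) \<and> y \<in> sites n \<and> l1_norm (x - y) = 1}"
  let ?B = "SIGMA i:UNIV. bonds n i"
  let ?u = "\<lambda>(i, x). (x, x + axis i (1 :: int)) :: (int ^ 'd) \<times> (int ^ 'd)"
  let ?w = "\<lambda>(i, x). (x + axis i (1 :: int), x) :: (int ^ 'd) \<times> (int ^ 'd)"
  have fin: "finite ?B" by (simp add: finite_bonds)
  have P: "?P = ?u ` ?B \<union> ?w ` ?B"
    by (auto simp: l1_norm_eq_1_iff bonds_def image_iff split: prod.splits)
  have inj: "inj_on ?u ?B" "inj_on ?w ?B"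
    by (auto simp: inj_on_def axis_eq_axis)
  have "x + axis i 1 + axis j 1 \<noteq> x" for x :: "int ^ 'd" and i j
  proof
    assume "x + axis i 1 + axis j 1 = x"
    then have "(x + axis i 1 + axis j 1) $ i = x $ i" by (rule arg_cong)
    then show False by (simp only: vector_add_component axis_def) (simp split: if_splits)
  qed
  then have disj: "?u ` ?B \<inter> ?w ` ?B = {}" by auto
  have "(\<Sum>(x, y) \<in> ?P. h x y) = (\<Sum>(x, y) \<in> ?u ` ?B. h x y) + (\<Sum>(x, y) \<in> ?w ` ?B. h x y)"
    unfolding P using fin disj by (intro sum.union_disjoint) auto
  also have "\<dots> = (\<Sum>(i, x) \<in> ?B. h x (x + axis i 1)) + (\<Sum>(i, x) \<in> ?B. h (x + axis i 1) x)"
    using inj by (simp add: sum.reindex o_def case_prod_unfold)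
  also have "\<dots> = (\<Sum>i \<in> UNIV. \<Sum>x \<in> bonds n i. h x (x + axis i 1) + h (x + axis i 1) x)"
    by (simp add: sum.Sigma[symmetric] finite_bonds sum.distrib)
  finally show ?thesis .
qed

lemma exchange_commute: "exchange x y \<eta> = exchange y x \<eta>"
  by (auto simp: exchange_def fun_eq_iff)

text \<open>The swap is symmetric in its two sites, so both orientations contribute equally and
  cancel the factor 1/2 in \<open>bulk_gen\<close>.\<close>

lemma bulk_gen_bonds:
  "bulk_gen n f \<eta> = (\<Sum>i \<in> UNIV. \<Sum>x \<in> bonds n i. f (exchange x (x + axis i 1) \<eta>) - f \<eta>)"
proof -
  have two: "f (exchange x y \<eta>) - f \<eta> + (f (exchange y x \<eta>) - f \<eta>) = 2 * (f (exchange x y \<eta>) - f \<eta>)" for x y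
    by (simp add: exchange_commute[of y])
  have "bulk_gen n f \<eta> = 1 / 2 * (\<Sum>i \<in> UNIV. \<Sum>x \<in> bonds n i. 2 * (f (exchange x (x + axis i 1) \<eta>) - f \<eta>))"
    unfolding bulk_gen_def sum_neighbours two ..
  also have "\<dots> = (\<Sum>i \<in> UNIV. \<Sum>x \<in> bonds n i. f (exchange x (x + axis i 1) \<eta>) - f \<eta>)"
    by (simp only: sum_distrib_left mult.assoc[symmetric]) simp
  finally show ?thesis .
qed

text \<open>The graph Laplacian of the box. A missing neighbour contributes nothing, so at boundary
  sites a one-sided difference remains; after multiplication by n^2 it is of order n for a smooth
  profile.\<close>

definition lattice_laplacian :: "nat \<Rightarrow> (int ^ 'd::finite \<Rightarrow> real) \<Rightarrow> int ^ 'd \<Rightarrow> real" where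
  "lattice_laplacian n r x =
     (\<Sum>i \<in> UNIV. (if x \<in> bonds n i then r (x + axis i 1) - r x else 0) +
                  (if x - axis i 1 \<in> bonds n i then r (x - axis i 1) - r x else 0))"

text \<open>In every direction a site collects \<open>w\<close> once as lower and once as upper end
  of a bond. Bonds leaving the box are absent on both sides, so no boundary term arises.\<close>

lemma sum_by_parts_bonds:
  fixes r w :: "int ^ 'd::finite \<Rightarrow> real"
  shows "(\<Sum>i \<in> UNIV. \<Sum>x \<in> bonds n i. (r (x + axis i 1) - r x) * (w x - w (x + axis i 1))) =
    (\<Sum>x \<in> sites n. lattice_laplacian n r x * w x)"
proof -
  have "(\<Sum>x \<in> bonds n i. (r (x + axis i 1) - r x) * (w x - w (x + axis i 1))) =
      (\<Sum>x \<in> sites n. ((if x \<in> bonds n i then r (x + axis i 1) - r x else 0) +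
         (if x - axis i 1 \<in> bonds n i then r (x - axis i 1) - r x else 0)) * w x)" for i
  proof -
    have 1: "(\<Sum>x \<in> bonds n i. (r (x + axis i 1) - r x) * w x) =
        (\<Sum>x \<in> sites n. (if x \<in> bonds n i then r (x + axis i 1) - r x else 0) * w x)"
      by (rule sum.mono_neutral_cong_left) (auto simp: finite_sites bonds_def)
    have "(\<Sum>x \<in> bonds n i. (r x - r (x + axis i 1)) * w (x + axis i 1)) =
        (\<Sum>y \<in> (\<lambda>x. x + axis i 1) ` bonds n i. (r (y - axis i 1) - r y) * w y)"
      by (subst sum.reindex) (auto simp: inj_on_def)
    also have "\<dots> = (\<Sum>x \<in> sites n. (if x - axis i 1 \<in> bonds n i then r (x - axis i 1) - r x else 0) * w x)"
    proof (rule sum.mono_neutral_cong_left)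
      show "\<forall>x \<in> sites n - (\<lambda>x. x + axis i 1) ` bonds n i.
          (if x - axis i 1 \<in> bonds n i then r (x - axis i 1) - r x else 0) * w x = 0"
        by (auto simp: image_iff) (metis diff_add_cancel)
    qed (auto simp: finite_sites bonds_def)
    finally show ?thesis using 1
      by (simp add: distrib_right sum.distrib algebra_simps sum_subtractf)
  qed
  then show ?thesis
    unfolding lattice_laplacian_def by (simp add: sum_distrib_right) (rule sum.swap)
qed

context bernoulli_density
begin

text \<open>\<open>\<Lambda> x\<close> measures how far the profile is from solving the
  semi-discrete equation at \<open>x\<close>: discrete Laplacian plus reservoir exchange minus the
  time derivative \<open>\<tau> x\<close>. The linear terms of the swaps (after summation by parts),
  of the flips and of the reference measure all carry the factor \<open>\<omega> x\<close> and merge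
  into it.\<close>

lemma entropy_production_le:
  assumes S: "S = sites n" and b: "0 \<le> c * real n powr (- \<theta>)"
    and G: "\<And>z. z \<in> boundary_sites n \<Longrightarrow> 0 \<le> g (p (rescale n z)) \<and> g (p (rescale n z)) \<le> 1"
    and \<Lambda>: "\<And>x. x \<in> S \<Longrightarrow> \<Lambda> x = (real n)\<^sup>2 * lattice_laplacian n r x +
        (if x \<in> boundary_sites n then (real n)\<^sup>2 * (c * real n powr (- \<theta>)) * (g (p (rescale n x)) - r x) else 0) - \<tau> x"
  shows "E (\<lambda>\<eta>. (real n)\<^sup>2 * generator \<theta> c g p n (\<lambda>\<xi>. ln (f \<xi>)) \<eta> - (\<Sum>x \<in> S. \<tau> x * \<omega> x \<eta>)) \<le>
    (\<Sum>x \<in> S. \<Lambda> x * E (\<omega> x))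
    - (\<Sum>i \<in> UNIV. (\<Sum>x \<in> bonds n i. (real n * (r x - r (x + axis i 1)))\<^sup>2 * E (\<lambda>\<eta>. \<omega> x \<eta> * \<omega> (x + axis i 1) \<eta>))
         + (real n)\<^sup>2 * (\<Sum>x \<in> bonds n i. bond_energy x (x + axis i 1)))
    - (\<Sum>z \<in> boundary_sites n. (real n)\<^sup>2 * (c * real n powr (- \<theta>)) * energy (spin_rate (g (p (rescale n z))) z) (flip z))"
proof -
  define N where "N = (real n)\<^sup>2"
  define k where "k = c * real n powr (- \<theta>)"
  define G where "G z = g (p (rescale n z))" for z
  let ?e = "\<lambda>i. axis i 1 :: int ^ 'd"
  have N: "0 \<le> N" and k: "0 \<le> k" using b by (auto simp: N_def k_def)
  have bS: "boundary_sites n \<subseteq> S" by (auto simp: boundary_sites_def S)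
  have dist: "a * (\<Sum>z \<in> I. A z - F z) = (\<Sum>z \<in> I. a * A z) - (\<Sum>z \<in> I. a * F z)"
    for a and I :: "(int ^ 'd) set" and A F :: "int ^ 'd \<Rightarrow> real"
    by (simp add: sum_subtractf right_diff_distrib sum_distrib_left)
  have pw: "(real n * a)\<^sup>2 * w = N * (a\<^sup>2 * w)" for a w
    by (simp add: N_def power_mult_distrib)
  have parts: "(\<Sum>i \<in> UNIV. \<Sum>x \<in> bonds n i. (r (x + ?e i) - r x) * (E (\<omega> x) - E (\<omega> (x + ?e i)))) =
      (\<Sum>x \<in> S. lattice_laplacian n r x * E (\<omega> x))"
    by (subst sum_by_parts_bonds) (simp only: S[symmetric])
  have prod: "E (\<lambda>\<eta>. N * generator \<theta> c g p n (\<lambda>\<xi>. ln (f \<xi>)) \<eta> - (\<Sum>x \<in> S. \<tau> x * \<omega> x \<eta>)) =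
      N * (\<Sum>i \<in> UNIV. \<Sum>x \<in> bonds n i. E (\<lambda>\<eta>. ln (f (exchange x (x + ?e i) \<eta>)) - ln (f \<eta>))) +
      N * k * (\<Sum>z \<in> boundary_sites n. E (\<lambda>\<eta>. spin_rate (G z) z \<eta> * (ln (f (flip z \<eta>)) - ln (f \<eta>)))) -
      (\<Sum>x \<in> S. \<tau> x * E (\<omega> x))"
    unfolding generator_def bulk_gen_bonds boundary_gen_def k_def[symmetric]
      G_def[symmetric] spin_rate_def[symmetric]
    by (simp only: E_add E_diff E_cmult E_sum distrib_left mult.assoc)
  have "N * (\<Sum>i \<in> UNIV. \<Sum>x \<in> bonds n i. E (\<lambda>\<eta>. ln (f (exchange x (x + ?e i) \<eta>)) - ln (f \<eta>))) \<le>
      N * (\<Sum>i \<in> UNIV. \<Sum>x \<in> bonds n i. (r (x + ?e i) - r x) * (E (\<omega> x) - E (\<omega> (x + ?e i)))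
          - (r x - r (x + ?e i))\<^sup>2 * E (\<lambda>\<eta>. \<omega> x \<eta> * \<omega> (x + ?e i) \<eta>) - bond_energy x (x + ?e i))"
    by (intro mult_left_mono sum_mono exchange_entropy_le N)
      (auto simp: bonds_def S axis_eq_0_iff)
  also have "\<dots> = N * (\<Sum>x \<in> S. lattice_laplacian n r x * E (\<omega> x))
      - (\<Sum>i \<in> UNIV. (\<Sum>x \<in> bonds n i. (real n * (r x - r (x + ?e i)))\<^sup>2 * E (\<lambda>\<eta>. \<omega> x \<eta> * \<omega> (x + ?e i) \<eta>))
         + N * (\<Sum>x \<in> bonds n i. bond_energy x (x + ?e i)))"
    unfolding parts[symmetric]
    by (simp only: pw sum_distrib_left[symmetric] sum_subtractf sum.distrib)
      (simp only: right_diff_distrib distrib_left diff_diff_eq)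
  finally have bulk: "N * (\<Sum>i \<in> UNIV. \<Sum>x \<in> bonds n i. E (\<lambda>\<eta>. ln (f (exchange x (x + ?e i) \<eta>)) - ln (f \<eta>))) \<le> N * (\<Sum>x \<in> S. lattice_laplacian n r x * E (\<omega> x))
      - (\<Sum>i \<in> UNIV. (\<Sum>x \<in> bonds n i. (real n * (r x - r (x + ?e i)))\<^sup>2 * E (\<lambda>\<eta>. \<omega> x \<eta> * \<omega> (x + ?e i) \<eta>))
         + N * (\<Sum>x \<in> bonds n i. bond_energy x (x + ?e i)))" .
  have "N * k * (\<Sum>z \<in> boundary_sites n. E (\<lambda>\<eta>. spin_rate (G z) z \<eta> * (ln (f (flip z \<eta>)) - ln (f \<eta>)))) \<le>
      N * k * (\<Sum>z \<in> boundary_sites n. (G z - r z) * E (\<omega> z) - energy (spin_rate (G z) z) (flip z))"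
    using bS assms(3) by (intro mult_left_mono sum_mono flip_entropy_le) (auto simp: G_def N k)
  also have "\<dots> = (\<Sum>z \<in> boundary_sites n. N * k * (G z - r z) * E (\<omega> z)) -
       (\<Sum>z \<in> boundary_sites n. N * k * energy (spin_rate (G z) z) (flip z))"
    by (simp only: dist mult.assoc)
  finally have bdry: "N * k * (\<Sum>z \<in> boundary_sites n. E (\<lambda>\<eta>. spin_rate (G z) z \<eta> * (ln (f (flip z \<eta>)) - ln (f \<eta>)))) \<le> (\<Sum>z \<in> boundary_sites n. N * k * (G z - r z) * E (\<omega> z)) -
       (\<Sum>z \<in> boundary_sites n. N * k * energy (spin_rate (G z) z) (flip z))" .
  have bdry_sum: "(\<Sum>z \<in> boundary_sites n. N * k * (G z - r z) * E (\<omega> z)) =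
      (\<Sum>x \<in> S. (if x \<in> boundary_sites n then N * k * (G x - r x) else 0) * E (\<omega> x))"
    using bS finite_S by (intro sum.mono_neutral_cong_left) auto
  have main: "E (\<lambda>\<eta>. N * generator \<theta> c g p n (\<lambda>\<xi>. ln (f \<xi>)) \<eta> - (\<Sum>x \<in> S. \<tau> x * \<omega> x \<eta>)) \<le>
     N * (\<Sum>x \<in> S. lattice_laplacian n r x * E (\<omega> x))
      - (\<Sum>i \<in> UNIV. (\<Sum>x \<in> bonds n i. (real n * (r x - r (x + ?e i)))\<^sup>2 * E (\<lambda>\<eta>. \<omega> x \<eta> * \<omega> (x + ?e i) \<eta>))
         + N * (\<Sum>x \<in> bonds n i. bond_energy x (x + ?e i)))
      + ((\<Sum>x \<in> S. (if x \<in> boundary_sites n then N * k * (G x - r x) else 0) * E (\<omega> x)) -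
       (\<Sum>z \<in> boundary_sites n. N * k * energy (spin_rate (G z) z) (flip z)))
      - (\<Sum>x \<in> S. \<tau> x * E (\<omega> x))"
    using prod bulk bdry bdry_sum by linarith
  have "(\<Sum>x \<in> S. \<Lambda> x * E (\<omega> x)) = (\<Sum>x \<in> S. (N * lattice_laplacian n r x + (if x \<in> boundary_sites n then N * k * (G x - r x) else 0) - \<tau> x) * E (\<omega> x))"
    by (intro sum.cong) (auto simp: \<Lambda> N_def k_def G_def)
  also have "\<dots> = N * (\<Sum>x \<in> S. lattice_laplacian n r x * E (\<omega> x))
       + (\<Sum>x \<in> S. (if x \<in> boundary_sites n then N * k * (G x - r x) else 0) * E (\<omega> x)) - (\<Sum>x \<in> S. \<tau> x * E (\<omega> x))"
    by (simp only: left_diff_distrib distrib_right sum_subtractf sum.distrib sum_distrib_left mult.assoc)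
  finally show ?thesis using main unfolding N_def k_def G_def by linarith
qed

text \<open>The bulk energy cancels against the one in \<open>bulk_quadratic_bound\<close>. At each
  boundary site the hypothesis leaves a choice: bound \<open>\<omega>\<close> by 1 / \<epsilon> and
  discard the reservoir energy, or spend that energy on the linear term.\<close>

lemma entropy_production_bound:
  assumes S: "S = sites n" and k: "k = (real n)\<^sup>2 * (c * real n powr (- \<theta>))" "0 \<le> c"
    and G: "\<And>z. z \<in> boundary_sites n \<Longrightarrow> \<epsilon> \<le> g (p (rescale n z)) \<and> g (p (rescale n z)) \<le> 1 - \<epsilon>"
    and \<Lambda>: "\<And>x. x \<in> S \<Longrightarrow> \<Lambda> x = (real n)\<^sup>2 * lattice_laplacian n r x +
        (if x \<in> boundary_sites n then k * (g (p (rescale n x)) - r x) else 0) - \<tau> x"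
    and L: "1 \<le> L" "L \<le> real n" and \<l>: "2 \<le> \<l>"
    and lip: "\<And>i x. x \<in> bonds n i \<Longrightarrow> real n * \<bar>r x - r (x + axis i 1)\<bar> \<le> L"
    and C: "C = L\<^sup>2 / \<epsilon> ^ 4"
    and interior: "\<And>x. x \<in> S - boundary_sites n \<Longrightarrow> \<bar>\<Lambda> x\<bar> \<le> \<kappa>" and \<kappa>: "0 \<le> \<kappa>"
    and boundary: "\<And>z. z \<in> boundary_sites n \<Longrightarrow> \<bar>\<Lambda> z\<bar> / \<epsilon> \<le> e z \<or> 0 < k \<and> (\<Lambda> z)\<^sup>2 / (k * \<epsilon> ^ 4) \<le> e z"
  shows "E (\<lambda>\<eta>. (real n)\<^sup>2 * generator \<theta> c g p n (\<lambda>\<xi>. ln (f \<xi>)) \<eta> - (\<Sum>x \<in> S. \<tau> x * \<omega> x \<eta>)) \<le>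
    \<kappa> / \<epsilon> * real n ^ CARD('d) + (\<Sum>z \<in> boundary_sites n. e z) +
    real CARD('d) * (C / real (\<l> - 1) * real n ^ CARD('d) +
      C * (6 * real \<l> / \<epsilon>\<^sup>2 * (2 * real \<l> * C + L) + L + real \<l>) * real n ^ (CARD('d) - 1))"
proof -
  let ?e = "\<lambda>i. axis i 1 :: int ^ 'd"
  let ?F = "\<lambda>z. energy (spin_rate (g (p (rescale n z))) z) (flip z)"
  let ?R = "C / real (\<l> - 1) * real n ^ CARD('d) +
      C * (6 * real \<l> / \<epsilon>\<^sup>2 * (2 * real \<l> * C + L) + L + real \<l>) * real n ^ (CARD('d) - 1)"
  have k0: "0 \<le> k" using k by simp
  have bS: "boundary_sites n \<subseteq> S" by (auto simp: boundary_sites_def S)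
  have finb: "finite (boundary_sites n :: (int ^ 'd) set)" using bS finite_S by (rule finite_subset)
  have E\<omega>: "\<bar>E (\<omega> x)\<bar> \<le> 1 / \<epsilon>" if "x \<in> S" for x
    by (intro abs_E_le \<omega>_bound that)
  have prod: "E (\<lambda>\<eta>. (real n)\<^sup>2 * generator \<theta> c g p n (\<lambda>\<xi>. ln (f \<xi>)) \<eta> - (\<Sum>x \<in> S. \<tau> x * \<omega> x \<eta>)) \<le>
    (\<Sum>x \<in> S. \<Lambda> x * E (\<omega> x))
    - (\<Sum>i \<in> UNIV. (\<Sum>x \<in> bonds n i. (real n * (r x - r (x + ?e i)))\<^sup>2 * E (\<lambda>\<eta>. \<omega> x \<eta> * \<omega> (x + ?e i) \<eta>))
         + (real n)\<^sup>2 * (\<Sum>x \<in> bonds n i. bond_energy x (x + ?e i)))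
    - (\<Sum>z \<in> boundary_sites n. k * ?F z)"
    unfolding k(1)
  proof (rule entropy_production_le[OF S])
    show "0 \<le> g (p (rescale n z)) \<and> g (p (rescale n z)) \<le> 1" if "z \<in> boundary_sites n" for z
      using G[OF that] \<epsilon>_pos by auto
  qed (use k \<Lambda> in auto)
  have move: "- (a + b) \<le> s + t" if "- a \<le> b + s + t" for a b s t :: real
    using that by simp
  have quad: "- (\<Sum>i \<in> UNIV. (\<Sum>x \<in> bonds n i. (real n * (r x - r (x + ?e i)))\<^sup>2 * E (\<lambda>\<eta>. \<omega> x \<eta> * \<omega> (x + ?e i) \<eta>))
         + (real n)\<^sup>2 * (\<Sum>x \<in> bonds n i. bond_energy x (x + ?e i))) \<le> (\<Sum>i \<in> (UNIV :: 'd set). ?R)"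
    unfolding sum_negf[symmetric]
  proof (rule sum_mono)
    fix i
    show "- ((\<Sum>x \<in> bonds n i. (real n * (r x - r (x + ?e i)))\<^sup>2 * E (\<lambda>\<eta>. \<omega> x \<eta> * \<omega> (x + ?e i) \<eta>))
         + (real n)\<^sup>2 * (\<Sum>x \<in> bonds n i. bond_energy x (x + ?e i))) \<le> ?R"
      by (rule move) (rule bulk_quadratic_bound[OF S L \<l> lip C])
  qed
  have split: "(\<Sum>x \<in> S. \<Lambda> x * E (\<omega> x)) = (\<Sum>x \<in> S - boundary_sites n. \<Lambda> x * E (\<omega> x)) + (\<Sum>z \<in> boundary_sites n. \<Lambda> z * E (\<omega> z))"
    using bS finite_S by (rule sum.subset_diff)
  have "(\<Sum>x \<in> S - boundary_sites n. \<Lambda> x * E (\<omega> x)) \<le> (\<Sum>x \<in> S - boundary_sites n. \<kappa> / \<epsilon>)"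
  proof (rule sum_mono)
    fix x assume x: "x \<in> S - boundary_sites n"
    have "\<Lambda> x * E (\<omega> x) \<le> \<bar>\<Lambda> x\<bar> * \<bar>E (\<omega> x)\<bar>" by (metis abs_ge_self abs_mult)
    also have "\<dots> \<le> \<kappa> * (1 / \<epsilon>)" using x interior E\<omega> \<kappa> by (intro mult_mono) auto
    finally show "\<Lambda> x * E (\<omega> x) \<le> \<kappa> / \<epsilon>" by simp
  qed
  also have "\<dots> \<le> \<kappa> / \<epsilon> * real n ^ CARD('d)"
  proof -
    have "real (card (S - boundary_sites n)) \<le> real n ^ CARD('d)"
      unfolding S by (rule card_subset_sites) auto
    then have "real (card (S - boundary_sites n)) * (\<kappa> / \<epsilon>) \<le> real n ^ CARD('d) * (\<kappa> / \<epsilon>)"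
      using \<kappa> \<epsilon>_pos by (intro mult_right_mono) auto
    then show ?thesis by (simp add: mult.commute)
  qed
  finally have int: "(\<Sum>x \<in> S - boundary_sites n. \<Lambda> x * E (\<omega> x)) \<le> \<kappa> / \<epsilon> * real n ^ CARD('d)" .
  have main: "E (\<lambda>\<eta>. (real n)\<^sup>2 * generator \<theta> c g p n (\<lambda>\<xi>. ln (f \<xi>)) \<eta> - (\<Sum>x \<in> S. \<tau> x * \<omega> x \<eta>)) \<le>
      \<kappa> / \<epsilon> * real n ^ CARD('d) + (\<Sum>z \<in> boundary_sites n. \<Lambda> z * E (\<omega> z) - k * ?F z) + real CARD('d) * ?R"
    using prod quad split int by (simp add: sum_subtractf)
  have "\<Lambda> z * E (\<omega> z) - k * ?F z \<le> e z" if z: "z \<in> boundary_sites n" for z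
    using boundary[OF z]
  proof
    assume 1: "\<bar>\<Lambda> z\<bar> / \<epsilon> \<le> e z"
    have "0 \<le> ?F z"
    proof (rule energy_nonneg)
      fix \<eta> assume "\<eta> \<in> \<Omega>"
      then show "0 \<le> spin_rate (g (p (rescale n z))) z \<eta>"
        using value_cases[of \<eta> z] subsetD[OF bS z] G[OF z] \<epsilon>_pos by (auto simp: spin_rate_def)
    qed
    then have "0 \<le> k * ?F z" using k0 by simp
    moreover have "\<Lambda> z * E (\<omega> z) \<le> \<bar>\<Lambda> z\<bar> * \<bar>E (\<omega> z)\<bar>" by (metis abs_ge_self abs_mult)
    moreover have "\<bar>\<Lambda> z\<bar> * \<bar>E (\<omega> z)\<bar> \<le> \<bar>\<Lambda> z\<bar> * (1 / \<epsilon>)" using z bS E\<omega> by (intro mult_left_mono) auto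
    ultimately show ?thesis using 1 by simp
  next
    assume 2: "0 < k \<and> (\<Lambda> z)\<^sup>2 / (k * \<epsilon> ^ 4) \<le> e z"
    \<comment> \<open>With \<open>k\<close> as the parameter \<alpha> of
      \<open>boundary_replacement\<close>, the whole reservoir energy at \<open>z\<close> is used
      up.\<close>
    then show ?thesis
      using boundary_replacement[of z "g (p (rescale n z))" k "\<Lambda> z"] z bS G[OF z] by auto
  qed
  then have "(\<Sum>z \<in> boundary_sites n. \<Lambda> z * E (\<omega> z) - k * ?F z) \<le> (\<Sum>z \<in> boundary_sites n. e z)"
    by (rule sum_mono)
  then show ?thesis using main by linarith
qed

end

section \<open>Kolmogorov equation on a finite state space\<close>

lemma expectation_finite:
  assumes "finite S" "set_pmf q \<subseteq> S"
  shows "measure_pmf.expectation q \<phi> = (\<Sum>y \<in> S. pmf q y * (\<phi> y :: real))"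
  using assms by (subst integral_measure_pmf[of S]) auto

locale finite_semigroup =
  fixes S :: "'s set" and K :: "real \<Rightarrow> 's \<Rightarrow> 's pmf" and G :: "('s \<Rightarrow> real) \<Rightarrow> 's \<Rightarrow> real"
  assumes finite_S: "finite S" and tf: "transition_function S K" and gen: "has_generator S K G"
begin

definition P :: "real \<Rightarrow> ('s \<Rightarrow> real) \<Rightarrow> 's \<Rightarrow> real" where
  "P t \<phi> x = (\<Sum>y \<in> S. pmf (K t x) y * \<phi> y)"

lemma support: "0 \<le> t \<Longrightarrow> x \<in> S \<Longrightarrow> set_pmf (K t x) \<subseteq> S"
  using tf by (auto simp: transition_function_def)

lemma pmf_add:
  assumes "0 \<le> s" "0 \<le> t" "x \<in> S"
  shows "pmf (K (s + t) x) y = (\<Sum>z \<in> S. pmf (K s x) z * pmf (K t z) y)"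
proof -
  have "K (s + t) x = bind_pmf (K s x) (K t)"
    using tf assms by (auto simp: transition_function_def)
  then show ?thesis
    using assms by (simp add: pmf_bind expectation_finite[OF finite_S support])
qed

lemma P_add:
  assumes "0 \<le> s" "0 \<le> t" "x \<in> S"
  shows "P (s + t) \<phi> x = (\<Sum>z \<in> S. pmf (K s x) z * P t \<phi> z)"
  unfolding P_def using assms
  by (simp add: pmf_add sum_distrib_left sum_distrib_right mult_ac) (rule sum.swap)

lemma P_generator:
  assumes "x \<in> S" shows "((\<lambda>h. (P h \<phi> x - \<phi> x) / h) \<longlongrightarrow> G \<phi> x) (at_right 0)"
proof -
  have "((\<lambda>h. (measure_pmf.expectation (K h x) \<phi> - \<phi> x) / h) \<longlongrightarrow> G \<phi> x) (at_right 0)"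
    using gen assms by (auto simp: has_generator_def)
  moreover have "\<forall>\<^sub>F h in at_right 0. (measure_pmf.expectation (K h x) \<phi> - \<phi> x) / h = (P h \<phi> x - \<phi> x) / h"
    using eventually_at_right_less[of "0 :: real"]
    by eventually_elim (use assms in \<open>simp add: P_def expectation_finite[OF finite_S support]\<close>)
  ultimately show ?thesis by (rule Lim_transform_eventually)
qed

lemma P_continuous_0:
  assumes "x \<in> S" shows "((\<lambda>h. P h \<phi> x) \<longlongrightarrow> \<phi> x) (at_right 0)"
proof -
  have "((\<lambda>h. h * ((P h \<phi> x - \<phi> x) / h) + \<phi> x) \<longlongrightarrow> 0 * G \<phi> x + \<phi> x) (at_right 0)"
    by (intro tendsto_intros P_generator assms)
  moreover have "\<forall>\<^sub>F h in at_right 0. h * ((P h \<phi> x - \<phi> x) / h) + \<phi> x = P h \<phi> x"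
    using eventually_at_right_less[of "0 :: real"] by eventually_elim simp
  ultimately show ?thesis by (auto dest: Lim_transform_eventually)
qed

lemma P_indicator: "y \<in> S \<Longrightarrow> P t (indicator {y}) x = pmf (K t x) y"
  using finite_S by (simp add: P_def indicator_def if_distrib[of "\<lambda>a. _ * a"] cong: if_cong)

text \<open>The generator is a pointwise limit of quotients linear in \<phi>, hence linear and
  determined by the rates into single states; values of \<phi> outside \<open>S\<close> cannot
  enter.\<close>

lemma generator_expand:
  assumes "x \<in> S" shows "G \<phi> x = (\<Sum>y \<in> S. \<phi> y * G (indicator {y}) x)"
proof (rule tendsto_unique[of "at_right 0"])
  show "((\<lambda>h. (P h \<phi> x - \<phi> x) / h) \<longlongrightarrow> G \<phi> x) (at_right 0)" by (rule P_generator[OF assms])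
  have "((\<lambda>h. \<Sum>y \<in> S. \<phi> y * ((P h (indicator {y}) x - indicator {y} x) / h)) \<longlongrightarrow>
      (\<Sum>y \<in> S. \<phi> y * G (indicator {y}) x)) (at_right 0)"
    by (intro tendsto_intros P_generator assms)
  moreover have "(\<Sum>y \<in> S. \<phi> y * ((P h (indicator {y}) x - indicator {y} x) / h)) = (P h \<phi> x - \<phi> x) / h" for h
  proof -
    have "\<phi> x = (\<Sum>y \<in> S. \<phi> y * indicator {y} x)"
      using assms finite_S by (simp add: indicator_def if_distrib[of "\<lambda>a. _ * a"] cong: if_cong)
    then have "(P h \<phi> x - \<phi> x) / h = (\<Sum>y \<in> S. pmf (K h x) y * \<phi> y - \<phi> y * indicator {y} x) / h"
      unfolding P_def sum_subtractf by simp
    also have "\<dots> = (\<Sum>y \<in> S. \<phi> y * ((P h (indicator {y}) x - indicator {y} x) / h))"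
      unfolding sum_divide_distrib by (intro sum.cong) (auto simp: P_indicator algebra_simps diff_divide_distrib)
    finally show ?thesis ..
  qed
  ultimately show "((\<lambda>h. (P h \<phi> x - \<phi> x) / h) \<longlongrightarrow> (\<Sum>y \<in> S. \<phi> y * G (indicator {y}) x)) (at_right 0)"
    by simp
qed simp

lemma generator_cong:
  assumes "x \<in> S" "\<And>y. y \<in> S \<Longrightarrow> \<phi> y = \<psi> y" shows "G \<phi> x = G \<psi> x"
  using assms by (simp add: generator_expand[of x])

lemma generator_const:
  assumes "x \<in> S" shows "G (\<lambda>_. 1) x = 0"
proof (rule tendsto_unique[OF _ P_generator[OF assms]])
  have "\<forall>\<^sub>F h in at_right 0. 0 = (P h (\<lambda>_. 1) x - 1) / h"
    using eventually_at_right_less[of "0 :: real"]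
    by eventually_elim (simp add: P_def sum_pmf_eq_1[OF finite_S support] assms)
  then show "((\<lambda>h. (P h (\<lambda>_. 1) x - 1) / h) \<longlongrightarrow> 0) (at_right 0)"
    by (rule Lim_transform_eventually[OF tendsto_const])
qed simp

text \<open>Off the diagonal the difference quotient is a probability divided by h.\<close>

lemma generator_indicator_nonneg:
  assumes "x \<in> S" "y \<in> S" "x \<noteq> y" shows "0 \<le> G (indicator {y}) x"
proof (rule tendsto_lowerbound[OF P_generator[OF assms(1)]])
  show "\<forall>\<^sub>F h in at_right 0. 0 \<le> (P h (indicator {y}) x - indicator {y} x) / h"
    using eventually_at_right_less[of "0 :: real"]
    by eventually_elim (use assms in \<open>auto simp: P_indicator\<close>)
qed simp

text \<open>\<open>has_generator\<close> speaks of time 0 from the right only. Splitting time t into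
  t - h and h bounds the difference by how far the semigroup moves an indicator during h. This opens
  the way to the left derivative at t.\<close>

lemma pmf_left_continuous:
  assumes t: "0 < t" and x: "x \<in> S" and y: "y \<in> S"
  shows "((\<lambda>h. pmf (K (t - h) x) y) \<longlongrightarrow> pmf (K t x) y) (at_right 0)"
proof -
  have lim: "((\<lambda>h. \<Sum>z \<in> S. \<bar>P h (indicator {y}) z - indicator {y} z\<bar>) \<longlongrightarrow>
      (\<Sum>z \<in> S. \<bar>indicator {y} z - indicator {y} z :: real\<bar>)) (at_right 0)"
    by (intro tendsto_intros P_continuous_0)
  have "((\<lambda>h. pmf (K (t - h) x) y - pmf (K t x) y) \<longlongrightarrow> 0) (at_right 0)"
  proof (rule Lim_null_comparison)
    show "\<forall>\<^sub>F h in at_right 0. norm (pmf (K (t - h) x) y - pmf (K t x) y) \<le>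
        (\<Sum>z \<in> S. \<bar>P h (indicator {y}) z - indicator {y} z\<bar>)"
      using eventually_at_right_less[of "0 :: real"] eventually_at_right_real[OF t]
    proof eventually_elim
      case (elim h)
      have "P (t - h + h) (indicator {y}) x = (\<Sum>z \<in> S. pmf (K (t - h) x) z * P h (indicator {y}) z)"
        using elim by (intro P_add x) auto
      then have 1: "pmf (K t x) y = (\<Sum>z \<in> S. pmf (K (t - h) x) z * P h (indicator {y}) z)"
        by (simp add: P_indicator y)
      have 2: "pmf (K (t - h) x) y = (\<Sum>z \<in> S. pmf (K (t - h) x) z * indicator {y} z)"
        using y finite_S by (simp add: indicator_def if_distrib[of "\<lambda>a. _ * a"] cong: if_cong)
      have "norm (pmf (K (t - h) x) y - pmf (K t x) y) =
          \<bar>\<Sum>z \<in> S. pmf (K (t - h) x) z * (indicator {y} z - P h (indicator {y}) z)\<bar>"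
        unfolding 1 2 by (simp add: right_diff_distrib sum_subtractf)
      also have "\<dots> \<le> (\<Sum>z \<in> S. \<bar>pmf (K (t - h) x) z * (indicator {y} z - P h (indicator {y}) z)\<bar>)"
        by (rule sum_abs)
      also have "\<dots> \<le> (\<Sum>z \<in> S. \<bar>P h (indicator {y}) z - indicator {y} z\<bar>)"
      proof (rule sum_mono)
        fix z
        have "\<bar>pmf (K (t - h) x) z * (indicator {y} z - P h (indicator {y}) z)\<bar> =
            pmf (K (t - h) x) z * \<bar>P h (indicator {y}) z - indicator {y} z\<bar>"
          by (simp add: abs_mult abs_minus_commute)
        also have "\<dots> \<le> 1 * \<bar>P h (indicator {y}) z - indicator {y} z\<bar>"
          by (intro mult_right_mono pmf_le_1) auto
        finally show "\<bar>pmf (K (t - h) x) z * (indicator {y} z - P h (indicator {y}) z)\<bar> \<le>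
            \<bar>P h (indicator {y}) z - indicator {y} z\<bar>" by simp
      qed
      finally show ?case .
    qed
    show "((\<lambda>h. \<Sum>z \<in> S. \<bar>P h (indicator {y}) z - indicator {y} z\<bar>) \<longlongrightarrow> 0) (at_right 0)"
      using lim by simp
  qed
  then show ?thesis by (simp add: LIM_zero_cancel)
qed

text \<open>Both one-sided quotients are averages of the quotient at time 0, weighted by the kernel
  at time t on the right and at time t - h on the left; the latter converges by
  \<open>pmf_left_continuous\<close>. At t = 0 only the right limit enters.\<close>

lemma P_has_derivative:
  assumes t: "0 \<le> t" and x: "x \<in> S"
  shows "((\<lambda>s. P s \<phi> x) has_real_derivative P t (G \<phi>) x) (at t within {0..})"
proof -
  have right: "((\<lambda>s. (P s \<phi> x - P t \<phi> x) / (s - t)) \<longlongrightarrow> P t (G \<phi>) x) (at_right t)"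
  proof -
    have "((\<lambda>h. \<Sum>z \<in> S. pmf (K t x) z * ((P h \<phi> z - \<phi> z) / h)) \<longlongrightarrow> P t (G \<phi>) x) (at_right 0)"
      unfolding P_def[of t "G \<phi>"] by (intro tendsto_intros P_generator)
    moreover have "\<forall>\<^sub>F h in at_right 0. (\<Sum>z \<in> S. pmf (K t x) z * ((P h \<phi> z - \<phi> z) / h)) =
        (P (h + t) \<phi> x - P t \<phi> x) / (h + t - t)"
      using eventually_at_right_less[of "0 :: real"]
    proof eventually_elim
      case (elim h)
      have "P (h + t) \<phi> x - P t \<phi> x = (\<Sum>z \<in> S. pmf (K t x) z * (P h \<phi> z - \<phi> z))"
        using P_add[of t h x \<phi>] elim t x
        by (simp add: add.commute P_def[of t] right_diff_distrib sum_subtractf)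
      then show ?case by (simp add: sum_divide_distrib)
    qed
    ultimately show ?thesis
      unfolding filterlim_at_right_to_0[of _ _ t] by (rule Lim_transform_eventually)
  qed
  have left: "((\<lambda>s. (P s \<phi> x - P t \<phi> x) / (s - t)) \<longlongrightarrow> P t (G \<phi>) x) (at_left t)" if "0 < t"
  proof -
    have "((\<lambda>h. \<Sum>z \<in> S. pmf (K (t - h) x) z * ((P h \<phi> z - \<phi> z) / h)) \<longlongrightarrow> P t (G \<phi>) x) (at_right 0)"
      unfolding P_def[of t "G \<phi>"] by (intro tendsto_intros P_generator pmf_left_continuous that x)
    moreover have "\<forall>\<^sub>F h in at_right 0. (\<Sum>z \<in> S. pmf (K (t - h) x) z * ((P h \<phi> z - \<phi> z) / h)) =
        (P (- (h + - t)) \<phi> x - P t \<phi> x) / (- (h + - t) - t)"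
      using eventually_at_right_less[of "0 :: real"] eventually_at_right_real[OF that]
    proof eventually_elim
      case (elim h)
      have "P t \<phi> x - P (t - h) \<phi> x = (\<Sum>z \<in> S. pmf (K (t - h) x) z * (P h \<phi> z - \<phi> z))"
        using P_add[of "t - h" h x \<phi>] elim x
        by (simp add: P_def[of "t - h"] right_diff_distrib sum_subtractf)
      then have "(P (t - h) \<phi> x - P t \<phi> x) / (- h) = (\<Sum>z \<in> S. pmf (K (t - h) x) z * (P h \<phi> z - \<phi> z)) / h"
        using elim by (simp add: field_simps)
      then show ?case by (simp add: sum_divide_distrib)
    qed
    ultimately show ?thesis
      unfolding filterlim_at_left_to_right[of _ _ t] filterlim_at_right_to_0[of _ _ "- t"]
      by (rule Lim_transform_eventually)
  qed
  have "((\<lambda>s. (P s \<phi> x - P t \<phi> x) / (s - t)) \<longlongrightarrow> P t (G \<phi>) x) (at t within {0..})"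
  proof (cases "t = 0")
    case True
    then show ?thesis using right by (simp add: at_within_Ici_at_right)
  next
    case False
    then have "0 < t" using t by simp
    then have "at t within {0..} = at t" by (intro at_within_interior) simp
    then show ?thesis using left[OF \<open>0 < t\<close>] right by (simp add: filterlim_split_at)
  qed
  then show ?thesis by (simp add: has_field_derivative_iff)
qed

definition flow :: "('s \<Rightarrow> real) \<Rightarrow> real \<Rightarrow> 's \<Rightarrow> real" where
  "flow m t y = (\<Sum>x \<in> S. m x * pmf (K t x) y)"

lemma flow_has_derivative:
  assumes "0 \<le> t" "y \<in> S"
  shows "((\<lambda>s. flow m s y) has_real_derivative (\<Sum>z \<in> S. flow m t z * G (indicator {y}) z)) (at t within {0..})"
proof -
  have "((\<lambda>s. \<Sum>x \<in> S. m x * P s (indicator {y}) x) has_real_derivative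
      (\<Sum>x \<in> S. m x * P t (G (indicator {y})) x)) (at t within {0..})"
    using assms by (intro DERIV_sum DERIV_cmult P_has_derivative) auto
  also have "(\<lambda>s. \<Sum>x \<in> S. m x * P s (indicator {y}) x) = (\<lambda>s. flow m s y)"
    by (simp add: flow_def P_indicator assms)
  also have "(\<Sum>x \<in> S. m x * P t (G (indicator {y})) x) = (\<Sum>z \<in> S. flow m t z * G (indicator {y}) z)"
    unfolding flow_def P_def by (simp add: sum_distrib_left sum_distrib_right mult_ac) (rule sum.swap)
  finally show ?thesis .
qed

lemma flow_0: "y \<in> S \<Longrightarrow> flow m 0 y = m y"
  using tf finite_S by (simp add: flow_def transition_function_def pmf_return indicator_def if_distrib[of "\<lambda>a. _ * a"] cong: if_cong)

lemma flow_mass: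
  assumes "0 \<le> t" shows "(\<Sum>y \<in> S. flow m t y) = (\<Sum>x \<in> S. m x)"
proof -
  have "(\<Sum>y \<in> S. flow m t y) = (\<Sum>x \<in> S. m x * (\<Sum>y \<in> S. pmf (K t x) y))"
    unfolding flow_def by (simp add: sum_distrib_left) (rule sum.swap)
  also have "\<dots> = (\<Sum>x \<in> S. m x)"
    using assms by (intro sum.cong refl) (simp add: sum_pmf_eq_1 finite_S support)
  finally show ?thesis .
qed

lemma flow_nonneg: "(\<And>x. x \<in> S \<Longrightarrow> 0 \<le> m x) \<Longrightarrow> 0 \<le> flow m t y"
  unfolding flow_def by (intro sum_nonneg) auto

text \<open>With \<open>q\<close> the diagonal rate at \<open>y\<close>, the mass at
  \<open>y\<close> times exp (- q t) is nondecreasing: its derivative is exp (- q t) times the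
  inflow from the other states.\<close>

lemma flow_pos:
  assumes m: "\<And>x. x \<in> S \<Longrightarrow> 0 < m x" and t: "0 \<le> t" and y: "y \<in> S"
  shows "0 < flow m t y"
proof (cases "t = 0")
  case False
  then have t0: "0 < t" using t by simp
  define q where "q = G (indicator {y}) y"
  define D where "D s = (\<Sum>z \<in> S. flow m s z * G (indicator {y}) z)" for s
  have "((\<lambda>s. exp (- q * s) * flow m s y) has_real_derivative
      exp (- q * s) * D s + flow m s y * (exp (- q * s) * (- q))) (at s within {0..t})" if "0 \<le> s" for s
    unfolding D_def
    by (rule DERIV_subset[of _ _ _ "{0..}"]) (use that y in \<open>auto intro!: derivative_eq_intros flow_has_derivative\<close>)
  then have der: "((\<lambda>s. exp (- q * s) * flow m s y) has_derivative
      (*) (exp (- q * s) * D s + flow m s y * (exp (- q * s) * (- q)))) (at s within {0..t})" if "0 \<le> s" for s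
    using that by (simp add: has_field_derivative_def)
  obtain s where s: "s \<in> {0<..<t}" and eq: "exp (- q * t) * flow m t y - exp (- q * 0) * flow m 0 y =
      (exp (- q * s) * D s + flow m s y * (exp (- q * s) * (- q))) * (t - 0)"
    using mvt_simple[OF t0 der] by auto
  have "q * flow m s y \<le> D s"
  proof -
    have "D s = flow m s y * q + (\<Sum>z \<in> S - {y}. flow m s z * G (indicator {y}) z)"
      unfolding D_def q_def using finite_S y by (simp add: sum.remove)
    moreover have "0 \<le> (\<Sum>z \<in> S - {y}. flow m s z * G (indicator {y}) z)"
      using y by (intro sum_nonneg mult_nonneg_nonneg flow_nonneg generator_indicator_nonneg)
        (auto intro: less_imp_le m)
    ultimately show ?thesis by (simp add: mult.commute)
  qed
  then have "0 \<le> exp (- q * s) * (D s - q * flow m s y)" by simp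
  then have "0 \<le> (exp (- q * s) * D s + flow m s y * (exp (- q * s) * (- q))) * (t - 0)"
    using t0 by (intro mult_nonneg_nonneg) (auto simp: algebra_simps)
  then have "m y \<le> exp (- q * t) * flow m t y" using eq by (simp add: flow_0 y)
  then have "0 < exp (- q * t) * flow m t y" using m[OF y] by linarith
  then show ?thesis by (simp add: zero_less_mult_iff)
qed (simp add: flow_0 y m)

text \<open>Differentiating the logarithm of the law produces the sum of the time derivatives of the
  masses, which is zero by conservation of mass. What remains is the generator moved onto the
  logarithm of the density, and the motion of the reference weight.\<close>

lemma entropy_has_derivative:
  assumes m: "\<And>x. x \<in> S \<Longrightarrow> 0 < m x" and mass: "(\<Sum>x \<in> S. m x) = 1" and t: "t \<in> {0..T}"
    and l: "\<And>y. y \<in> S \<Longrightarrow> ((\<lambda>s. l s y) has_real_derivative l' y) (at t within {0..T})"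
  shows "((\<lambda>s. \<Sum>y \<in> S. flow m s y * (ln (flow m s y) - l s y)) has_real_derivative
      (\<Sum>z \<in> S. flow m t z * (G (\<lambda>y. ln (flow m t y) - l t y) z - l' z))) (at t within {0..T})"
proof -
  let ?D = "\<lambda>y. \<Sum>z \<in> S. flow m t z * G (indicator {y}) z"
  have der: "((\<lambda>s. flow m s y) has_real_derivative ?D y) (at t within {0..T})" if "y \<in> S" for y
    using flow_has_derivative[of t y m] that t by (auto intro: DERIV_subset)
  have "((\<lambda>s. \<Sum>y \<in> S. flow m s y * (ln (flow m s y) - l s y)) has_real_derivative
     (\<Sum>y \<in> S. flow m t y * (?D y / flow m t y - l' y) + ?D y * (ln (flow m t y) - l t y))) (at t within {0..T})"
  proof (rule DERIV_sum)
    fix y assume y: "y \<in> S"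
    have pos: "0 < flow m t y" using flow_pos[OF m _ y] t by auto
    show "((\<lambda>s. flow m s y * (ln (flow m s y) - l s y)) has_real_derivative
     flow m t y * (?D y / flow m t y - l' y) + ?D y * (ln (flow m t y) - l t y)) (at t within {0..T})"
      using pos by (auto intro!: derivative_eq_intros der[OF y] l[OF y] simp: field_simps)
  qed
  also have "(\<Sum>y \<in> S. flow m t y * (?D y / flow m t y - l' y) + ?D y * (ln (flow m t y) - l t y)) =
      (\<Sum>y \<in> S. ?D y) + (\<Sum>y \<in> S. ?D y * (ln (flow m t y) - l t y)) - (\<Sum>y \<in> S. flow m t y * l' y)"
  proof -
    have "flow m t y * (?D y / flow m t y - l' y) + ?D y * (ln (flow m t y) - l t y) =
        ?D y + ?D y * (ln (flow m t y) - l t y) - flow m t y * l' y" if "y \<in> S" for y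
      using flow_pos[where m = m and t = t, OF m _ that] t by (simp add: right_diff_distrib)
    then show ?thesis by (simp add: sum.distrib sum_subtractf)
  qed
  also have "(\<Sum>y \<in> S. ?D y) = 0"
  proof -
    have "(\<Sum>y \<in> S. ?D y) = (\<Sum>z \<in> S. flow m t z * (\<Sum>y \<in> S. 1 * G (indicator {y}) z))"
      by (simp add: sum_distrib_left) (rule sum.swap)
    also have "\<dots> = (\<Sum>z \<in> S. flow m t z * G (\<lambda>_. 1) z)"
      by (simp add: generator_expand[of _ "\<lambda>_. 1"])
    finally show ?thesis by (simp add: generator_const)
  qed
  also have "(\<Sum>y \<in> S. ?D y * (ln (flow m t y) - l t y)) = (\<Sum>z \<in> S. flow m t z * G (\<lambda>y. ln (flow m t y) - l t y) z)"
  proof -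
    have "(\<Sum>y \<in> S. ?D y * (ln (flow m t y) - l t y)) =
        (\<Sum>z \<in> S. flow m t z * (\<Sum>y \<in> S. (ln (flow m t y) - l t y) * G (indicator {y}) z))"
      by (simp add: sum_distrib_left sum_distrib_right mult_ac) (rule sum.swap)
    then show ?thesis by (simp add: generator_expand[symmetric])
  qed
  finally show ?thesis by (simp add: right_diff_distrib sum_subtractf)
qed

end

section \<open>Regularity of the hydrodynamic profile\<close>

lemma smooth_on_derivative:
  assumes "smooth_on S f"
  obtains D where "\<And>x. x \<in> S \<Longrightarrow> (f has_derivative (\<lambda>v. \<Sum>b \<in> Basis. (v \<bullet> b) * D b x)) (at x within S)"
    and "\<And>b. b \<in> Basis \<Longrightarrow> smooth_on S (D b)"
  using assms by cases blast

lemma smooth_on_continuous: "smooth_on S f \<Longrightarrow> continuous_on S f"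
  by (elim smooth_on_derivative) (auto simp: continuous_on_eq_continuous_within intro: has_derivative_continuous)

lemma smooth_on_bounded:
  assumes "smooth_on S f" "compact S" shows "\<exists>B. \<forall>x \<in> S. \<bar>f x\<bar> \<le> B"
proof -
  have "bounded (f ` S)"
    using assms by (intro compact_imp_bounded compact_continuous_image smooth_on_continuous)
  then show ?thesis by (auto simp: bounded_iff)
qed

text \<open>The partial derivatives are again smooth, hence bounded on the compact set; convexity
  allows the mean value inequality.\<close>

lemma smooth_on_Lipschitz:
  assumes f: "smooth_on S f" and S: "compact S" "convex S"
  shows "\<exists>C. \<forall>x \<in> S. \<forall>y \<in> S. \<bar>f x - f y\<bar> \<le> C * dist x y"
proof -
  obtain D where D: "\<And>x. x \<in> S \<Longrightarrow> (f has_derivative (\<lambda>v. \<Sum>b \<in> Basis. (v \<bullet> b) * D b x)) (at x within S)"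
    and D': "\<And>b. b \<in> Basis \<Longrightarrow> smooth_on S (D b)"
    using smooth_on_derivative[OF f] by blast
  have "\<forall>b \<in> Basis. \<exists>B. \<forall>x \<in> S. \<bar>D b x\<bar> \<le> B" using D' S smooth_on_bounded by blast
  then obtain B where B: "\<And>b x. b \<in> Basis \<Longrightarrow> x \<in> S \<Longrightarrow> \<bar>D b x\<bar> \<le> B b" by metis
  define C where "C = (\<Sum>b \<in> Basis. B b)"
  have "onorm (\<lambda>v. \<Sum>b \<in> Basis. (v \<bullet> b) * D b x) \<le> C" if x: "x \<in> S" for x
  proof (rule onorm_le)
    fix v
    have "norm (\<Sum>b \<in> Basis. (v \<bullet> b) * D b x) \<le> (\<Sum>b \<in> Basis. norm v * B b)"
    proof (rule sum_norm_le)
      fix b :: 'a assume b: "b \<in> Basis"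
      show "norm ((v \<bullet> b) * D b x) \<le> norm v * B b"
        using Basis_le_norm[OF b, of v] B[OF b x] by (simp add: abs_mult mult_mono)
    qed
    then show "norm (\<Sum>b \<in> Basis. (v \<bullet> b) * D b x) \<le> C * norm v"
      by (simp add: C_def sum_distrib_left mult.commute)
  qed
  then have "norm (f x - f y) \<le> C * norm (x - y)" if "x \<in> S" "y \<in> S" for x y
    using differentiable_bound[OF S(2) D _ that] by blast
  then show ?thesis by (auto simp: dist_norm)
qed

lemma smooth_on_line:
  assumes D: "\<And>x. x \<in> S \<Longrightarrow> (f has_derivative (\<lambda>v. \<Sum>b \<in> Basis. (v \<bullet> b) * D b x)) (at x within S)"
    and b: "b \<in> Basis" and x: "x + s *\<^sub>R b \<in> S"
  shows "((\<lambda>s. f (x + s *\<^sub>R b)) has_real_derivative D b (x + s *\<^sub>R b)) (at s within {s. x + s *\<^sub>R b \<in> S})"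
proof -
  let ?I = "{s. x + s *\<^sub>R b \<in> S}"
  have 1: "(f has_derivative (\<lambda>v. \<Sum>c \<in> Basis. (v \<bullet> c) * D c (x + s *\<^sub>R b))) (at (x + s *\<^sub>R b) within (\<lambda>s. x + s *\<^sub>R b) ` ?I)"
    using D[OF x] by (rule has_derivative_subset) auto
  have 2: "((\<lambda>s. x + s *\<^sub>R b) has_derivative (\<lambda>h. h *\<^sub>R b)) (at s within ?I)"
    by (auto intro!: derivative_eq_intros)
  have "((\<lambda>s. f (x + s *\<^sub>R b)) has_derivative (\<lambda>h. \<Sum>c \<in> Basis. ((h *\<^sub>R b) \<bullet> c) * D c (x + s *\<^sub>R b))) (at s within ?I)"
    using diff_chain_within[OF 2 1] unfolding o_def .
  also have "(\<lambda>h. \<Sum>c \<in> Basis. ((h *\<^sub>R b) \<bullet> c) * D c (x + s *\<^sub>R b)) = (*) (D b (x + s *\<^sub>R b))"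
    using b by (simp add: fun_eq_iff inner_Basis if_distrib[of "\<lambda>a. _ * a"] if_distrib[of "\<lambda>a. a * _"] cong: if_cong)
  finally show ?thesis by (simp add: has_field_derivative_def)
qed

section \<open>Space derivatives of the profile up to the boundary of the cube\<close>

lemma compact_closed_cube: "compact (closed_cube :: (real ^ 'd::finite) set)"
  and convex_closed_cube: "convex (closed_cube :: (real ^ 'd::finite) set)"
proof -
  have "(closed_cube :: (real ^ 'd) set) = cbox 0 (\<chi> i. 1)"
    by (auto simp: closed_cube_def mem_box_cart)
  then show "compact (closed_cube :: (real ^ 'd) set)" and "convex (closed_cube :: (real ^ 'd) set)"
    by (metis compact_cbox, metis convex_box(1))
qed

lemma cube_subset: "cube \<subseteq> closed_cube"
  by (auto simp: cube_def closed_cube_def less_imp_le)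

lemma boundary_coordinate:
  assumes "u \<in> closed_cube" "u \<notin> cube" shows "\<exists>i. u $ i = 0 \<or> u $ i = 1"
proof -
  obtain i where "\<not> (0 < u $ i \<and> u $ i < 1)" using assms(2) by (auto simp: cube_def)
  moreover have "0 \<le> u $ i" "u $ i \<le> 1" using assms(1) by (auto simp: closed_cube_def)
  ultimately show ?thesis by (intro exI[of _ i]) linarith
qed

abbreviation smooth_profile :: "real \<Rightarrow> (real \<Rightarrow> real ^ 'd::finite \<Rightarrow> real) \<Rightarrow> bool" where
  "smooth_profile T w \<equiv> smooth_on ({0..T} \<times> closed_cube) (\<lambda>(t, u). w t u)"

text \<open>Derivatives are taken along axis-parallel lines within the closed cube, so that they are
  one-sided on the faces. Each \<open>w' i\<close> is again a smooth profile, which lets the lemma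
  be iterated.\<close>

lemma smooth_profile_partial:
  fixes w :: "real \<Rightarrow> real ^ 'd::finite \<Rightarrow> real"
  assumes "smooth_profile T w"
  shows "\<exists>w'. \<forall>i. smooth_profile T (w' i) \<and> (\<forall>t \<in> {0..T}. \<forall>u s. u + s *\<^sub>R axis i 1 \<in> closed_cube \<longrightarrow>
    ((\<lambda>s. w t (u + s *\<^sub>R axis i 1)) has_real_derivative w' i t (u + s *\<^sub>R axis i 1))
      (at s within {s. u + s *\<^sub>R axis i 1 \<in> closed_cube}))"
proof -
  obtain D where D: "\<And>x. x \<in> {0..T} \<times> closed_cube \<Longrightarrow> ((\<lambda>(t, u). w t u) has_derivative (\<lambda>v. \<Sum>b \<in> Basis. (v \<bullet> b) * D b x)) (at x within {0..T} \<times> closed_cube)"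
    and D': "\<And>b. b \<in> Basis \<Longrightarrow> smooth_on ({0..T} \<times> closed_cube) (D b)"
    using smooth_on_derivative[OF assms] by blast
  let ?b = "\<lambda>i. (0 :: real, axis i 1 :: real ^ 'd)"
  have b: "?b i \<in> Basis" for i by (simp add: Basis_prod_def axis_in_Basis_iff)
  show ?thesis
  proof (intro exI[of _ "\<lambda>i t u. D (?b i) (t, u)"] allI conjI ballI impI)
    fix i show "smooth_on ({0..T} \<times> closed_cube) (\<lambda>(t, u). D (?b i) (t, u))" using D'[OF b] by simp
    fix t u s assume "t \<in> {0..T}" "u + s *\<^sub>R axis i 1 \<in> (closed_cube :: (real ^ 'd) set)"
    then show "((\<lambda>s. w t (u + s *\<^sub>R axis i 1)) has_real_derivative D (?b i) (t, u + s *\<^sub>R axis i 1))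
      (at s within {s. u + s *\<^sub>R axis i 1 \<in> closed_cube})"
      using smooth_on_line[OF D b, of "(t, u)" s i] by simp
  qed
qed

lemma smooth_profile_bounds:
  fixes w :: "'i::finite \<Rightarrow> real \<Rightarrow> real ^ 'd::finite \<Rightarrow> real"
  assumes "\<And>i. smooth_profile T (w i)"
  shows "\<exists>C. \<forall>i. \<forall>t \<in> {0..T}. \<forall>u \<in> closed_cube. \<bar>w i t u\<bar> \<le> C \<and>
    (\<forall>v \<in> closed_cube. \<bar>w i t u - w i t v\<bar> \<le> C * dist u v)"
proof -
  have S: "compact ({0..T} \<times> (closed_cube :: (real ^ 'd) set))" "convex ({0..T} \<times> (closed_cube :: (real ^ 'd) set))"
    by (auto intro!: compact_Times convex_Times compact_closed_cube convex_closed_cube)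
  have "\<forall>i. \<exists>B. \<forall>x \<in> {0..T} \<times> closed_cube. \<bar>(\<lambda>(t, u). w i t u) x\<bar> \<le> B"
    using smooth_on_bounded[OF assms S(1)] by blast
  then obtain B where B: "\<And>i x. x \<in> {0..T} \<times> closed_cube \<Longrightarrow> \<bar>(\<lambda>(t, u). w i t u) x\<bar> \<le> B i" by metis
  have "\<forall>i. \<exists>L. \<forall>x \<in> {0..T} \<times> closed_cube. \<forall>y \<in> {0..T} \<times> closed_cube.
      \<bar>(\<lambda>(t, u). w i t u) x - (\<lambda>(t, u). w i t u) y\<bar> \<le> L * dist x y"
    using smooth_on_Lipschitz[OF assms S] by blast
  then obtain L where L: "\<And>i x y. x \<in> {0..T} \<times> closed_cube \<Longrightarrow> y \<in> {0..T} \<times> closed_cube \<Longrightarrow>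
      \<bar>(\<lambda>(t, u). w i t u) x - (\<lambda>(t, u). w i t u) y\<bar> \<le> L i * dist x y" by metis
  define C where "C = (\<Sum>i \<in> UNIV. \<bar>B i\<bar> + \<bar>L i\<bar>)"
  have C: "\<bar>B i\<bar> + \<bar>L i\<bar> \<le> C" for i
    unfolding C_def by (rule member_le_sum) auto
  show ?thesis
  proof (intro exI[of _ C] allI ballI conjI)
    fix i t and u :: "real ^ 'd" assume tu: "t \<in> {0..T}" "u \<in> closed_cube"
    show "\<bar>w i t u\<bar> \<le> C" using B[of "(t, u)" i] C[of i] tu by auto
    fix v :: "real ^ 'd" assume v: "v \<in> closed_cube"
    have "\<bar>w i t u - w i t v\<bar> \<le> L i * dist (t, u) (t, v)" using L[of "(t, u)" "(t, v)" i] tu v by auto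
    also have "dist (t, u) (t, v) = dist u v" by (simp add: dist_Pair_Pair)
    also have "L i * dist u v \<le> C * dist u v" using C[of i] by (intro mult_right_mono) auto
    finally show "\<bar>w i t u - w i t v\<bar> \<le> C * dist u v" .
  qed
qed

text \<open>Collects what the estimates use: first and pure second space derivatives up to the
  boundary, one constant for all bounds, and the equation written with \<open>w2\<close>. On the
  faces \<open>w2\<close> replaces \<open>laplacian\<close>, whose two-sided \<open>deriv\<close> is
  not controlled there.\<close>

locale heat_profile =
  fixes T :: real and w :: "real \<Rightarrow> real ^ 'd::finite \<Rightarrow> real"
    and w1 w2 :: "'d \<Rightarrow> real \<Rightarrow> real ^ 'd \<Rightarrow> real" and C :: real
  assumes T: "0 < T"
    and der1: "\<And>i t u s. t \<in> {0..T} \<Longrightarrow> u + s *\<^sub>R axis i 1 \<in> closed_cube \<Longrightarrow>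
      ((\<lambda>s. w t (u + s *\<^sub>R axis i 1)) has_real_derivative w1 i t (u + s *\<^sub>R axis i 1))
        (at s within {s. u + s *\<^sub>R axis i 1 \<in> closed_cube})"
    and der2: "\<And>i t u s. t \<in> {0..T} \<Longrightarrow> u + s *\<^sub>R axis i 1 \<in> closed_cube \<Longrightarrow>
      ((\<lambda>s. w1 i t (u + s *\<^sub>R axis i 1)) has_real_derivative w2 i t (u + s *\<^sub>R axis i 1))
        (at s within {s. u + s *\<^sub>R axis i 1 \<in> closed_cube})"
    and lip0: "\<And>t u v. t \<in> {0..T} \<Longrightarrow> u \<in> closed_cube \<Longrightarrow> v \<in> closed_cube \<Longrightarrow> \<bar>w t u - w t v\<bar> \<le> C * dist u v"
    and lip1: "\<And>i t u v. t \<in> {0..T} \<Longrightarrow> u \<in> closed_cube \<Longrightarrow> v \<in> closed_cube \<Longrightarrow> \<bar>w1 i t u - w1 i t v\<bar> \<le> C * dist u v"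
    and lip2: "\<And>i t u v. t \<in> {0..T} \<Longrightarrow> u \<in> closed_cube \<Longrightarrow> v \<in> closed_cube \<Longrightarrow> \<bar>w2 i t u - w2 i t v\<bar> \<le> C * dist u v"
    and bound1: "\<And>i t u. t \<in> {0..T} \<Longrightarrow> u \<in> closed_cube \<Longrightarrow> \<bar>w1 i t u\<bar> \<le> C"
    and bound2: "\<And>i t u. t \<in> {0..T} \<Longrightarrow> u \<in> closed_cube \<Longrightarrow> \<bar>w2 i t u\<bar> \<le> C"
    and cont: "continuous_on ({0..T} \<times> closed_cube) (\<lambda>(t, u). w t u)"
    and time: "\<And>t u. t \<in> {0..T} \<Longrightarrow> u \<in> cube \<Longrightarrow>
      ((\<lambda>s. w s u) has_real_derivative (\<Sum>i \<in> UNIV. w2 i t u)) (at t within {0..T})"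

lemma cube_line_interior:
  fixes u :: "real ^ 'd::finite"
  assumes "u \<in> cube" shows "\<forall>\<^sub>F s in nhds 0. u + s *\<^sub>R axis i 1 \<in> cube"
proof -
  have "\<forall>\<^sub>F s in nhds (0 :: real). 0 < u $ i + s \<and> u $ i + s < 1"
  proof (intro eventually_conj)
    have "((\<lambda>s. u $ i + s) \<longlongrightarrow> u $ i + 0) (nhds 0)"
      by (intro tendsto_add tendsto_const filterlim_ident)
    then show "\<forall>\<^sub>F s in nhds (0 :: real). 0 < u $ i + s" "\<forall>\<^sub>F s in nhds (0 :: real). u $ i + s < 1"
      using assms by (auto simp: cube_def intro: order_tendstoD)
  qed
  then show ?thesis
    by eventually_elim (use assms in \<open>auto simp: cube_def axis_def\<close>)
qed

text \<open>\<open>partial_deriv\<close> is two-sided. At an interior point a short piece of the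
  line stays inside the cube, so the derivative within the cube is the full one; for the second
  derivative the first identity is used on that whole piece.\<close>

lemma laplacian_eq:
  fixes f :: "real ^ 'd::finite \<Rightarrow> real"
  assumes f1: "\<And>i u s. u + s *\<^sub>R axis i 1 \<in> closed_cube \<Longrightarrow>
      ((\<lambda>s. f (u + s *\<^sub>R axis i 1)) has_real_derivative f1 i (u + s *\<^sub>R axis i 1))
        (at s within {s. u + s *\<^sub>R axis i 1 \<in> closed_cube})"
    and f2: "\<And>i u s. u + s *\<^sub>R axis i 1 \<in> closed_cube \<Longrightarrow>
      ((\<lambda>s. f1 i (u + s *\<^sub>R axis i 1)) has_real_derivative f2 i (u + s *\<^sub>R axis i 1))
        (at s within {s. u + s *\<^sub>R axis i 1 \<in> closed_cube})"
    and u: "u \<in> cube"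
  shows "laplacian f u = (\<Sum>i \<in> UNIV. f2 i u)"
proof -
  have at0: "at 0 within {s. v + s *\<^sub>R axis i 1 \<in> closed_cube} = at 0" if v: "v \<in> cube" for v :: "real ^ 'd" and i
  proof -
    obtain U where "open U" "0 \<in> U" "\<And>s. s \<in> U \<Longrightarrow> v + s *\<^sub>R axis i 1 \<in> cube"
      using cube_line_interior[OF v, of i] unfolding eventually_nhds by blast
    moreover from this have "{s. v + s *\<^sub>R axis i 1 \<in> closed_cube} \<inter> U - {0} = UNIV \<inter> U - {0}"
      using cube_subset by blast
    ultimately show ?thesis by (intro at_within_nhd)
  qed
  have p1: "partial_deriv i f v = f1 i v" if "v \<in> cube" for v i
    using f1[of v 0 i] that cube_subset at0[OF that, of i]
    unfolding partial_deriv_def by (intro DERIV_imp_deriv) auto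
  have "partial_deriv i (partial_deriv i f) u = f2 i u" for i
  proof -
    have "((\<lambda>s. f1 i (u + s *\<^sub>R axis i 1)) has_real_derivative f2 i u) (at 0)"
      using f2[of u 0 i] u cube_subset at0[OF u, of i] by auto
    moreover have "\<forall>\<^sub>F s in nhds 0. f1 i (u + s *\<^sub>R axis i 1) = partial_deriv i f (u + s *\<^sub>R axis i 1)"
      using cube_line_interior[OF u, of i] by eventually_elim (simp add: p1)
    ultimately have "((\<lambda>s. partial_deriv i f (u + s *\<^sub>R axis i 1)) has_real_derivative f2 i u) (at 0)"
      by (rule DERIV_cong_ev[THEN iffD1, OF refl _ refl, rotated])
    then show ?thesis unfolding partial_deriv_def[of i "partial_deriv i f"] by (rule DERIV_imp_deriv)
  qed
  then show ?thesis by (simp add: laplacian_def)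
qed

lemma hydrodynamic_solution_profile:
  fixes \<rho> :: "real \<Rightarrow> real ^ 'd::finite \<Rightarrow> real"
  assumes hs: "hydrodynamic_solution \<theta> c g \<rho>\<^sub>0 T \<rho>" and T: "0 < T"
  shows "\<exists>w1 w2 C. heat_profile T \<rho> w1 w2 C"
proof -
  have sm: "smooth_profile T \<rho>" using hs by (simp add: hydrodynamic_solution_def)
  obtain w1 where w1: "\<And>i. smooth_profile T (w1 i)" and d1: "\<And>i t u s. t \<in> {0..T} \<Longrightarrow> u + s *\<^sub>R axis i 1 \<in> closed_cube \<Longrightarrow>
      ((\<lambda>s. \<rho> t (u + s *\<^sub>R axis i 1)) has_real_derivative w1 i t (u + s *\<^sub>R axis i 1))
        (at s within {s. u + s *\<^sub>R axis i 1 \<in> closed_cube})"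
    using smooth_profile_partial[OF sm] by blast
  have "\<forall>i. \<exists>w'. smooth_profile T w' \<and> (\<forall>t \<in> {0..T}. \<forall>u s. u + s *\<^sub>R axis i 1 \<in> closed_cube \<longrightarrow>
    ((\<lambda>s. w1 i t (u + s *\<^sub>R axis i 1)) has_real_derivative w' t (u + s *\<^sub>R axis i 1))
      (at s within {s. u + s *\<^sub>R axis i 1 \<in> closed_cube}))"
    using smooth_profile_partial[OF w1] by blast
  then obtain w2 where w2: "\<And>i. smooth_profile T (w2 i)" and d2: "\<And>i t u s. t \<in> {0..T} \<Longrightarrow> u + s *\<^sub>R axis i 1 \<in> closed_cube \<Longrightarrow>
      ((\<lambda>s. w1 i t (u + s *\<^sub>R axis i 1)) has_real_derivative w2 i t (u + s *\<^sub>R axis i 1))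
        (at s within {s. u + s *\<^sub>R axis i 1 \<in> closed_cube})"
    by metis
  obtain C0 where C0: "\<And>t u v. t \<in> {0..T} \<Longrightarrow> u \<in> closed_cube \<Longrightarrow> v \<in> closed_cube \<Longrightarrow> \<bar>\<rho> t u - \<rho> t v\<bar> \<le> C0 * dist u v"
    using smooth_profile_bounds[of T "\<lambda>_ :: unit. \<rho>"] sm by blast
  obtain C1 where C1: "\<And>i t u. t \<in> {0..T} \<Longrightarrow> u \<in> closed_cube \<Longrightarrow> \<bar>w1 i t u\<bar> \<le> C1"
    "\<And>i t u v. t \<in> {0..T} \<Longrightarrow> u \<in> closed_cube \<Longrightarrow> v \<in> closed_cube \<Longrightarrow> \<bar>w1 i t u - w1 i t v\<bar> \<le> C1 * dist u v"
    using smooth_profile_bounds[of T w1, OF w1] by blast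
  obtain C2 where C2: "\<And>i t u. t \<in> {0..T} \<Longrightarrow> u \<in> closed_cube \<Longrightarrow> \<bar>w2 i t u\<bar> \<le> C2"
    "\<And>i t u v. t \<in> {0..T} \<Longrightarrow> u \<in> closed_cube \<Longrightarrow> v \<in> closed_cube \<Longrightarrow> \<bar>w2 i t u - w2 i t v\<bar> \<le> C2 * dist u v"
    using smooth_profile_bounds[of T w2, OF w2] by blast
  define C where "C = \<bar>C0\<bar> + \<bar>C1\<bar> + \<bar>C2\<bar>"
  have C: "C0 \<le> C" "C1 \<le> C" "C2 \<le> C" by (auto simp: C_def)
  have mono: "a \<le> C * b" if "a \<le> D * b" "D \<le> C" "0 \<le> b" for a b D
    using that mult_right_mono[of D C b] by linarith
  have L0: "\<bar>\<rho> t u - \<rho> t v\<bar> \<le> C * dist u v"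
    and L1: "\<bar>w1 i t u - w1 i t v\<bar> \<le> C * dist u v" and L2: "\<bar>w2 i t u - w2 i t v\<bar> \<le> C * dist u v"
    if "t \<in> {0..T}" "u \<in> closed_cube" "v \<in> closed_cube" for i t u v
    using mono[OF C0[OF that] C(1)] mono[OF C1(2)[OF that] C(2)] mono[OF C2(2)[OF that] C(3)] by auto
  have B1: "\<bar>w1 i t u\<bar> \<le> C" and B2: "\<bar>w2 i t u\<bar> \<le> C" if "t \<in> {0..T}" "u \<in> closed_cube" for i t u
    using order_trans[OF C1(1)[OF that] C(2)] order_trans[OF C2(1)[OF that] C(3)] by auto
  have cont: "continuous_on ({0..T} \<times> closed_cube) (\<lambda>(t, u). \<rho> t u)"
    using sm by (rule smooth_on_continuous)
  have time: "((\<lambda>s. \<rho> s u) has_real_derivative (\<Sum>i \<in> UNIV. w2 i t u)) (at t within {0..T})"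
    if "t \<in> {0..T}" "u \<in> cube" for t u
  proof -
    have "laplacian (\<rho> t) u = (\<Sum>i \<in> UNIV. w2 i t u)"
      using laplacian_eq[OF d1[OF that(1)] d2[OF that(1)] that(2)] .
    moreover have "((\<lambda>s. \<rho> s u) has_real_derivative laplacian (\<rho> t) u) (at t within {0..T})"
      using hs that by (auto simp: hydrodynamic_solution_def)
    ultimately show ?thesis by simp
  qed
  have "heat_profile T \<rho> w1 w2 C"
    by (rule heat_profile.intro) (assumption | rule T d1 d2 L0 L1 L2 B1 B2 cont time)+
  then show ?thesis by blast
qed

section \<open>Taylor bounds and the maximum principle\<close>

text \<open>The mean value inequality for \<phi> s - s \<phi>'(0), whose derivative is at most C |h|
  on the segment. A closed segment instead of an interval covers both signs of h.\<close>

lemma segment_taylor: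
  fixes \<phi> \<phi>' :: "real \<Rightarrow> real"
  assumes der: "\<And>s. s \<in> closed_segment 0 h \<Longrightarrow> (\<phi> has_real_derivative \<phi>' s) (at s within closed_segment 0 h)"
    and lip: "\<And>s. s \<in> closed_segment 0 h \<Longrightarrow> \<bar>\<phi>' s - \<phi>' 0\<bar> \<le> C * \<bar>s\<bar>" and C: "0 \<le> C"
  shows "\<bar>\<phi> h - \<phi> 0 - h * \<phi>' 0\<bar> \<le> C * h\<^sup>2"
proof -
  have seg: "\<bar>s\<bar> \<le> \<bar>h\<bar>" if "s \<in> closed_segment 0 h" for s
    using that by (auto simp: closed_segment_eq_real_ivl split: if_splits)
  have "norm ((\<phi> h - h * \<phi>' 0) - (\<phi> 0 - 0 * \<phi>' 0)) \<le> (C * \<bar>h\<bar>) * norm (h - 0)"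
  proof (rule field_differentiable_bound[of "closed_segment 0 h" "\<lambda>s. \<phi> s - s * \<phi>' 0" "\<lambda>s. \<phi>' s - \<phi>' 0"])
    fix s assume s: "s \<in> closed_segment 0 h"
    show "((\<lambda>s. \<phi> s - s * \<phi>' 0) has_real_derivative \<phi>' s - \<phi>' 0) (at s within closed_segment 0 h)"
      using der[OF s] by (auto intro!: derivative_eq_intros)
    show "norm (\<phi>' s - \<phi>' 0) \<le> C * \<bar>h\<bar>"
      using lip[OF s] mult_left_mono[OF seg[OF s] C] by simp
  qed auto
  moreover have "(C * \<bar>h\<bar>) * norm (h - 0) = C * h\<^sup>2"
    by (simp add: power2_eq_square mult.assoc)
  ultimately show ?thesis by (simp add: algebra_simps power2_eq_square)
qed

lemma le_of_le_add_small:
  fixes a b :: real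
  assumes "0 < h0" "\<And>h. 0 < h \<Longrightarrow> h \<le> h0 \<Longrightarrow> a \<le> b + K * h" shows "a \<le> b"
proof (rule tendsto_lowerbound[of "\<lambda>h. b + K * h" b "at_right 0"])
  have "((\<lambda>h. b + K * h) \<longlongrightarrow> b + K * 0) (at_right 0)" by (intro tendsto_intros)
  then show "((\<lambda>h. b + K * h) \<longlongrightarrow> b) (at_right 0)" by simp
  show "\<forall>\<^sub>F h in at_right 0. a \<le> b + K * h"
    using eventually_at_right_less[of 0] eventually_at_right_real[OF assms(1)]
    by eventually_elim (use assms(2) in auto)
qed simp

lemma closed_cube_segment:
  fixes u :: "real ^ 'd::finite"
  assumes "u \<in> closed_cube" "u + h *\<^sub>R axis i 1 \<in> closed_cube" "s \<in> closed_segment 0 h"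
  shows "u + s *\<^sub>R axis i 1 \<in> closed_cube"
proof -
  obtain l where l: "0 \<le> l" "l \<le> 1" "s = l * h" using assms(3) by (auto simp: in_segment)
  have "(1 - l) *\<^sub>R u + l *\<^sub>R (u + h *\<^sub>R axis i 1) \<in> closed_cube"
    using convex_closed_cube assms l unfolding convex_alt by blast
  also have "(1 - l) *\<^sub>R u + l *\<^sub>R (u + h *\<^sub>R axis i 1) = u + s *\<^sub>R axis i 1"
    by (simp add: l algebra_simps)
  finally show ?thesis .
qed

context heat_profile
begin

lemma C_nonneg: "0 \<le> C"
proof -
  have "(0 :: real ^ 'd) \<in> closed_cube" by (simp add: closed_cube_def)
  then show ?thesis using bound1[of 0 0 undefined] T by (auto intro: order_trans[OF abs_ge_zero])
qed

text \<open>Reduces the lower bound for the solution to the maximum principle.\<close>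

lemma heat_profile_uminus: "heat_profile T (\<lambda>t u. - w t u) (\<lambda>i t u. - w1 i t u) (\<lambda>i t u. - w2 i t u) C"
proof (rule heat_profile.intro)
  fix i t s and u v :: "real ^ 'd"
  show "((\<lambda>s. - w t (u + s *\<^sub>R axis i 1)) has_real_derivative - w1 i t (u + s *\<^sub>R axis i 1))
        (at s within {s. u + s *\<^sub>R axis i 1 \<in> closed_cube})"
    if "t \<in> {0..T}" "u + s *\<^sub>R axis i 1 \<in> closed_cube"
    by (intro DERIV_minus der1 that)
  show "((\<lambda>s. - w1 i t (u + s *\<^sub>R axis i 1)) has_real_derivative - w2 i t (u + s *\<^sub>R axis i 1))
        (at s within {s. u + s *\<^sub>R axis i 1 \<in> closed_cube})"
    if "t \<in> {0..T}" "u + s *\<^sub>R axis i 1 \<in> closed_cube"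
    by (intro DERIV_minus der2 that)
  show "((\<lambda>s. - w s u) has_real_derivative (\<Sum>i\<in>UNIV. - w2 i t u)) (at t within {0..T})"
    if "t \<in> {0..T}" "u \<in> cube"
    using DERIV_minus[OF time[OF that]] by (simp add: sum_negf)
  show "\<bar>- w t u - - w t v\<bar> \<le> C * dist u v" "\<bar>- w1 i t u - - w1 i t v\<bar> \<le> C * dist u v" "\<bar>- w2 i t u - - w2 i t v\<bar> \<le> C * dist u v"
    if "t \<in> {0..T}" "u \<in> closed_cube" "v \<in> closed_cube"
    using lip0[OF that] lip1[OF that, of i] lip2[OF that, of i] by (auto simp: abs_minus_commute)
  show "\<bar>- w1 i t u\<bar> \<le> C" "\<bar>- w2 i t u\<bar> \<le> C" if "t \<in> {0..T}" "u \<in> closed_cube"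
    using bound1[OF that] bound2[OF that] by auto
  show "continuous_on ({0..T} \<times> closed_cube) (\<lambda>(t, u). - w t u)"
    using continuous_on_minus[OF cont] by (simp add: case_prod_unfold)
qed (rule T)

lemma taylor1:
  assumes t: "t \<in> {0..T}" and u: "u \<in> closed_cube" "u + h *\<^sub>R axis i 1 \<in> closed_cube"
  shows "\<bar>w t (u + h *\<^sub>R axis i 1) - w t u - h * w1 i t u\<bar> \<le> C * h\<^sup>2"
    and "\<bar>w1 i t (u + h *\<^sub>R axis i 1) - w1 i t u - h * w2 i t u\<bar> \<le> C * h\<^sup>2"
proof -
  let ?l = "\<lambda>s. u + s *\<^sub>R axis i 1"
  have cc: "?l s \<in> closed_cube" if "s \<in> closed_segment 0 h" for s
    using closed_cube_segment[OF u that] .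
  have dist: "dist (?l s) u = \<bar>s\<bar>" for s by (simp add: dist_norm norm_axis_1)
  have "\<bar>w t (?l h) - w t (?l 0) - h * w1 i t (?l 0)\<bar> \<le> C * h\<^sup>2"
    by (rule segment_taylor[OF DERIV_subset[OF der1[OF t cc]]])
      (use cc lip1[OF t cc u(1)] C_nonneg dist in auto)
  then show "\<bar>w t (?l h) - w t u - h * w1 i t u\<bar> \<le> C * h\<^sup>2" by simp
  have "\<bar>w1 i t (?l h) - w1 i t (?l 0) - h * w2 i t (?l 0)\<bar> \<le> C * h\<^sup>2"
    by (rule segment_taylor[OF DERIV_subset[OF der2[OF t cc]]])
      (use cc lip2[OF t cc u(1)] C_nonneg dist in auto)
  then show "\<bar>w1 i t (?l h) - w1 i t u - h * w2 i t u\<bar> \<le> C * h\<^sup>2" by simp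
qed

text \<open>In the derivative of the symmetrised function the constant terms cancel, and each side
  contributes an error C s^2 by \<open>taylor1\<close>; hence a cubic remainder.\<close>

lemma taylor2:
  assumes t: "t \<in> {0..T}" and u: "u \<in> closed_cube" "u + h *\<^sub>R axis i 1 \<in> closed_cube" "u - h *\<^sub>R axis i 1 \<in> closed_cube"
    and h: "0 \<le> h"
  shows "\<bar>w t (u + h *\<^sub>R axis i 1) + w t (u - h *\<^sub>R axis i 1) - 2 * w t u - h\<^sup>2 * w2 i t u\<bar> \<le> 2 * C * h ^ 3"
proof -
  let ?l = "\<lambda>s. u + s *\<^sub>R axis i 1"
  have cc: "?l s \<in> closed_cube" "?l (- s) \<in> closed_cube" if "s \<in> {0..h}" for s
    using closed_cube_segment[OF u(1,2), of s] closed_cube_segment[of u "- h" i "- s"] u that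
    by (auto simp: closed_segment_eq_real_ivl)
  let ?q = "\<lambda>s. w t (?l s) + w t (?l (- s)) - s\<^sup>2 * w2 i t u"
  have "norm (?q h - ?q 0) \<le> (2 * C * h\<^sup>2) * norm (h - 0)"
  proof (rule field_differentiable_bound[of "{0..h}" ?q "\<lambda>s. w1 i t (?l s) + w1 i t (?l (- s)) * (- 1) - 2 * s * w2 i t u"])
    fix s assume s: "s \<in> {0..h}"
    have 1: "((\<lambda>s. w t (?l s)) has_real_derivative w1 i t (?l s)) (at s within {0..h})"
      by (rule DERIV_subset[OF der1[OF t cc(1)[OF s]]]) (use cc in auto)
    have "((\<lambda>s. w t (?l s)) has_real_derivative w1 i t (?l (- s))) (at (- s) within uminus ` {0..h})"
      by (rule DERIV_subset[OF der1[OF t cc(2)[OF s]]]) (use cc(2) in blast)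
    then have "((\<lambda>s. w t (?l s)) \<circ> uminus has_real_derivative w1 i t (?l (- s)) * (- 1)) (at s within {0..h})"
      by (rule DERIV_image_chain) (auto intro!: derivative_eq_intros)
    then have 2: "((\<lambda>s. w t (?l (- s))) has_real_derivative w1 i t (?l (- s)) * (- 1)) (at s within {0..h})"
      by (simp add: o_def)
    show "(?q has_real_derivative w1 i t (?l s) + w1 i t (?l (- s)) * (- 1) - 2 * s * w2 i t u) (at s within {0..h})"
      by (rule derivative_eq_intros 1 2 refl)+ simp
    have "\<bar>w1 i t (?l s) - w1 i t u - s * w2 i t u\<bar> \<le> C * s\<^sup>2"
      "\<bar>w1 i t (?l (- s)) - w1 i t u - (- s) * w2 i t u\<bar> \<le> C * (- s)\<^sup>2"
      by (intro taylor1(2)[OF t u(1)] cc s)+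
    moreover have "C * s\<^sup>2 \<le> C * h\<^sup>2" using s C_nonneg by (intro mult_left_mono power_mono) auto
    ultimately show "norm (w1 i t (?l s) + w1 i t (?l (- s)) * (- 1) - 2 * s * w2 i t u) \<le> 2 * C * h\<^sup>2"
      by (simp add: abs_le_iff)
  qed (use h in auto)
  also have "?q h - ?q 0 = w t (u + h *\<^sub>R axis i 1) + w t (u - h *\<^sub>R axis i 1) - 2 * w t u - h\<^sup>2 * w2 i t u" by simp
  also have "2 * C * h\<^sup>2 * norm (h - 0) = 2 * C * h ^ 3" using h by (simp add: power2_eq_square power3_eq_cube)
  finally show ?thesis by simp
qed

text \<open>The perturbation \<open>\<delta> * (\<Sum>i. (u\<^sub>i - 1/2)\<^sup>2 + (2 d + 1) t)\<close> is a strict supersolution with positive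
  outward normal derivative, so that neither an interior point nor a point of a face can be a
  maximum above \<open>M\<close>.\<close>

lemma maximum_principle:
  assumes init: "\<And>u. u \<in> closed_cube \<Longrightarrow> w 0 u \<le> M"
    and bc: "\<And>t u i. t \<in> {0..T} \<Longrightarrow> u \<in> closed_cube \<Longrightarrow> M < w t u \<Longrightarrow>
      (u $ i = 0 \<longrightarrow> 0 \<le> w1 i t u) \<and> (u $ i = 1 \<longrightarrow> w1 i t u \<le> 0)"
    and tu: "t \<in> {0..T}" "u \<in> closed_cube"
  shows "w t u \<le> M"
proof -
  \<comment> \<open>The rate 2 d + 1 exceeds by one the Laplacian 2 d of the quadratic part, which
    makes the inequality at an interior maximum strict.\<close>
  define b where "b t u = (\<Sum>i \<in> UNIV. (u $ i - 1 / 2)\<^sup>2) + (2 * real CARD('d) + 1) * t" for t and u :: "real ^ 'd"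
  have b_shift: "b t (u + h *\<^sub>R axis i 1) = b t u + (2 * h * (u $ i - 1 / 2) + h\<^sup>2)" for t u h i
  proof -
    have "(\<Sum>j \<in> UNIV. ((u + h *\<^sub>R axis i 1) $ j - 1 / 2)\<^sup>2) =
        ((u + h *\<^sub>R axis i 1) $ i - 1 / 2)\<^sup>2 + (\<Sum>j \<in> UNIV - {i}. (u $ j - 1 / 2)\<^sup>2)"
      by (subst sum.remove[of UNIV i]) (auto simp: axis_def intro!: sum.cong)
    moreover have "(\<Sum>j \<in> UNIV. (u $ j - 1 / 2)\<^sup>2) = (u $ i - 1 / 2)\<^sup>2 + (\<Sum>j \<in> UNIV - {i}. (u $ j - 1 / 2)\<^sup>2)"
      by (rule sum.remove) auto
    ultimately show ?thesis by (simp add: b_def axis_def power2_eq_square algebra_simps)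
  qed
  have b0: "0 \<le> b t u" if "0 \<le> t" for t u
    unfolding b_def using that by (intro add_nonneg_nonneg sum_nonneg mult_nonneg_nonneg) auto
  have main: "w t u - \<delta> * b t u \<le> M" if \<delta>: "0 < \<delta>" for \<delta>
  proof -
    define v where "v t u = w t u - \<delta> * b t u" for t u
    let ?S = "{0..T} \<times> (closed_cube :: (real ^ 'd) set)"
    have "continuous_on ?S (\<lambda>p. (\<lambda>(t, u). w t u) p - \<delta> * b (fst p) (snd p))"
      unfolding b_def by (intro continuous_intros cont)
    then have "continuous_on ?S (\<lambda>(t, u). v t u)" by (simp add: v_def case_prod_unfold)
    moreover have "compact ?S" by (intro compact_Times compact_closed_cube) auto
    ultimately obtain p where p: "p \<in> ?S" "\<And>q. q \<in> ?S \<Longrightarrow> (\<lambda>(t, u). v t u) q \<le> (\<lambda>(t, u). v t u) p"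
      using continuous_attains_sup[of ?S] tu by blast
    obtain s x where sx: "p = (s, x)" by (cases p)
    have s: "s \<in> {0..T}" and x: "x \<in> closed_cube" using p sx by auto
    have max: "v t u \<le> v s x" if "t \<in> {0..T}" "u \<in> closed_cube" for t u
      using p(2)[of "(t, u)"] that sx by auto
    have shift: "w s (x + h *\<^sub>R axis i 1) - w s x \<le> \<delta> * (2 * h * (x $ i - 1 / 2) + h\<^sup>2)"
      if "x + h *\<^sub>R axis i 1 \<in> closed_cube" for h i
      using max[OF s that] by (simp add: v_def b_shift algebra_simps)
    have "v s x \<le> M"
    proof (rule ccontr)
      assume "\<not> v s x \<le> M"
      moreover have "0 \<le> \<delta> * b s x" using b0[of s x] s \<delta> by simp
      \<comment> \<open>Since the perturbation is nonnegative, v > M implies w > M, the region in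
        which the boundary hypothesis speaks.\<close>
      ultimately have big: "M < w s x" by (simp add: v_def)
      then have "s \<noteq> 0" using init[OF x] by auto
      then have s0: "0 < s" using s by simp
      show False
      proof (cases "x \<in> cube")
        case True
        have w2: "w2 i s x \<le> 2 * \<delta>" for i
        proof (rule le_of_le_add_small)
          define h0 where "h0 = min (x $ i) (1 - x $ i)"
          show "0 < h0" using True by (simp add: h0_def cube_def)
          fix h assume h: "0 < h" "h \<le> h0"
          have cc: "x + h *\<^sub>R axis i 1 \<in> closed_cube" "x + (- h) *\<^sub>R axis i 1 \<in> closed_cube"
            using x h by (auto simp: closed_cube_def axis_def h0_def)
          then have cc': "x - h *\<^sub>R axis i 1 \<in> closed_cube" by simp
          have "h\<^sup>2 * w2 i s x \<le> 2 * \<delta> * h\<^sup>2 + 2 * C * h ^ 3"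
            using taylor2[OF s x cc(1) cc'] shift[OF cc(1)] shift[OF cc(2)] h
            by (simp add: abs_le_iff algebra_simps)
          then have "h\<^sup>2 * w2 i s x \<le> h\<^sup>2 * (2 * \<delta> + 2 * C * h)"
            by (simp add: algebra_simps power2_eq_square power3_eq_cube)
          then show "w2 i s x \<le> 2 * \<delta> + 2 * C * h" using h by simp
        qed
        have "((\<lambda>t. v t x) has_real_derivative (\<Sum>i \<in> UNIV. w2 i s x) - \<delta> * (2 * real CARD('d) + 1)) (at s within {0..T})"
          unfolding v_def b_def by (rule derivative_eq_intros time[OF s True] refl)+ simp
        moreover have "(\<Sum>i \<in> UNIV. w2 i s x) \<le> (\<Sum>i \<in> (UNIV :: 'd set). 2 * \<delta>)" by (intro sum_mono w2)
        then have "(\<Sum>i \<in> UNIV. w2 i s x) - \<delta> * (2 * real CARD('d) + 1) < 0"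
          using \<delta> by (simp add: algebra_simps)
        \<comment> \<open>A negative derivative within [0, T] already yields larger values just
          before s, which also covers s = T.\<close>
        ultimately obtain d where d: "d > 0" "\<And>h. h > 0 \<Longrightarrow> s - h \<in> {0..T} \<Longrightarrow> h < d \<Longrightarrow> v s x < v (s - h) x"
          using has_real_derivative_neg_dec_left by blast
        define h where "h = min s (d / 2)"
        have h: "h > 0" "s - h \<in> {0..T}" "h < d" using s0 s d by (auto simp: h_def)
        show False using d(2)[OF h] max[OF h(2) x] by simp
      next
        case False
        then obtain i where i: "x $ i = 0 \<or> x $ i = 1"
          using boundary_coordinate x by blast
        \<comment> \<open>\<open>c\<close> is the inward direction: 1 where the coordinate is 0 and
          -1 where it is 1. The perturbation falls inwards at rate \<delta> and \<open>v\<close> is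
          maximal at \<open>x\<close>, so the inward derivative of \<open>w\<close> is at most
          -\<delta>.\<close>
        have small: "False" if c: "c = 1 \<or> c = - 1" "x $ i = (1 - c) / 2" "0 \<le> c * w1 i s x" for c :: real
        proof -
          have "c * w1 i s x \<le> - \<delta>"
          proof (rule le_of_le_add_small[of 1])
            fix h :: real assume h: "0 < h" "h \<le> 1"
            have cc: "x + (c * h) *\<^sub>R axis i 1 \<in> closed_cube"
              using x h c by (auto simp: closed_cube_def axis_def)
            have "c * h * w1 i s x \<le> \<delta> * (2 * (c * h) * (x $ i - 1 / 2) + (c * h)\<^sup>2) + C * (c * h)\<^sup>2"
              using taylor1(1)[OF s x cc] shift[OF cc] by (simp add: abs_le_iff)
            also have "\<dots> = h * (- \<delta> + (\<delta> + C) * h)"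
              using c(1,2) by (auto simp: power2_eq_square algebra_simps)
            finally have "h * (c * w1 i s x) \<le> h * (- \<delta> + (\<delta> + C) * h)" by (simp add: mult_ac)
            then show "c * w1 i s x \<le> - \<delta> + (\<delta> + C) * h" using h by simp
          qed simp
          then show False using c \<delta> by linarith
        qed
        show False
          using i small[of 1] small[of "- 1"] bc[OF s x big, of i] by auto
      qed
    qed
    then show ?thesis using max[OF tu] by (simp add: v_def)
  qed
  show ?thesis
  proof (rule le_of_le_add_small[of 1])
    fix \<delta> :: real assume "0 < \<delta>" "\<delta> \<le> 1"
    then show "w t u \<le> M + b t u * \<delta>" using main[of \<delta>] by (simp add: algebra_simps)
  qed simp
qed

text \<open>The boundary condition is a limit from the right at 0 and \<open>w1\<close> a derivative
  within the cube; both restrict to \<open>{0<..<1}\<close>, where the limit is unique.\<close>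

lemma right_partial_unique:
  assumes t: "t \<in> {0..T}" and u: "u \<in> face_plus i" and D: "has_right_partial i (w t) u D"
  shows "D = w1 i t u"
proof -
  have u': "u \<in> closed_cube" "u $ i = 0" using u by (auto simp: face_plus_def cube_boundary_def)
  have sub: "{0<..<1} \<subseteq> {s. u + s *\<^sub>R axis i 1 \<in> closed_cube}"
    using u' by (auto simp: closed_cube_def axis_def)
  have 1: "((\<lambda>s. w t (u + s *\<^sub>R axis i 1)) has_real_derivative w1 i t u) (at 0 within {0<..<1})"
    using DERIV_subset[OF der1[OF t, of u 0 i] sub] u' by simp
  have 2: "((\<lambda>s. w t (u + s *\<^sub>R axis i 1)) has_real_derivative D) (at 0 within {0<..<1})"
    using D unfolding has_right_partial_def by (rule DERIV_subset) auto
  show ?thesis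
    using tendsto_unique[OF _ 2[unfolded has_field_derivative_iff] 1[unfolded has_field_derivative_iff]]
    by (simp add: at_within_eq_bot_iff islimpt_greaterThanLessThan1 trivial_limit_within)
qed

lemma left_partial_unique:
  assumes t: "t \<in> {0..T}" and u: "u \<in> face_minus i" and D: "has_left_partial i (w t) u D"
  shows "D = w1 i t u"
proof -
  have u': "u \<in> closed_cube" "u $ i = 1" using u by (auto simp: face_minus_def cube_boundary_def)
  have sub: "{- 1<..<0} \<subseteq> {s. u + s *\<^sub>R axis i 1 \<in> closed_cube}"
    using u' by (auto simp: closed_cube_def axis_def)
  have 1: "((\<lambda>s. w t (u + s *\<^sub>R axis i 1)) has_real_derivative w1 i t u) (at 0 within {- 1<..<0})"
    using DERIV_subset[OF der1[OF t, of u 0 i] sub] u' by simp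
  have 2: "((\<lambda>s. w t (u + s *\<^sub>R axis i 1)) has_real_derivative D) (at 0 within {- 1<..<0})"
    using D unfolding has_left_partial_def by (rule DERIV_subset) auto
  show ?thesis
    using tendsto_unique[OF _ 2[unfolded has_field_derivative_iff] 1[unfolded has_field_derivative_iff]]
    by (simp add: islimpt_greaterThanLessThan2 trivial_limit_within)
qed

end

section \<open>The drift of the reference measure\<close>

text \<open>The competitor \<open>v\<close> moves one extreme coordinate by 1 / n onto its face and
  keeps the others.\<close>

lemma nearest_boundary_point_near:
  fixes z :: "int ^ 'd::finite"
  assumes p: "nearest_boundary_point p" and z: "z \<in> boundary_sites n" and n: "3 \<le> n"
  shows "rescale n z \<in> cube" "p (rescale n z) \<in> cube_boundary" "dist (rescale n z) (p (rescale n z)) \<le> 1 / real n"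
proof -
  let ?u = "rescale n z :: real ^ 'd"
  have zs: "\<And>k. 0 < z $ k" "\<And>k. z $ k < int n" using z by (auto simp: boundary_sites_def sites_def)
  have n0: "0 < real n" using n by simp
  have zr: "0 < real_of_int (z $ k)" "real_of_int (z $ k) < real n" for k
    using zs[of k] by simp_all
  then show u: "?u \<in> cube" using n0 by (auto simp: cube_def rescale_def)
  then show "p ?u \<in> cube_boundary" using p by (auto simp: nearest_boundary_point_def)
  obtain i where i: "z $ i = 1 \<or> z $ i = int n - 1" using z by (auto simp: boundary_sites_def)
  define s :: real where "s = (if z $ i = 1 then - 1 else 1)"
  define v where "v = ?u + (s / real n) *\<^sub>R axis i 1"
  have vi: "v $ i = 0 \<or> v $ i = 1"
    using i n0 by (auto simp: v_def s_def rescale_def axis_def field_simps)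
  have vk: "v $ k = ?u $ k" if "k \<noteq> i" for k using that by (simp add: v_def axis_def)
  have "v \<in> closed_cube"
    unfolding closed_cube_def
  proof (intro CollectI allI)
    fix k show "0 \<le> v $ k \<and> v $ k \<le> 1"
      using u vi vk[of k] by (cases "k = i") (auto simp: cube_def less_imp_le)
  qed
  moreover have "v \<notin> cube" using vi by (auto simp: cube_def intro!: exI[of _ i])
  ultimately have "v \<in> cube_boundary" by (simp add: cube_boundary_def)
  then have "dist ?u (p ?u) \<le> dist ?u v" using p u by (auto simp: nearest_boundary_point_def)
  also have "dist ?u v = 1 / real n" by (simp add: v_def dist_norm norm_axis_1 s_def)
  finally show "dist ?u (p ?u) \<le> 1 / real n" .
qed

text \<open>Non-extreme coordinates are at least 2 / n away from 0 and 1, while the nearest boundary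
  point lies within 1 / n, so it can touch the boundary only in coordinate \<open>i\<close>, however
  ties are broken by \<open>p\<close>. The two opposite faces are separated by n \<ge> 3.\<close>

lemma nearest_boundary_point_face:
  fixes z :: "int ^ 'd::finite"
  assumes p: "nearest_boundary_point p" and z: "z \<in> boundary_sites n" and n: "3 \<le> n"
    and only: "\<And>k. k \<noteq> i \<Longrightarrow> z $ k \<noteq> 1 \<and> z $ k \<noteq> int n - 1"
  shows "z $ i = 1 \<Longrightarrow> p (rescale n z) \<in> face_plus i"
    and "z $ i = int n - 1 \<Longrightarrow> p (rescale n z) \<in> face_minus i"
proof -
  let ?u = "rescale n z :: real ^ 'd" and ?P = "p (rescale n z)"
  note near = nearest_boundary_point_near[OF p z n]
  have zs: "\<And>k. 0 < z $ k" "\<And>k. z $ k < int n" using z by (auto simp: boundary_sites_def sites_def)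
  have n0: "0 < real n" using n by simp
  have close: "\<bar>real_of_int (z $ k) - real n * ?P $ k\<bar> \<le> 1" for k
  proof -
    have "\<bar>?u $ k - ?P $ k\<bar> \<le> 1 / real n"
      using order_trans[OF dist_vec_nth_le near(3)] by (simp add: dist_real_def)
    then have "real n * \<bar>?u $ k - ?P $ k\<bar> \<le> 1" using n0 by (simp add: field_simps)
    then have "\<bar>real n * (?u $ k - ?P $ k)\<bar> \<le> 1" by (simp add: abs_mult)
    then show ?thesis using n0 by (simp add: rescale_def right_diff_distrib)
  qed
  obtain j where j: "?P $ j = 0 \<or> ?P $ j = 1"
    using boundary_coordinate near(2) by (auto simp: cube_boundary_def)
  have "j = i"
  proof (rule ccontr)
    assume "j \<noteq> i"
    then have "z $ j \<noteq> 1" "z $ j \<noteq> int n - 1" using only by auto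
    then have "2 \<le> z $ j" "z $ j \<le> int n - 2" using zs[of j] by auto
    then have "2 \<le> real_of_int (z $ j)" "real_of_int (z $ j) \<le> real n - 2" by linarith+
    then show False using j close[of j] by auto
  qed
  then show "z $ i = 1 \<Longrightarrow> ?P \<in> face_plus i" "z $ i = int n - 1 \<Longrightarrow> ?P \<in> face_minus i"
    using j close[of i] n near(2) by (auto simp: face_plus_def face_minus_def)
qed

section \<open>The profile on the lattice and its drift\<close>

locale hydrodynamic_profile = heat_profile T w w1 w2 C
  for T and w :: "real \<Rightarrow> real ^ 'd::finite \<Rightarrow> real" and w1 w2 C +
  fixes \<theta> c \<epsilon> :: real and g :: "real ^ 'd \<Rightarrow> real" and p :: "real ^ 'd \<Rightarrow> real ^ 'd"
  assumes \<theta>: "0 \<le> \<theta>" and c: "0 < c" and \<epsilon>: "0 < \<epsilon>" and p: "nearest_boundary_point p"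
    and g: "\<And>u. u \<in> cube_boundary \<Longrightarrow> \<epsilon> \<le> g u \<and> g u \<le> 1 - \<epsilon>"
    and w: "\<And>t u. t \<in> {0..T} \<Longrightarrow> u \<in> closed_cube \<Longrightarrow> \<epsilon> \<le> w t u \<and> w t u \<le> 1 - \<epsilon>"
    and dirichlet: "\<And>t u. \<theta> < 1 \<Longrightarrow> t \<in> {0..T} \<Longrightarrow> u \<in> cube_boundary \<Longrightarrow> w t u = g u"
    and flux_plus: "\<And>t u i. 1 \<le> \<theta> \<Longrightarrow> t \<in> {0..T} \<Longrightarrow> u \<in> face_plus i \<Longrightarrow>
      w1 i t u = (if \<theta> = 1 then c * (w t u - g u) else 0)"
    and flux_minus: "\<And>t u i. 1 \<le> \<theta> \<Longrightarrow> t \<in> {0..T} \<Longrightarrow> u \<in> face_minus i \<Longrightarrow>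
      w1 i t u = (if \<theta> = 1 then c * (g u - w t u) else 0)"
begin

text \<open>Its product with the reservoir rate n^2 c n^(-\<theta>) is exactly n, so a change of the
  profile across this distance produces a reservoir term of order n, like the one-sided lattice
  difference.\<close>

definition margin :: "nat \<Rightarrow> real" where "margin n = real n powr (\<theta> - 1) / c"

definition spacing :: "nat \<Rightarrow> real" where
  "spacing n = (if 1 \<le> \<theta> then 1 / real n else (1 - 2 * margin n) / (real n - 2))"

text \<open>n \<ge> 3 makes the denominator n - 2 in \<open>spacing\<close> positive; the second
  condition keeps the spacing positive and the sites inside the cube when \<theta> < 1.\<close>

definition large :: "nat \<Rightarrow> bool" where
  "large n \<longleftrightarrow> 3 \<le> n \<and> (\<theta> < 1 \<longrightarrow> 2 * margin n < 1)"

definition profile :: "nat \<Rightarrow> real \<Rightarrow> int ^ 'd \<Rightarrow> real" where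
  "profile n t x = w t (site_map \<theta> c n x)"

lemma margin_pos: "large n \<Longrightarrow> 0 < margin n"
  using c by (simp add: margin_def large_def)

lemma spacing_pos: "large n \<Longrightarrow> 0 < spacing n"
  by (auto simp: spacing_def large_def)

text \<open>n / (n - 2) is at most 3 for n \<ge> 3; this is the origin of the factor 3 in
  \<open>profile_step\<close> and in the constants built from it.\<close>

lemma spacing_le: "large n \<Longrightarrow> real n * spacing n \<le> 3"
proof -
  assume n: "large n"
  have "real n * (1 - 2 * margin n) \<le> real n * 1"
    using margin_pos[OF n] by (intro mult_left_mono) auto
  moreover have "3 \<le> real n" using n by (simp add: large_def)
  ultimately have "real n * (1 - 2 * margin n) \<le> 3 * real n - 6" by linarith
  then show ?thesis using n by (auto simp: spacing_def large_def divide_le_eq)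
qed

lemma site_map_shift:
  fixes x :: "int ^ 'b::finite"
  shows "site_map \<theta> c n (x + axis i 1) = site_map \<theta> c n x + spacing n *\<^sub>R axis i 1"
proof (cases "1 \<le> \<theta>")
  case True
  then show ?thesis
    by (auto simp: site_map_def rescale_def spacing_def vec_eq_iff axis_def add_divide_distrib)
next
  case False
  define q where "q = (1 - 2 * margin n) / (real n - 2)"
  have eq: "site_map \<theta> c n y = (\<chi> i. margin n + (real_of_int (y $ i) - 1) * q)" for y :: "int ^ 'b"
    using False by (simp add: site_map_def margin_def q_def)
  show ?thesis
    unfolding eq using False by (simp add: spacing_def q_def[symmetric] vec_eq_iff axis_def algebra_simps)
qed

lemma site_map_shift_back: "site_map \<theta> c n (x - axis i 1) = site_map \<theta> c n x - spacing n *\<^sub>R axis i 1"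
  using site_map_shift[of n "x - axis i 1" i] by (simp add: algebra_simps)

lemma site_map_cube:
  assumes n: "large n" and x: "x \<in> sites n" shows "site_map \<theta> c n x \<in> cube"
proof (cases "1 \<le> \<theta>")
  case True
  have "0 < real_of_int (x $ i) \<and> real_of_int (x $ i) < real n" for i
    using x by (auto simp: sites_def) (metis of_int_less_iff of_int_of_nat_eq)
  then show ?thesis using True n by (auto simp: site_map_def rescale_def cube_def large_def)
next
  case False
  have "0 < margin n + (real_of_int (x $ i) - 1) * ((1 - 2 * margin n) / (real n - 2))"
       "margin n + (real_of_int (x $ i) - 1) * ((1 - 2 * margin n) / (real n - 2)) < 1" for i
  proof -
    have "0 < x $ i" "x $ i < int n" using x by (auto simp: sites_def)
    then have xr: "0 \<le> real_of_int (x $ i) - 1" "real_of_int (x $ i) - 1 \<le> real n - 2" by linarith+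
    have q: "0 \<le> (1 - 2 * margin n) / (real n - 2)" using n False by (auto simp: large_def)
    have "(real_of_int (x $ i) - 1) * ((1 - 2 * margin n) / (real n - 2)) \<le> (real n - 2) * ((1 - 2 * margin n) / (real n - 2))"
      using xr q by (intro mult_right_mono) auto
    also have "\<dots> = 1 - 2 * margin n" using n by (auto simp: large_def)
    finally show "margin n + (real_of_int (x $ i) - 1) * ((1 - 2 * margin n) / (real n - 2)) < 1"
      using margin_pos[OF n] by simp
    show "0 < margin n + (real_of_int (x $ i) - 1) * ((1 - 2 * margin n) / (real n - 2))"
      using margin_pos[OF n] xr q by (intro add_pos_nonneg mult_nonneg_nonneg) auto
  qed
  then show ?thesis using False by (auto simp: site_map_def cube_def margin_def)
qed

lemma site_map_closed: "large n \<Longrightarrow> x \<in> sites n \<Longrightarrow> site_map \<theta> c n x \<in> closed_cube"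
  using site_map_cube cube_subset by blast

lemma profile_bounds:
  assumes "large n" "t \<in> {0..T}" "x \<in> sites n"
  shows "\<epsilon> \<le> profile n t x" "profile n t x \<le> 1 - \<epsilon>"
  using w[OF assms(2) site_map_closed[OF assms(1,3)]] by (auto simp: profile_def)

lemma profile_step:
  assumes n: "large n" and t: "t \<in> {0..T}" and x: "x \<in> sites n" "x + axis i 1 \<in> sites n"
  shows "real n * \<bar>profile n t x - profile n t (x + axis i 1)\<bar> \<le> 3 * C"
proof -
  have "\<bar>profile n t x - profile n t (x + axis i 1)\<bar> \<le> C * dist (site_map \<theta> c n x) (site_map \<theta> c n (x + axis i 1))"
    unfolding profile_def by (intro lip0 t site_map_closed n x)
  also have "\<dots> = C * spacing n"
    using spacing_pos[OF n] by (simp add: site_map_shift dist_norm norm_axis_1)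
  finally have "real n * \<bar>profile n t x - profile n t (x + axis i 1)\<bar> \<le> real n * (C * spacing n)"
    by (intro mult_left_mono) auto
  also have "\<dots> \<le> C * 3" using spacing_le[OF n] C_nonneg by (simp add: mult.left_commute mult_left_mono)
  finally show ?thesis by simp
qed

definition lap_term :: "nat \<Rightarrow> real \<Rightarrow> int ^ 'd \<Rightarrow> 'd \<Rightarrow> real" where
  "lap_term n t x i = (if x \<in> bonds n i then profile n t (x + axis i 1) - profile n t x else 0) +
     (if x - axis i 1 \<in> bonds n i then profile n t (x - axis i 1) - profile n t x else 0)"

text \<open>The instance of \<open>\<Lambda>\<close> for the hydrodynamic profile; by the heat
  equation the sum of \<open>w2\<close> is its time derivative.\<close>

definition drift :: "nat \<Rightarrow> real \<Rightarrow> int ^ 'd \<Rightarrow> real" where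
  "drift n t x = (real n)\<^sup>2 * lattice_laplacian n (profile n t) x +
     (if x \<in> boundary_sites n then (real n)\<^sup>2 * (c * real n powr (- \<theta>)) * (g (p (rescale n x)) - profile n t x) else 0)
     - (\<Sum>i \<in> UNIV. w2 i t (site_map \<theta> c n x))"

lemma drift_eq: "drift n t x = (\<Sum>i \<in> UNIV. (real n)\<^sup>2 * lap_term n t x i) +
     (if x \<in> boundary_sites n then (real n)\<^sup>2 * (c * real n powr (- \<theta>)) * (g (p (rescale n x)) - profile n t x) else 0)
     - (\<Sum>i \<in> UNIV. w2 i t (site_map \<theta> c n x))"
  unfolding drift_def lattice_laplacian_def lap_term_def sum_distrib_left ..

text \<open>Each one-sided difference is at most 3 C / n, so the factor n^2 leaves order n. The
  bound holds also where a neighbour is missing.\<close>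

lemma lap_term_crude:
  assumes n: "large n" and t: "t \<in> {0..T}"
  shows "\<bar>(real n)\<^sup>2 * lap_term n t x i\<bar> \<le> 6 * C * real n"
proof -
  have 1: "real n * \<bar>if x \<in> bonds n i then profile n t (x + axis i 1) - profile n t x else 0\<bar> \<le> 3 * C"
    using profile_step[OF n t, of x i] C_nonneg by (auto simp: bonds_def abs_minus_commute)
  have 2: "real n * \<bar>if x - axis i 1 \<in> bonds n i then profile n t (x - axis i 1) - profile n t x else 0\<bar> \<le> 3 * C"
    using profile_step[OF n t, of "x - axis i 1" i] C_nonneg by (auto simp: bonds_def)
  have "real n * \<bar>lap_term n t x i\<bar> \<le> real n * (\<bar>if x \<in> bonds n i then profile n t (x + axis i 1) - profile n t x else 0\<bar>
     + \<bar>if x - axis i 1 \<in> bonds n i then profile n t (x - axis i 1) - profile n t x else 0\<bar>)"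
    unfolding lap_term_def by (intro mult_left_mono abs_triangle_ineq) auto
  also have "\<dots> \<le> 6 * C" unfolding distrib_left using 1 2 by linarith
  finally have "real n * (real n * \<bar>lap_term n t x i\<bar>) \<le> real n * (6 * C)" by (intro mult_left_mono) auto
  then show ?thesis by (simp add: abs_mult power2_eq_square mult_ac)
qed

text \<open>The first error arises because the mesh differs from 1 / n when \<theta> < 1, the second
  is the Taylor remainder. Only coordinate \<open>i\<close> has to be non-extreme, so the bound also
  serves the tangential directions at a face.\<close>

lemma lap_term_interior:
  assumes n: "large n" and t: "t \<in> {0..T}" and x: "x \<in> sites n" "x $ i \<noteq> 1" "x $ i \<noteq> int n - 1"
  shows "\<bar>(real n)\<^sup>2 * lap_term n t x i - w2 i t (site_map \<theta> c n x)\<bar> \<le>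
    C * \<bar>(real n * spacing n)\<^sup>2 - 1\<bar> + 2 * C * (real n)\<^sup>2 * spacing n ^ 3"
proof -
  have xi: "0 < x $ k" "x $ k < int n" for k using x by (auto simp: sites_def)
  have plus: "x + axis i 1 \<in> sites n"
    unfolding sites_def
  proof (intro CollectI allI)
    fix k show "0 < (x + axis i 1) $ k \<and> (x + axis i 1) $ k < int n"
      using xi[of k] x by (auto simp: axis_def)
  qed
  have minus: "x - axis i 1 \<in> sites n"
    unfolding sites_def
  proof (intro CollectI allI)
    fix k show "0 < (x - axis i 1) $ k \<and> (x - axis i 1) $ k < int n"
      using xi[of k] x by (auto simp: axis_def)
  qed
  let ?u = "site_map \<theta> c n x" and ?h = "spacing n"
  have "lap_term n t x i = w t (?u + ?h *\<^sub>R axis i 1) + w t (?u - ?h *\<^sub>R axis i 1) - 2 * w t ?u"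
    using x plus minus by (simp add: lap_term_def bonds_def profile_def site_map_shift site_map_shift_back)
  moreover have "\<bar>w t (?u + ?h *\<^sub>R axis i 1) + w t (?u - ?h *\<^sub>R axis i 1) - 2 * w t ?u - ?h\<^sup>2 * w2 i t ?u\<bar> \<le> 2 * C * ?h ^ 3"
    using site_map_closed[OF n plus] site_map_closed[OF n minus] site_map_closed[OF n x(1)] spacing_pos[OF n]
    by (intro taylor2 t) (auto simp: site_map_shift site_map_shift_back)
  ultimately have "(real n)\<^sup>2 * \<bar>lap_term n t x i - ?h\<^sup>2 * w2 i t ?u\<bar> \<le> (real n)\<^sup>2 * (2 * C * ?h ^ 3)"
    by (intro mult_left_mono) auto
  then have 1: "\<bar>(real n)\<^sup>2 * lap_term n t x i - (real n * ?h)\<^sup>2 * w2 i t ?u\<bar> \<le> 2 * C * (real n)\<^sup>2 * ?h ^ 3"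
    by (simp add: abs_mult[of "(real n)\<^sup>2", simplified, symmetric] right_diff_distrib power_mult_distrib mult_ac)
  have "\<bar>((real n * ?h)\<^sup>2 - 1) * w2 i t ?u\<bar> \<le> \<bar>(real n * ?h)\<^sup>2 - 1\<bar> * C"
    unfolding abs_mult by (intro mult_left_mono bound2 t site_map_closed n x) auto
  then show ?thesis using 1 by (simp add: algebra_simps) 
qed

lemma drift_interior:
  assumes n: "large n" and t: "t \<in> {0..T}" and x: "x \<in> sites n - boundary_sites n"
  shows "\<bar>drift n t x\<bar> \<le> real CARD('d) * (C * \<bar>(real n * spacing n)\<^sup>2 - 1\<bar> + 2 * C * (real n)\<^sup>2 * spacing n ^ 3)"
proof -
  have "drift n t x = (\<Sum>i \<in> UNIV. (real n)\<^sup>2 * lap_term n t x i - w2 i t (site_map \<theta> c n x))"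
    using x by (simp add: drift_eq sum_subtractf)
  also have "\<bar>\<dots>\<bar> \<le> (\<Sum>i \<in> UNIV. \<bar>(real n)\<^sup>2 * lap_term n t x i - w2 i t (site_map \<theta> c n x)\<bar>)"
    by (rule sum_abs)
  also have "\<dots> \<le> (\<Sum>i \<in> (UNIV :: 'd set). C * \<bar>(real n * spacing n)\<^sup>2 - 1\<bar> + 2 * C * (real n)\<^sup>2 * spacing n ^ 3)"
    using x by (intro sum_mono lap_term_interior n t) (auto simp: boundary_sites_def)
  finally show ?thesis by simp
qed

lemma w2_sum_bound:
  assumes "t \<in> {0..T}" "u \<in> closed_cube"
  shows "\<bar>\<Sum>i \<in> UNIV. w2 i t u\<bar> \<le> real CARD('d) * C"
proof -
  have "\<bar>\<Sum>i \<in> UNIV. w2 i t u\<bar> \<le> (\<Sum>i \<in> (UNIV :: 'd set). C)"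
    by (rule order_trans[OF sum_abs]) (intro sum_mono bound2 assms)
  then show ?thesis by simp
qed

lemma lap_sum_crude:
  assumes "large n" "t \<in> {0..T}"
  shows "\<bar>\<Sum>i \<in> UNIV. (real n)\<^sup>2 * lap_term n t x i\<bar> \<le> real CARD('d) * (6 * C * real n)"
proof -
  have "\<bar>\<Sum>i \<in> UNIV. (real n)\<^sup>2 * lap_term n t x i\<bar> \<le> (\<Sum>i \<in> (UNIV :: 'd set). 6 * C * real n)"
    by (rule order_trans[OF sum_abs]) (intro sum_mono lap_term_crude assms)
  then show ?thesis by simp
qed

lemma boundary_sites_subset: "boundary_sites n \<subseteq> sites n"
  by (auto simp: boundary_sites_def)

text \<open>In each coordinate the site map is \<open>margin n * (1 - 2 * q) + q\<close>, with q =
  (x_i - 1) / (n - 2) the relative position; and q differs from x_i / n by at most 1 / n.\<close>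

lemma site_map_rescale_dist:
  fixes x :: "int ^ 'd"
  assumes n: "large n" and x: "x \<in> sites n" and \<theta>1: "\<theta> < 1"
  shows "dist (site_map \<theta> c n x) (rescale n x) \<le> real CARD('d) * (3 * margin n + 1 / real n)"
proof -
  have "dist (site_map \<theta> c n x) (rescale n x) \<le> (\<Sum>i \<in> UNIV. \<bar>(site_map \<theta> c n x - rescale n x) $ i\<bar>)"
    unfolding dist_norm by (rule norm_le_l1_cart)
  also have "\<dots> \<le> (\<Sum>i \<in> (UNIV :: 'd set). 3 * margin n + 1 / real n)"
  proof (rule sum_mono)
    fix i
    define X where "X = real_of_int (x $ i)"
    have "0 < x $ i" "x $ i < int n" using x by (auto simp: sites_def)
    then have X: "1 \<le> X" "X \<le> real n - 1" by (simp_all add: X_def)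
    have n3: "3 \<le> real n" using n by (simp add: large_def)
    define q where "q = (X - 1) / (real n - 2)"
    have q: "0 \<le> q" "q \<le> 1" using X n3 by (auto simp: q_def divide_le_eq)
    define Y where "Y = (2 * X - real n) / (real n - 2)"
    have "q - X / real n = Y / real n"
      using n3 by (simp add: q_def Y_def field_simps)
    moreover have "\<bar>Y\<bar> \<le> 1"
      using X n3 by (auto simp: Y_def abs_le_iff divide_le_eq le_divide_eq)
    ultimately have 1: "\<bar>q - X / real n\<bar> \<le> 1 / real n"
      using n3 by (simp add: divide_right_mono)
    have "(site_map \<theta> c n x - rescale n x) $ i = margin n * (1 - 2 * q) + (q - X / real n)"
      using \<theta>1 by (simp add: site_map_def rescale_def margin_def q_def X_def algebra_simps diff_divide_distrib)
    also have "\<bar>\<dots>\<bar> \<le> \<bar>margin n * (1 - 2 * q)\<bar> + \<bar>q - X / real n\<bar>" by (rule abs_triangle_ineq)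
    also have "\<bar>margin n * (1 - 2 * q)\<bar> \<le> margin n * 1"
      unfolding abs_mult using q margin_pos[OF n] by (intro mult_mono) auto
    finally show "\<bar>(site_map \<theta> c n x - rescale n x) $ i\<bar> \<le> 3 * margin n + 1 / real n"
      using 1 margin_pos[OF n] by simp
  qed
  finally show ?thesis by simp
qed

lemma powr_mult_of_nat:
  assumes "0 < n" shows "(real n)\<^sup>2 * (c * real n powr (- \<theta>)) = c * real n powr (2 - \<theta>)"
proof -
  have "(real n)\<^sup>2 = real n powr 2" using assms by simp
  then show ?thesis by (simp only: powr_add[symmetric] mult.left_commute[of "real n powr 2"]) simp
qed

text \<open>For \<open>\<theta> < 1\<close> the map \<open>m\<^sub>n\<close> also displaces boundary sites tangentially, by an amount of the same order
  as their distance to the boundary. The two boundary contributions therefore do not cancel, and the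
  drift is only of order \<open>n\<close>; the energy of the fast boundary dynamics has to absorb it.\<close>

lemma drift_boundary_dirichlet:
  assumes \<theta>1: "\<theta> < 1"
  shows "\<exists>B. \<forall>n t z. large n \<longrightarrow> t \<in> {0..T} \<longrightarrow> z \<in> boundary_sites n \<longrightarrow> \<bar>drift n t z\<bar> \<le> B * real n"
proof -
  let ?d = "real CARD('d)"
  define B where "B = ?d * (6 * C) + (C * (c + ?d * (3 + c)) + ?d * C)"
  have "\<bar>drift n t z\<bar> \<le> B * real n" if n: "large n" and t: "t \<in> {0..T}" and z: "z \<in> boundary_sites n" for n t z
  proof -
    have n3: "3 \<le> n" using n by (simp add: large_def)
    have zs: "z \<in> sites n" using z boundary_sites_subset by auto
    note near = nearest_boundary_point_near[OF p z n3]
    let ?u = "site_map \<theta> c n z" and ?P = "p (rescale n z)"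
    \<comment> \<open>The mesh is at most a multiple of the margin because \<theta> \<ge> 0; all
      displacements then have the order of the margin.\<close>
    have inv: "1 / real n \<le> c * margin n"
    proof -
      have "1 / real n = real n powr (- 1)" using n3 by (simp add: powr_minus divide_inverse)
      also have "\<dots> \<le> real n powr (\<theta> - 1)" using \<theta> n3 by (intro powr_mono) auto
      finally show ?thesis using c by (simp add: margin_def)
    qed
    have P: "?P \<in> closed_cube" using near(2) by (simp add: cube_boundary_def)
    have "\<bar>g ?P - profile n t z\<bar> = \<bar>w t ?P - w t ?u\<bar>"
      using dirichlet[OF \<theta>1 t near(2)] by (simp add: profile_def)
    also have "\<dots> \<le> C * dist ?P ?u" by (intro lip0 t P site_map_closed n zs)
    also have "\<dots> \<le> C * (1 / real n + ?d * (3 * margin n + 1 / real n))"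
      using near(3) site_map_rescale_dist[OF n zs \<theta>1] dist_triangle2[of ?P ?u "rescale n z"] C_nonneg
      by (intro mult_left_mono) (auto simp: dist_commute)
    also have "\<dots> \<le> C * (c * margin n + ?d * (3 * margin n + c * margin n))"
      using inv C_nonneg by (intro mult_left_mono add_mono) auto
    also have "\<dots> = C * (c + ?d * (3 + c)) * margin n" by (simp add: algebra_simps)
    finally have 1: "\<bar>g ?P - profile n t z\<bar> \<le> C * (c + ?d * (3 + c)) * margin n" .
    have km: "(real n)\<^sup>2 * (c * real n powr (- \<theta>)) * margin n = real n"
    proof -
      have "(real n)\<^sup>2 * (c * real n powr (- \<theta>)) * margin n = real n powr (2 - \<theta>) * real n powr (\<theta> - 1)"
        using c n3 by (simp add: powr_mult_of_nat margin_def)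
      also have "\<dots> = real n" using n3 by (simp add: powr_add[symmetric])
      finally show ?thesis .
    qed
    have "\<bar>(real n)\<^sup>2 * (c * real n powr (- \<theta>)) * (g ?P - profile n t z)\<bar> =
        (real n)\<^sup>2 * (c * real n powr (- \<theta>)) * \<bar>g ?P - profile n t z\<bar>"
      using c by (simp add: abs_mult)
    also have "\<dots> \<le> (real n)\<^sup>2 * (c * real n powr (- \<theta>)) * (C * (c + ?d * (3 + c)) * margin n)"
      using c by (intro mult_left_mono 1) auto
    also have "\<dots> = C * (c + ?d * (3 + c)) * real n"
      using km by (simp add: mult_ac)
    finally have 2: "\<bar>(real n)\<^sup>2 * (c * real n powr (- \<theta>)) * (g ?P - profile n t z)\<bar> \<le> C * (c + ?d * (3 + c)) * real n" .
    have 3: "\<bar>\<Sum>i \<in> UNIV. w2 i t ?u\<bar> \<le> ?d * C * real n"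
    proof -
      have "?d * C * 1 \<le> ?d * C * real n" using n3 C_nonneg by (intro mult_left_mono) auto
      then show ?thesis using w2_sum_bound[OF t site_map_closed[OF n zs]] by linarith
    qed
    have "drift n t z = (\<Sum>i \<in> UNIV. (real n)\<^sup>2 * lap_term n t z i) +
        (real n)\<^sup>2 * (c * real n powr (- \<theta>)) * (g ?P - profile n t z) - (\<Sum>i \<in> UNIV. w2 i t ?u)"
      using z by (simp add: drift_eq)
    also have "\<bar>\<dots>\<bar> \<le> ?d * (6 * C * real n) + C * (c + ?d * (3 + c)) * real n + ?d * C * real n"
      using lap_sum_crude[OF n t, of z] 2 3 by linarith
    also have "\<dots> = B * real n" by (simp add: B_def algebra_simps)
    finally show ?thesis .
  qed
  then show ?thesis by blast
qed

text \<open>For a boundary site this says that exactly one coordinate is extreme; the other boundary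
  sites lie along the edges, where at least two faces meet.\<close>

definition face_site :: "nat \<Rightarrow> int ^ 'd \<Rightarrow> bool" where
  "face_site n z \<longleftrightarrow> (\<exists>i. \<forall>k. k \<noteq> i \<longrightarrow> z $ k \<noteq> 1 \<and> z $ k \<noteq> int n - 1)"

text \<open>For \<theta> \<ge> 1 the reservoir rate c n^(2-\<theta>) is at most c n, so crude bounds
  give order n at every boundary site. This suffices along the edges, which have few sites.\<close>

lemma drift_boundary_edge:
  assumes \<theta>1: "1 \<le> \<theta>"
  shows "\<exists>B. \<forall>n t z. large n \<longrightarrow> t \<in> {0..T} \<longrightarrow> z \<in> boundary_sites n \<longrightarrow> \<bar>drift n t z\<bar> \<le> B * real n"
proof -
  let ?d = "real CARD('d)"
  have "\<bar>drift n t z\<bar> \<le> (?d * (6 * C) + c + ?d * C) * real n"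
    if n: "large n" and t: "t \<in> {0..T}" and z: "z \<in> boundary_sites n" for n t z
  proof -
    have n3: "3 \<le> n" using n by (simp add: large_def)
    have zs: "z \<in> sites n" using z boundary_sites_subset by auto
    note near = nearest_boundary_point_near[OF p z n3]
    let ?u = "site_map \<theta> c n z" and ?P = "p (rescale n z)"
    have "\<bar>g ?P - profile n t z\<bar> \<le> 1"
      using g[OF near(2)] profile_bounds[OF n t zs] \<epsilon> by (simp add: abs_le_iff)
    then have "\<bar>(real n)\<^sup>2 * (c * real n powr (- \<theta>)) * (g ?P - profile n t z)\<bar> \<le> (real n)\<^sup>2 * (c * real n powr (- \<theta>)) * 1"
      unfolding abs_mult using c by (intro mult_mono) auto
    also have "\<dots> = c * real n powr (2 - \<theta>)" using n3 by (simp add: powr_mult_of_nat)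
    also have "\<dots> \<le> c * real n powr 1" using \<theta>1 n3 c by (intro mult_left_mono powr_mono) auto
    finally have 2: "\<bar>(real n)\<^sup>2 * (c * real n powr (- \<theta>)) * (g ?P - profile n t z)\<bar> \<le> c * real n" using n3 by simp
    have 3: "\<bar>\<Sum>i \<in> UNIV. w2 i t ?u\<bar> \<le> ?d * C * real n"
    proof -
      have "?d * C * 1 \<le> ?d * C * real n" using n3 C_nonneg by (intro mult_left_mono) auto
      then show ?thesis using w2_sum_bound[OF t site_map_closed[OF n zs]] by linarith
    qed
    have "drift n t z = (\<Sum>i \<in> UNIV. (real n)\<^sup>2 * lap_term n t z i) +
        (real n)\<^sup>2 * (c * real n powr (- \<theta>)) * (g ?P - profile n t z) - (\<Sum>i \<in> UNIV. w2 i t ?u)"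
      using z by (simp add: drift_eq)
    also have "\<bar>\<dots>\<bar> \<le> ?d * (6 * C * real n) + c * real n + ?d * C * real n"
      using lap_sum_crude[OF n t, of z] 2 3 by linarith
    finally show ?thesis by (simp add: algebra_simps)
  qed
  then show ?thesis by blast
qed

text \<open>Up to O(1), the normal difference is n times the inward derivative, and moving it to the
  nearest boundary point costs O(1) more since that point is within 1 / n. There the flux condition
  applies: for \<theta> = 1 it cancels the reservoir term up to O(1), for \<theta> > 1 the
  derivative vanishes and the reservoir term is at most c n^(2-\<theta>).\<close>

lemma drift_boundary_face:
  assumes \<theta>1: "1 \<le> \<theta>"
  shows "\<exists>B. \<forall>n t z. large n \<longrightarrow> t \<in> {0..T} \<longrightarrow> z \<in> boundary_sites n \<longrightarrow> face_site n z \<longrightarrow>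
    \<bar>drift n t z\<bar> \<le> B * (1 + (if \<theta> = 1 then 0 else real n powr (2 - \<theta>)))"
proof -
  let ?d = "real CARD('d)"
  define B where "B = ?d * (4 * C) + 3 * C + c * C + c"
  have B: "?d * (4 * C) + 3 * C + c * C \<le> B" "c \<le> B" "0 \<le> B"
    using c C_nonneg by (auto simp: B_def intro!: add_nonneg_nonneg)
  have "\<bar>drift n t z\<bar> \<le> B * (1 + (if \<theta> = 1 then 0 else real n powr (2 - \<theta>)))"
    if n: "large n" and t: "t \<in> {0..T}" and z: "z \<in> boundary_sites n" and f: "face_site n z" for n t z
  proof -
    have n3: "3 \<le> n" using n by (simp add: large_def)
    have zs: "z \<in> sites n" using z boundary_sites_subset by auto
    have zb: "0 < z $ k" "z $ k < int n" for k using zs by (auto simp: sites_def)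
    note near = nearest_boundary_point_near[OF p z n3]
    let ?u = "rescale n z :: real ^ 'd" and ?P = "p (rescale n z)"
    have u: "site_map \<theta> c n z = ?u" using \<theta>1 by (simp add: site_map_def)
    have ucc: "?u \<in> closed_cube" using site_map_closed[OF n zs] u by simp
    have Pcc: "?P \<in> closed_cube" using near(2) by (simp add: cube_boundary_def)
    have h: "spacing n = 1 / real n" using \<theta>1 by (simp add: spacing_def)
    obtain i where only: "\<And>k. k \<noteq> i \<Longrightarrow> z $ k \<noteq> 1 \<and> z $ k \<noteq> int n - 1"
      using f by (auto simp: face_site_def)
    have zi: "z $ i = 1 \<or> z $ i = int n - 1"
    proof -
      obtain k where k: "z $ k = 1 \<or> z $ k = int n - 1" using z by (auto simp: boundary_sites_def)
      then have "k = i" using only[of k] by blast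
      then show ?thesis using k by simp
    qed
    note face = nearest_boundary_point_face[OF p z n3 only]
    have nC: "(real n)\<^sup>2 * (C * (1 / real n)\<^sup>2) = C" using n3 by (simp add: power2_eq_square)
    have tangential: "\<bar>(real n)\<^sup>2 * lap_term n t z k - w2 k t ?u\<bar> \<le> 2 * C" if "k \<noteq> i" for k
    proof -
      have "2 * C * (real n)\<^sup>2 * spacing n ^ 3 = 2 * C * (1 / real n)" using n3 by (simp add: h power2_eq_square power3_eq_cube)
      also have "\<dots> \<le> 2 * C * 1" using n3 C_nonneg by (intro mult_left_mono) auto
      finally show ?thesis
        using lap_term_interior[OF n t zs, of k] only[OF that] n3 by (simp add: h u)
    qed
    \<comment> \<open>\<open>s\<close> points inwards, so \<open>s * w1\<close> is the inward normal
      derivative and opposite faces are treated at once.\<close>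
    define s :: real where "s = (if z $ i = 1 then 1 else - 1)"
    have normal: "\<bar>(real n)\<^sup>2 * lap_term n t z i - real n * (s * w1 i t ?u)\<bar> \<le> C"
    proof -
      have lt: "lap_term n t z i = w t (?u + (s / real n) *\<^sub>R axis i 1) - w t ?u" "?u + (s / real n) *\<^sub>R axis i 1 \<in> closed_cube"
      proof -
        have ax: "z + axis i 1 \<in> sites n" if "z $ i = 1"
          unfolding sites_def
        proof (intro CollectI allI)
          fix k show "0 < (z + axis i 1) $ k \<and> (z + axis i 1) $ k < int n"
            using zb[of k] that n3 by (auto simp: axis_def)
        qed
        have ax': "z - axis i 1 \<in> sites n" if "z $ i \<noteq> 1"
          unfolding sites_def
        proof (intro CollectI allI)
          fix k show "0 < (z - axis i 1) $ k \<and> (z - axis i 1) $ k < int n"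
            using zb[of k] that n3 by (auto simp: axis_def)
        qed
        have out: "z - axis i 1 \<notin> sites n" if "z $ i = 1"
          using that by (auto simp: sites_def axis_def intro!: exI[of _ i])
        have out': "z + axis i 1 \<notin> sites n" if "z $ i \<noteq> 1"
          using that zi by (auto simp: sites_def axis_def intro!: exI[of _ i])
        show "lap_term n t z i = w t (?u + (s / real n) *\<^sub>R axis i 1) - w t ?u"
          using ax ax' out out' zs site_map_shift[of n z i] site_map_shift_back[of n z i]
          by (auto simp: lap_term_def bonds_def profile_def s_def u h)
        show "?u + (s / real n) *\<^sub>R axis i 1 \<in> closed_cube"
          using ax ax' site_map_shift[of n z i] site_map_shift_back[of n z i]
            site_map_closed[OF n, of "z + axis i 1"] site_map_closed[OF n, of "z - axis i 1"]
          by (auto simp: s_def u h)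
      qed
      have "\<bar>lap_term n t z i - s / real n * w1 i t ?u\<bar> \<le> C * (s / real n)\<^sup>2"
        unfolding lt(1) by (rule taylor1(1)[OF t ucc lt(2)])
      also have "(s / real n)\<^sup>2 = (1 / real n)\<^sup>2" by (simp add: s_def power_divide)
      finally have "(real n)\<^sup>2 * \<bar>lap_term n t z i - s / real n * w1 i t ?u\<bar> \<le> (real n)\<^sup>2 * (C * (1 / real n)\<^sup>2)"
        by (intro mult_left_mono) auto
      moreover have "(real n)\<^sup>2 * \<bar>lap_term n t z i - s / real n * w1 i t ?u\<bar> = \<bar>(real n)\<^sup>2 * lap_term n t z i - real n * (s * w1 i t ?u)\<bar>"
      proof -
        have "(real n)\<^sup>2 * lap_term n t z i - real n * (s * w1 i t ?u) = (real n)\<^sup>2 * (lap_term n t z i - s / real n * w1 i t ?u)"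
          using n3 by (simp add: power2_eq_square right_diff_distrib)
        then show ?thesis by (simp add: abs_mult)
      qed
      ultimately show ?thesis using nC by simp
    qed
    have flux: "\<bar>real n * (s * w1 i t ?u) - real n * (s * w1 i t ?P)\<bar> \<le> C"
    proof -
      have "\<bar>w1 i t ?u - w1 i t ?P\<bar> \<le> C * dist ?u ?P" by (rule lip1[OF t ucc Pcc])
      also have "\<dots> \<le> C * (1 / real n)" using near(3) C_nonneg by (intro mult_left_mono)
      finally have "real n * \<bar>w1 i t ?u - w1 i t ?P\<bar> \<le> real n * (C * (1 / real n))" by (intro mult_left_mono) auto
      moreover have "\<bar>real n * (s * w1 i t ?u) - real n * (s * w1 i t ?P)\<bar> = real n * \<bar>w1 i t ?u - w1 i t ?P\<bar>"
        by (auto simp: s_def abs_mult[of "real n", simplified, symmetric] right_diff_distrib abs_minus_commute)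
      ultimately show ?thesis using n3 by simp
    qed
    have sflux: "s * w1 i t ?P = (if \<theta> = 1 then c * (w t ?P - g ?P) else 0)"
      using zi face flux_plus[OF \<theta>1 t, of ?P i] flux_minus[OF \<theta>1 t, of ?P i]
      by (auto simp: s_def algebra_simps)
    define K where "K = (real n)\<^sup>2 * (c * real n powr (- \<theta>)) * (g ?P - w t ?u)"
    have robin: "\<bar>real n * (s * w1 i t ?P) + K\<bar> \<le> c * C + c * (if \<theta> = 1 then 0 else real n powr (2 - \<theta>))"
    proof (cases "\<theta> = 1")
      case True
      have "(real n)\<^sup>2 * (c * real n powr (- \<theta>)) = c * real n"
        using n3 True by (simp add: powr_minus power2_eq_square)
      then have "real n * (s * w1 i t ?P) + K = c * (real n * (w t ?P - w t ?u))"
        unfolding K_def sflux using True by (simp add: algebra_simps)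
      moreover have "\<bar>real n * (w t ?P - w t ?u)\<bar> \<le> C"
      proof -
        have "\<bar>w t ?P - w t ?u\<bar> \<le> C * dist ?P ?u" by (rule lip0[OF t Pcc ucc])
        also have "\<dots> \<le> C * (1 / real n)"
          using near(3) C_nonneg by (intro mult_left_mono) (auto simp: dist_commute)
        finally have "real n * \<bar>w t ?P - w t ?u\<bar> \<le> real n * (C * (1 / real n))" by (intro mult_left_mono) auto
        then show ?thesis using n3 by (simp add: abs_mult)
      qed
      ultimately show ?thesis using c True by (simp add: abs_mult)
    next
      case False
      have "\<bar>g ?P - w t ?u\<bar> \<le> 1"
        using g[OF near(2)] w[OF t ucc] \<epsilon> by (simp add: abs_le_iff)
      then have "\<bar>K\<bar> \<le> (real n)\<^sup>2 * (c * real n powr (- \<theta>)) * 1"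
        unfolding K_def abs_mult using c by (intro mult_mono) auto
      also have "\<dots> = c * real n powr (2 - \<theta>)" using n3 by (simp add: powr_mult_of_nat)
      finally have "\<bar>K\<bar> \<le> c * real n powr (2 - \<theta>)" .
      moreover have "real n * (s * w1 i t ?P) = 0" using sflux False by simp
      moreover have "0 \<le> c * C" using c C_nonneg by simp
      ultimately have "\<bar>real n * (s * w1 i t ?P) + K\<bar> \<le> c * C + c * real n powr (2 - \<theta>)" by linarith
      then show ?thesis using False by simp
    qed
    have others: "\<bar>\<Sum>k \<in> UNIV - {i}. (real n)\<^sup>2 * lap_term n t z k - w2 k t ?u\<bar> \<le> ?d * (2 * C)"
    proof -
      have "\<bar>\<Sum>k \<in> UNIV - {i}. (real n)\<^sup>2 * lap_term n t z k - w2 k t ?u\<bar> \<le> (\<Sum>k \<in> UNIV - {i}. 2 * C)"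
        by (rule order_trans[OF sum_abs]) (intro sum_mono tangential, auto)
      also have "\<dots> \<le> (\<Sum>k \<in> (UNIV :: 'd set). 2 * C)" using C_nonneg by (intro sum_mono2) auto
      finally show ?thesis by simp
    qed
    have "drift n t z = (\<Sum>k \<in> UNIV. (real n)\<^sup>2 * lap_term n t z k - w2 k t ?u) + K"
      using z by (simp add: drift_eq sum_subtractf u K_def profile_def)
    also have "(\<Sum>k \<in> UNIV. (real n)\<^sup>2 * lap_term n t z k - w2 k t ?u) =
        ((real n)\<^sup>2 * lap_term n t z i - w2 i t ?u) + (\<Sum>k \<in> UNIV - {i}. (real n)\<^sup>2 * lap_term n t z k - w2 k t ?u)"
      by (rule sum.remove) auto
    finally have "\<bar>drift n t z\<bar> \<le> 3 * C + c * C + ?d * (2 * C) + c * (if \<theta> = 1 then 0 else real n powr (2 - \<theta>))"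
      using normal flux robin others bound2[OF t ucc, of i] by linarith
    also have "\<dots> \<le> B + B * (if \<theta> = 1 then 0 else real n powr (2 - \<theta>))"
      using C_nonneg c by (intro add_mono mult_right_mono B) (auto simp: B_def)
    finally show ?thesis by (simp add: distrib_left)
  qed
  then show ?thesis by blast
qed

end

section \<open>Number of boundary sites and total size of the errors\<close>

lemma card_boundary_sites:
  "card (boundary_sites n :: (int ^ 'd::finite) set) \<le> CARD('d) * (2 * n ^ (CARD('d) - 1))"
proof -
  let ?J = "{1, int n - 1}"
  have J: "card ?J \<le> 2" by (simp add: card_insert_if)
  have fin: "finite {x \<in> (sites n :: (int ^ 'd) set). x $ i \<in> ?J}" for i
    by (rule finite_subset[OF _ finite_sites[of n]]) auto
  have "card (boundary_sites n :: (int ^ 'd) set) \<le> card (\<Union>i. {x \<in> (sites n :: (int ^ 'd) set). x $ i \<in> ?J})"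
    using fin by (intro card_mono) (auto simp: boundary_sites_def)
  also have "\<dots> \<le> (\<Sum>i \<in> UNIV. card {x \<in> (sites n :: (int ^ 'd) set). x $ i \<in> ?J})"
    by (rule card_UN_le) simp
  also have "\<dots> \<le> (\<Sum>i \<in> (UNIV :: 'd set). 2 * n ^ (CARD('d) - 1))"
    by (intro sum_mono order_trans[OF card_sites_slab] mult_right_mono J) auto
  finally show ?thesis by simp
qed

context hydrodynamic_profile
begin

text \<open>Two distinct extreme coordinates, with two values each, leave d - 2 free ones; d^2
  bounds the number of pairs of directions.\<close>

lemma card_edge_sites:
  "card {z \<in> boundary_sites n. \<not> face_site n z} \<le> (CARD('d))\<^sup>2 * (4 * n ^ (CARD('d) - 2))"
proof -
  let ?J = "{1, int n - 1}" and ?P = "{(i, j). i \<noteq> (j :: 'd)}"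
  let ?A = "\<lambda>(i, j). {x \<in> (sites n :: (int ^ 'd) set). x $ i \<in> ?J \<and> x $ j \<in> ?J}"
  have J: "(card ?J)\<^sup>2 \<le> 4"
    using power_mono[of "card ?J" 2 2] by (simp add: card_insert_if)
  have fin: "finite (?A ij)" for ij
    by (rule finite_subset[OF _ finite_sites[of n]]) (auto split: prod.splits)
  have "{z \<in> boundary_sites n. \<not> face_site n z} \<subseteq> (\<Union>ij \<in> ?P. ?A ij)"
  proof
    fix z assume z: "z \<in> {z \<in> boundary_sites n. \<not> face_site n z}"
    then obtain i where i: "z $ i \<in> ?J" by (auto simp: boundary_sites_def)
    obtain j where "j \<noteq> i" "z $ j \<in> ?J" using z by (auto simp: face_site_def)
    then show "z \<in> (\<Union>ij \<in> ?P. ?A ij)"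
      using z i by (intro UN_I[of "(i, j)"]) (auto simp: boundary_sites_def)
  qed
  then have "card {z \<in> boundary_sites n. \<not> face_site n z} \<le> card (\<Union>ij \<in> ?P. ?A ij)"
    using fin by (intro card_mono finite_UN_I) auto
  also have "\<dots> \<le> (\<Sum>ij \<in> ?P. card (?A ij))" by (rule card_UN_le) simp
  also have "\<dots> \<le> (\<Sum>ij \<in> ?P. 4 * n ^ (CARD('d) - 2))"
  proof (rule sum_mono)
    fix ij assume "ij \<in> ?P"
    then obtain i j where ij: "ij = (i, j)" "i \<noteq> j" by auto
    have "card (?A ij) \<le> (card ?J)\<^sup>2 * n ^ (CARD('d) - 2)"
      unfolding ij prod.case using ij by (intro card_sites_edge) auto
    then show "card (?A ij) \<le> 4 * n ^ (CARD('d) - 2)"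
      using mult_right_mono[OF J, of "n ^ (CARD('d) - 2)"] by linarith
  qed
  also have "\<dots> \<le> (\<Sum>ij \<in> (UNIV :: ('d \<times> 'd) set). 4 * n ^ (CARD('d) - 2))"
    by (intro sum_mono2) auto
  finally show ?thesis by (simp add: power2_eq_square)
qed

lemma spacing_limits:
  "(\<lambda>n. real n * spacing n) \<longlonglongrightarrow> 1" "spacing \<longlonglongrightarrow> 0"
proof -
  have inv: "(\<lambda>n. 1 / real n) \<longlonglongrightarrow> 0" by (rule lim_1_over_n)
  show lim: "(\<lambda>n. real n * spacing n) \<longlonglongrightarrow> 1"
  proof (cases "1 \<le> \<theta>")
    case True
    have "\<forall>\<^sub>F n in sequentially. 1 = real n * spacing n"
      using eventually_gt_at_top[of 0] by eventually_elim (use True in \<open>simp add: spacing_def\<close>)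
    then show ?thesis by (rule Lim_transform_eventually[OF tendsto_const])
  next
    case False
    have "(\<lambda>n. real n powr (\<theta> - 1)) \<longlonglongrightarrow> 0"
      using False by (intro tendsto_neg_powr filterlim_real_sequentially) auto
    then have "(\<lambda>n. (1 - 2 * (real n powr (\<theta> - 1) / c)) / (1 - 2 * (1 / real n))) \<longlonglongrightarrow> (1 - 2 * (0 / c)) / (1 - 2 * 0)"
      using c by (intro tendsto_intros inv) auto
    moreover have "\<forall>\<^sub>F n in sequentially. (1 - 2 * (real n powr (\<theta> - 1) / c)) / (1 - 2 * (1 / real n)) = real n * spacing n"
      using eventually_gt_at_top[of 2]
      by eventually_elim (use False in \<open>simp add: spacing_def margin_def field_simps\<close>)
    ultimately show ?thesis by (auto dest: Lim_transform_eventually)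
  qed
  have "(\<lambda>n. (real n * spacing n) * (1 / real n)) \<longlonglongrightarrow> 1 * 0" by (intro tendsto_mult lim inv)
  moreover have "\<forall>\<^sub>F n in sequentially. (real n * spacing n) * (1 / real n) = spacing n"
    using eventually_gt_at_top[of 0] by eventually_elim simp
  ultimately show "spacing \<longlonglongrightarrow> 0" by (auto dest: Lim_transform_eventually)
qed

lemma eventually_large: "\<forall>\<^sub>F n in sequentially. large n"
proof (cases "\<theta> < 1")
  case True
  have "(\<lambda>n. real n powr (\<theta> - 1)) \<longlonglongrightarrow> 0"
    using True by (intro tendsto_neg_powr filterlim_real_sequentially) auto
  then have "\<forall>\<^sub>F n in sequentially. real n powr (\<theta> - 1) < c / 2"
    using c by (intro order_tendstoD) auto
  then show ?thesis
    using eventually_ge_at_top[of 3]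
    by eventually_elim (use c in \<open>simp add: large_def margin_def field_simps\<close>)
next
  case False
  then show ?thesis using eventually_ge_at_top[of 3] by (simp add: large_def)
qed

definition interior_error :: "nat \<Rightarrow> real" where
  "interior_error n = real CARD('d) * (C * \<bar>(real n * spacing n)\<^sup>2 - 1\<bar> + 2 * C * (real n)\<^sup>2 * spacing n ^ 3)"

text \<open>n^2 spacing^3 is the bounded factor (n spacing)^2 times the null sequence
  \<open>spacing\<close>.\<close>

lemma interior_error_limit: "interior_error \<longlonglongrightarrow> 0"
proof -
  have "(\<lambda>n. real CARD('d) * (C * \<bar>(real n * spacing n)\<^sup>2 - 1\<bar> + 2 * C * ((real n * spacing n)\<^sup>2 * spacing n)))
      \<longlonglongrightarrow> real CARD('d) * (C * \<bar>1\<^sup>2 - 1\<bar> + 2 * C * (1\<^sup>2 * 0))"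
    by (intro tendsto_intros spacing_limits)
  then show ?thesis
    by (simp add: interior_error_def[abs_def] power_mult_distrib power2_eq_square power3_eq_cube mult_ac)
qed

text \<open>\<open>e\<close> is free of time, which allows integration. For \<theta> < 1 it is the
  square of B n over the reservoir rate, of order n^\<theta> per site and n^(d-1+\<theta>) in total.
  For \<theta> \<ge> 1 the faces give order n^(d-1), plus n^(d+1-\<theta>) when \<theta> > 1, and
  the edges n^(d-2) times n.\<close>

lemma drift_boundary_error:
  assumes d: "2 \<le> CARD('d)"
  shows "\<exists>e. (\<lambda>n. (\<Sum>z \<in> boundary_sites n. e n z) / real n ^ CARD('d)) \<longlonglongrightarrow> 0 \<and>
    (\<forall>n t z. large n \<longrightarrow> t \<in> {0..T} \<longrightarrow> z \<in> boundary_sites n \<longrightarrow>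
      \<bar>drift n t z\<bar> / \<epsilon> \<le> e n z \<or>
      0 < (real n)\<^sup>2 * (c * real n powr (- \<theta>)) \<and>
        (drift n t z)\<^sup>2 / ((real n)\<^sup>2 * (c * real n powr (- \<theta>)) * \<epsilon> ^ 4) \<le> e n z)"
proof -
  let ?d = "real CARD('d)"
  let ?b = "boundary_sites :: nat \<Rightarrow> (int ^ 'd) set"
  have card_b: "real (card (?b n)) * n \<le> 2 * ?d * real n ^ CARD('d)" for n
  proof -
    have "real (card (?b n)) \<le> ?d * (2 * real n ^ (CARD('d) - 1))"
      using of_nat_mono[OF card_boundary_sites[where 'd = 'd, of n], where 'a = real] by simp
    then have "real (card (?b n)) * n \<le> ?d * (2 * real n ^ (CARD('d) - 1)) * n" by (intro mult_right_mono) auto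
    also have "\<dots> = 2 * ?d * real n ^ CARD('d)" using d by (simp add: power_eq_if[of _ "CARD('d)"])
    finally show ?thesis .
  qed
  show ?thesis
  proof (cases "\<theta> < 1")
    case True
    obtain B where B: "\<And>n t z. large n \<Longrightarrow> t \<in> {0..T} \<Longrightarrow> z \<in> boundary_sites n \<Longrightarrow> \<bar>drift n t z\<bar> \<le> B * real n"
      using drift_boundary_dirichlet[OF True] by blast
    define k where "k n = (real n)\<^sup>2 * (c * real n powr (- \<theta>))" for n
    define e where "e n z = (B * real n)\<^sup>2 / (k n * \<epsilon> ^ 4)" for n and z :: "int ^ 'd"
    have kpos: "0 < k n" if "0 < n" for n using that c by (simp add: k_def)
    have "(\<lambda>n. (\<Sum>z \<in> ?b n. e n z) / real n ^ CARD('d)) \<longlonglongrightarrow> 0"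
    proof (rule tendsto_sandwich)
      show "\<forall>\<^sub>F n in sequentially. 0 \<le> (\<Sum>z \<in> ?b n. e n z) / real n ^ CARD('d)"
        using eventually_gt_at_top[of 0]
        by eventually_elim (auto simp: e_def intro!: divide_nonneg_nonneg sum_nonneg mult_nonneg_nonneg less_imp_le[OF kpos])
      show "\<forall>\<^sub>F n in sequentially. (\<Sum>z \<in> ?b n. e n z) / real n ^ CARD('d) \<le> 2 * ?d * (B\<^sup>2 / (c * \<epsilon> ^ 4)) * real n powr (\<theta> - 1)"
        using eventually_gt_at_top[of 0]
      proof eventually_elim
        case (elim n)
        have "real n powr (\<theta> - 1) = real n powr \<theta> / real n" using elim by (simp add: powr_diff)
        then have "(B * real n)\<^sup>2 / (k n * \<epsilon> ^ 4) = B\<^sup>2 / (c * \<epsilon> ^ 4) * real n powr (\<theta> - 1) * real n"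
          using elim by (simp add: k_def power_mult_distrib powr_minus field_simps)
        then have "(\<Sum>z \<in> ?b n. e n z) = (B\<^sup>2 / (c * \<epsilon> ^ 4) * real n powr (\<theta> - 1)) * (real (card (?b n)) * real n)"
          by (simp add: e_def mult_ac)
        also have "\<dots> \<le> (B\<^sup>2 / (c * \<epsilon> ^ 4) * real n powr (\<theta> - 1)) * (2 * ?d * real n ^ CARD('d))"
          using c by (intro mult_left_mono card_b) auto
        finally show ?case using elim by (simp add: divide_le_eq mult_ac)
      qed
      have "(\<lambda>n. real n powr (\<theta> - 1)) \<longlonglongrightarrow> 0"
        using True by (intro tendsto_neg_powr filterlim_real_sequentially) auto
      then show "(\<lambda>n. 2 * ?d * (B\<^sup>2 / (c * \<epsilon> ^ 4)) * real n powr (\<theta> - 1)) \<longlonglongrightarrow> 0"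
        by (rule tendsto_mult_right_zero)
    qed simp
    moreover have "0 < k n \<and> (drift n t z)\<^sup>2 / (k n * \<epsilon> ^ 4) \<le> e n z"
      if "large n" "t \<in> {0..T}" "z \<in> ?b n" for n t z
    proof -
      have n: "0 < n" using that by (simp add: large_def)
      have "\<bar>drift n t z\<bar>\<^sup>2 \<le> (B * real n)\<^sup>2" by (intro power_mono B that) simp
      then show ?thesis using kpos[OF n] \<epsilon> unfolding e_def by (auto intro!: divide_right_mono)
    qed
    ultimately show ?thesis unfolding k_def by blast
  next
    case False
    then have \<theta>1: "1 \<le> \<theta>" by simp
    obtain B1 where B1: "\<And>n t z. large n \<Longrightarrow> t \<in> {0..T} \<Longrightarrow> z \<in> boundary_sites n \<Longrightarrow> \<bar>drift n t z\<bar> \<le> B1 * real n"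
      using drift_boundary_edge[OF \<theta>1] by blast
    define s where "s n = 1 + (if \<theta> = 1 then 0 else real n powr (2 - \<theta>))" for n
    obtain B2 where B2: "\<And>n t z. large n \<Longrightarrow> t \<in> {0..T} \<Longrightarrow> z \<in> boundary_sites n \<Longrightarrow> face_site n z \<Longrightarrow> \<bar>drift n t z\<bar> \<le> B2 * s n"
      using drift_boundary_face[OF \<theta>1] unfolding s_def by blast
    define B where "B = \<bar>B1\<bar> + \<bar>B2\<bar>"
    define e where "e n z = (if face_site n z then B * s n / \<epsilon> else B * real n / \<epsilon>)" for n z
    have B: "0 \<le> B" "B1 \<le> B" "B2 \<le> B" by (auto simp: B_def)
    have s0: "0 \<le> s n" for n by (simp add: s_def)
    have "(\<lambda>n. (\<Sum>z \<in> ?b n. e n z) / real n ^ CARD('d)) \<longlonglongrightarrow> 0"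
    proof (rule tendsto_sandwich)
      show "\<forall>\<^sub>F n in sequentially. 0 \<le> (\<Sum>z \<in> ?b n. e n z) / real n ^ CARD('d)"
        using B \<epsilon> s0 by (intro always_eventually allI divide_nonneg_nonneg sum_nonneg) (auto simp: e_def)
      show "\<forall>\<^sub>F n in sequentially. (\<Sum>z \<in> ?b n. e n z) / real n ^ CARD('d) \<le>
          2 * ?d * B / \<epsilon> * (s n * (1 / real n)) + 4 * ?d\<^sup>2 * B / \<epsilon> * (1 / real n)"
        using eventually_gt_at_top[of 0]
      proof eventually_elim
        case (elim n)
        let ?F = "{z \<in> ?b n. face_site n z}" and ?E = "{z \<in> ?b n. \<not> face_site n z}"
        have finb: "finite (?b n)" by (rule finite_subset[OF boundary_sites_subset finite_sites])
        have "(\<Sum>z \<in> ?b n. e n z) = (\<Sum>z \<in> ?F. e n z) + (\<Sum>z \<in> ?E. e n z)"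
          using finb by (subst sum.union_disjoint[symmetric]) (auto intro!: sum.cong)
        also have "(\<Sum>z \<in> ?F. e n z) = real (card ?F) * (B * s n / \<epsilon>)" by (simp add: e_def)
        also have "\<dots> \<le> real (card (?b n)) * (B * s n / \<epsilon>)"
          using finb B s0 \<epsilon> by (intro mult_right_mono) (auto intro!: card_mono)
        also have "\<dots> \<le> 2 * ?d * B / \<epsilon> * (s n * (1 / real n)) * real n ^ CARD('d)"
        proof -
          have "real (card (?b n)) * (B * s n / \<epsilon>) = (real (card (?b n)) * real n) * (B * s n / \<epsilon> * (1 / real n))"
            using elim by simp
          also have "\<dots> \<le> (2 * ?d * real n ^ CARD('d)) * (B * s n / \<epsilon> * (1 / real n))"
            using B s0 \<epsilon> by (intro mult_right_mono card_b) auto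
          finally show ?thesis by (simp add: mult_ac)
        qed
        also have "(\<Sum>z \<in> ?E. e n z) = real (card ?E) * (B * real n / \<epsilon>)" by (simp add: e_def)
        also have "\<dots> \<le> (?d\<^sup>2 * (4 * real n ^ (CARD('d) - 2))) * (B * real n / \<epsilon>)"
        proof (rule mult_right_mono)
          show "real (card ?E) \<le> ?d\<^sup>2 * (4 * real n ^ (CARD('d) - 2))"
            using of_nat_mono[OF card_edge_sites[of n], where 'a = real] by simp
        qed (use B \<epsilon> in auto)
        also have "\<dots> = 4 * ?d\<^sup>2 * B / \<epsilon> * (1 / real n) * real n ^ CARD('d)"
        proof -
          have "real n ^ CARD('d) = real n ^ (CARD('d) - 2) * real n * real n"
          proof -
            have "CARD('d) = CARD('d) - 2 + 2" using d by linarith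
            then have "real n ^ CARD('d) = real n ^ (CARD('d) - 2 + 2)" by (rule arg_cong)
            then show ?thesis by (simp only: power_add power2_eq_square mult.assoc)
          qed
          then show ?thesis using elim by (simp add: mult_ac)
        qed
        finally show ?case using elim by (simp add: divide_le_eq distrib_right)
      qed
      have inv: "(\<lambda>n. 1 / real n) \<longlonglongrightarrow> 0" by (rule lim_1_over_n)
      have "(\<lambda>n. s n * (1 / real n)) \<longlonglongrightarrow> 0"
      proof (cases "\<theta> = 1")
        case True then show ?thesis using inv by (simp add: s_def)
      next
        case False
        have "(\<lambda>n. 1 / real n + real n powr (1 - \<theta>)) \<longlonglongrightarrow> 0 + 0"
          using False \<theta>1 by (intro tendsto_add inv tendsto_neg_powr filterlim_real_sequentially) auto
        moreover have "\<forall>\<^sub>F n in sequentially. 1 / real n + real n powr (1 - \<theta>) = s n * (1 / real n)"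
          using eventually_gt_at_top[of 0]
        proof eventually_elim
          case (elim n)
          have "real n powr (2 - \<theta>) = real n powr (1 - \<theta>) * real n"
            using elim powr_add[of "real n" "1 - \<theta>" 1] by simp
          then show ?case using False elim by (simp add: s_def field_simps)
        qed
        ultimately show ?thesis by (auto dest: Lim_transform_eventually)
      qed
      then have "(\<lambda>n. 2 * ?d * B / \<epsilon> * (s n * (1 / real n)) + 4 * ?d\<^sup>2 * B / \<epsilon> * (1 / real n)) \<longlonglongrightarrow>
          2 * ?d * B / \<epsilon> * 0 + 4 * ?d\<^sup>2 * B / \<epsilon> * 0"
        by (intro tendsto_intros inv)
      then show "(\<lambda>n. 2 * ?d * B / \<epsilon> * (s n * (1 / real n)) + 4 * ?d\<^sup>2 * B / \<epsilon> * (1 / real n)) \<longlonglongrightarrow> 0"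
        by simp
    qed simp
    moreover have "\<bar>drift n t z\<bar> / \<epsilon> \<le> e n z" if "large n" "t \<in> {0..T}" "z \<in> ?b n" for n t z
    proof (cases "face_site n z")
      case True
      have "\<bar>drift n t z\<bar> \<le> B * s n"
        using order_trans[OF B2[OF that True] mult_right_mono[OF B(3) s0]] .
      then show ?thesis using True \<epsilon> by (simp add: e_def divide_right_mono)
    next
      case False
      have "\<bar>drift n t z\<bar> \<le> B * real n"
        using order_trans[OF B1[OF that] mult_right_mono[OF B(2)]] by simp
      then show ?thesis using False \<epsilon> by (simp add: e_def divide_right_mono)
    qed
    ultimately show ?thesis by blast
  qed
qed

end

section \<open>Growth of the relative entropy\<close>

text \<open>Where \<open>q\<close> vanishes the term is 0 whatever value \<open>ln 0\<close> has, in
  accordance with the convention 0 log 0 = 0.\<close>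

definition finite_entropy :: "'a set \<Rightarrow> ('a \<Rightarrow> real) \<Rightarrow> ('a \<Rightarrow> real) \<Rightarrow> real" where
  "finite_entropy A q \<nu> = (\<Sum>\<eta> \<in> A. q \<eta> * (ln (q \<eta>) - ln (\<nu> \<eta>)))"

text \<open>Gibbs' inequality, summed from ln s \<le> s - 1. It supplies the lower half of the final
  limit.\<close>

lemma finite_entropy_nonneg:
  assumes "finite A" "\<And>\<eta>. \<eta> \<in> A \<Longrightarrow> 0 \<le> q \<eta>" "\<And>\<eta>. \<eta> \<in> A \<Longrightarrow> 0 < \<nu> \<eta>" "sum q A = sum \<nu> A"
  shows "0 \<le> finite_entropy A q \<nu>"
proof -
  have "q \<eta> - \<nu> \<eta> \<le> q \<eta> * (ln (q \<eta>) - ln (\<nu> \<eta>))" if \<eta>: "\<eta> \<in> A" for \<eta>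
  proof (cases "q \<eta> = 0")
    case False
    then have q: "0 < q \<eta>" using assms(2)[OF \<eta>] by simp
    have "ln (\<nu> \<eta> / q \<eta>) \<le> \<nu> \<eta> / q \<eta> - 1" using q assms(3)[OF \<eta>] by (intro ln_le_minus_one) auto
    then have "q \<eta> * (ln (\<nu> \<eta>) - ln (q \<eta>)) \<le> q \<eta> * (\<nu> \<eta> / q \<eta> - 1)"
      using q assms(3)[OF \<eta>] by (intro mult_left_mono) (auto simp: ln_div)
    then show ?thesis using q by (simp add: algebra_simps)
  qed (use assms(3)[OF \<eta>] in simp)
  then have "(\<Sum>\<eta> \<in> A. q \<eta> - \<nu> \<eta>) \<le> finite_entropy A q \<nu>"
    unfolding finite_entropy_def by (rule sum_mono)
  then show ?thesis using assms(4) by (simp add: sum_subtractf)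
qed

text \<open>At a zero of \<open>q\<close> the limit is that of \<delta> b ln (\<delta> b); elsewhere
  the logarithm is continuous. It carries the growth estimate from positive laws to all
  laws.\<close>

lemma finite_entropy_tendsto:
  assumes "finite A" "\<And>\<eta>. \<eta> \<in> A \<Longrightarrow> 0 \<le> q \<eta>" "\<And>\<eta>. \<eta> \<in> A \<Longrightarrow> 0 < u \<eta>"
  shows "((\<lambda>\<delta>. finite_entropy A (\<lambda>\<eta>. (1 - \<delta>) * q \<eta> + \<delta> * u \<eta>) \<nu>) \<longlongrightarrow> finite_entropy A q \<nu>) (at_right 0)"
  unfolding finite_entropy_def right_diff_distrib
proof (intro tendsto_sum tendsto_diff)
  fix \<eta> assume \<eta>: "\<eta> \<in> A"
  have lin: "((\<lambda>\<delta>. (1 - \<delta>) * q \<eta> + \<delta> * u \<eta>) \<longlongrightarrow> q \<eta>) (at_right 0)"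
    by (auto intro!: tendsto_eq_intros)
  show "((\<lambda>\<delta>. ((1 - \<delta>) * q \<eta> + \<delta> * u \<eta>) * ln (\<nu> \<eta>)) \<longlongrightarrow> q \<eta> * ln (\<nu> \<eta>)) (at_right 0)"
    by (intro tendsto_mult lin tendsto_const)
  show "((\<lambda>\<delta>. ((1 - \<delta>) * q \<eta> + \<delta> * u \<eta>) * ln ((1 - \<delta>) * q \<eta> + \<delta> * u \<eta>)) \<longlongrightarrow> q \<eta> * ln (q \<eta>)) (at_right 0)"
  proof (cases "q \<eta> = 0")
    case True
    have "((\<lambda>\<delta>. (\<delta> * b) * ln (\<delta> * b)) \<longlongrightarrow> 0) (at_right 0)" if "0 < b" for b :: real
      using that by real_asymp
    then show ?thesis using True assms(3)[OF \<eta>] by simp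
  next
    case False
    then show ?thesis by (intro tendsto_mult tendsto_ln lin) auto
  qed
qed

context hydrodynamic_profile
begin

abbreviation scaled_generator :: "nat \<Rightarrow> ('d config \<Rightarrow> real) \<Rightarrow> 'd config \<Rightarrow> real" where
  "scaled_generator n \<equiv> \<lambda>f \<eta>. (real n)\<^sup>2 * generator \<theta> c g p n f \<eta>"

definition ref_weight :: "nat \<Rightarrow> real \<Rightarrow> 'd config \<Rightarrow> real" where
  "ref_weight n t = bernoulli_weight (sites n) (profile n t)"

text \<open>The error of \<open>bulk_quadratic_bound\<close> summed over the d directions, with L =
  1 + 3 C: \<open>profile_step\<close> gives 3 C and the added 1 secures L \<ge> 1.\<close>

definition quadratic_error :: "nat \<Rightarrow> nat \<Rightarrow> real" where
  "quadratic_error \<l> n = real CARD('d) * ((1 + 3 * C)\<^sup>2 / \<epsilon> ^ 4 / real (\<l> - 1) * real n ^ CARD('d) +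
      (1 + 3 * C)\<^sup>2 / \<epsilon> ^ 4 * (6 * real \<l> / \<epsilon>\<^sup>2 * (2 * real \<l> * ((1 + 3 * C)\<^sup>2 / \<epsilon> ^ 4) + (1 + 3 * C)) + (1 + 3 * C) + real \<l>)
        * real n ^ (CARD('d) - 1))"

lemma finite_configs: "finite (configs n :: 'd config set)"
  unfolding configs_def using finite_sites by (intro finite_PiE) auto

lemma profile_01: "large n \<Longrightarrow> t \<in> {0..T} \<Longrightarrow> x \<in> sites n \<Longrightarrow> 0 < profile n t x \<and> profile n t x < 1"
  using profile_bounds[of n t x] \<epsilon> by auto

lemma ref_weight_pos: "large n \<Longrightarrow> t \<in> {0..T} \<Longrightarrow> \<eta> \<in> configs n \<Longrightarrow> 0 < ref_weight n t \<eta>"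
  unfolding ref_weight_def configs_def using profile_01 by (intro bernoulli_weight_pos) auto

lemma ref_weight_sum: "(\<Sum>\<eta> \<in> configs n. ref_weight n t \<eta>) = 1"
  unfolding ref_weight_def configs_def by (intro bernoulli_weight_sum finite_sites)

text \<open>By the heat equation the profile moves with speed the sum of \<open>w2\<close>, and the
  logarithmic derivative of a Bernoulli factor in its parameter is the quantity
  \<open>\<omega>\<close> of \<open>bernoulli_density\<close>.\<close>

lemma ln_ref_weight_derivative:
  assumes n: "large n" and t: "t \<in> {0..T}" and \<eta>: "\<eta> \<in> configs n"
  shows "((\<lambda>s. ln (ref_weight n s \<eta>)) has_real_derivative
    (\<Sum>x \<in> sites n. (\<Sum>i \<in> UNIV. w2 i t (site_map \<theta> c n x)) *
      ((real (\<eta> x) - profile n t x) / (profile n t x * (1 - profile n t x))))) (at t within {0..T})"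
proof -
  let ?b = "\<lambda>s x. real (\<eta> x) * profile n s x + (1 - real (\<eta> x)) * (1 - profile n s x)"
  have pos: "0 < ?b s x" if "s \<in> {0..T}" "x \<in> sites n" for s x
    using config_cases[of \<eta> "sites n" x] \<eta> that profile_01[OF n that] by (auto simp: configs_def)
  have "((\<lambda>s. \<Sum>x \<in> sites n. ln (?b s x)) has_real_derivative
    (\<Sum>x \<in> sites n. (\<Sum>i \<in> UNIV. w2 i t (site_map \<theta> c n x)) *
      ((real (\<eta> x) - profile n t x) / (profile n t x * (1 - profile n t x))))) (at t within {0..T})"
  proof (rule DERIV_sum)
    fix x :: "int ^ 'd" assume x: "x \<in> sites n"
    let ?D = "\<Sum>i \<in> UNIV. w2 i t (site_map \<theta> c n x)"
    have der: "((\<lambda>s. profile n s x) has_real_derivative ?D) (at t within {0..T})"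
      unfolding profile_def by (rule time[OF t site_map_cube[OF n x]])
    have "((\<lambda>s. ln (?b s x)) has_real_derivative
        (real (\<eta> x) * ?D + (1 - real (\<eta> x)) * (- ?D)) / ?b t x) (at t within {0..T})"
      using pos[OF t x] by (auto intro!: derivative_eq_intros der)
    also have "(real (\<eta> x) * ?D + (1 - real (\<eta> x)) * (- ?D)) / ?b t x =
        ?D * ((real (\<eta> x) - profile n t x) / (profile n t x * (1 - profile n t x)))"
      using config_cases[of \<eta> "sites n" x] \<eta> x profile_01[OF n t x]
      by (auto simp: configs_def divide_simps)
    finally show "((\<lambda>s. ln (?b s x)) has_real_derivative
        ?D * ((real (\<eta> x) - profile n t x) / (profile n t x * (1 - profile n t x)))) (at t within {0..T})" .
  qed
  then show ?thesis
  proof (rule has_field_derivative_transform_within[where d = 1])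
    show "(\<Sum>x \<in> sites n. ln (?b s x)) = ln (ref_weight n s \<eta>)" if "s \<in> {0..T}" for s
      unfolding ref_weight_def bernoulli_weight_def
      using less_imp_neq[OF pos[OF that], symmetric] by (intro ln_prod[symmetric]) (auto simp: finite_sites)
  qed (use t in auto)
qed

text \<open>The bound on the derivative is uniform in time and involves neither the law nor its
  entropy, so the mean value theorem integrates it.\<close>

lemma entropy_growth_pos:
  assumes n: "large n" "1 + 3 * C \<le> real n" and \<l>: "2 \<le> \<l>"
    and K: "transition_function (configs n) K" "has_generator (configs n) K (scaled_generator n)"
    and m: "\<And>\<eta>. \<eta> \<in> configs n \<Longrightarrow> 0 < m \<eta>" "(\<Sum>\<eta> \<in> configs n. m \<eta>) = 1"
    and e: "\<And>t z. t \<in> {0..T} \<Longrightarrow> z \<in> boundary_sites n \<Longrightarrow>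
      \<bar>drift n t z\<bar> / \<epsilon> \<le> e z \<or>
      0 < (real n)\<^sup>2 * (c * real n powr (- \<theta>)) \<and>
        (drift n t z)\<^sup>2 / ((real n)\<^sup>2 * (c * real n powr (- \<theta>)) * \<epsilon> ^ 4) \<le> e z"
    and t: "t \<in> {0..T}"
  shows "finite_entropy (configs n) (finite_semigroup.flow (configs n) K m t) (ref_weight n t) \<le>
    finite_entropy (configs n) m (ref_weight n 0) +
    t * (interior_error n / \<epsilon> * real n ^ CARD('d) + (\<Sum>z \<in> boundary_sites n. e z) + quadratic_error \<l> n)"
proof -
  interpret finite_semigroup "configs n" K "scaled_generator n"
    by unfold_locales (fact finite_configs K)+
  define R where "R = interior_error n / \<epsilon> * real n ^ CARD('d) + (\<Sum>z \<in> boundary_sites n. e z) + quadratic_error \<l> n"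
  define H where "H s = finite_entropy (configs n) (flow m s) (ref_weight n s)" for s
  define \<tau> where "\<tau> s x = (\<Sum>i \<in> UNIV. w2 i s (site_map \<theta> c n x))" for s and x :: "int ^ 'd"
  define l' where "l' s \<eta> = (\<Sum>x \<in> sites n. \<tau> s x *
      ((real (\<eta> x) - profile n s x) / (profile n s x * (1 - profile n s x))))" for s and \<eta> :: "'d config"
  define D where "D s = (\<Sum>z \<in> configs n. flow m s z *
     (scaled_generator n (\<lambda>y. ln (flow m s y) - ln (ref_weight n s y)) z - l' s z))" for s
  have der: "(H has_real_derivative D s) (at s within {0..T})" if s: "s \<in> {0..T}" for s
    unfolding H_def[abs_def] D_def finite_entropy_def
    by (rule entropy_has_derivative[OF m s]) (auto simp only: l'_def \<tau>_def intro!: ln_ref_weight_derivative n s)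
  have D_le: "D s \<le> R" if s: "s \<in> {0..T}" for s
  proof -
    interpret B: bernoulli_density "sites n" "profile n s" \<epsilon> "flow m s"
    proof
      show "0 < flow m s \<eta>" if "\<eta> \<in> sites n \<rightarrow>\<^sub>E {0, 1}" for \<eta>
        using that s flow_pos[of m s \<eta>] m by (simp add: configs_def)
      show "(\<Sum>\<eta> \<in> sites n \<rightarrow>\<^sub>E {0, 1}. flow m s \<eta>) = 1"
        using s m flow_mass[of s m] by (simp add: configs_def)
    qed (use profile_bounds[OF n(1) s] \<epsilon> finite_sites in auto)
    have \<Omega>: "configs n = B.\<Omega>" by (simp add: configs_def B.\<Omega>_def)
    have "D s = B.E (\<lambda>\<eta>. (real n)\<^sup>2 * generator \<theta> c g p n (\<lambda>\<xi>. ln (B.f \<xi>)) \<eta> - (\<Sum>x \<in> sites n. \<tau> s x * B.\<omega> x \<eta>))"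
      unfolding D_def B.E_def \<Omega>[symmetric]
    proof (rule sum.cong[OF refl])
      fix \<eta> :: "'d config" assume \<eta>: "\<eta> \<in> configs n"
      \<comment> \<open>The two functions are identified on \<open>configs n\<close>;
        \<open>generator_cong\<close> shows that this determines the generator there.\<close>
      have G_eq: "scaled_generator n (\<lambda>y. ln (flow m s y) - ln (ref_weight n s y)) \<eta> = scaled_generator n (\<lambda>\<xi>. ln (B.f \<xi>)) \<eta>"
      proof (rule generator_cong[OF \<eta>])
        fix \<xi> :: "'d config" assume \<xi>: "\<xi> \<in> configs n"
        have "0 < flow m s \<xi>" using s \<xi> m by (intro flow_pos) auto
        then show "ln (flow m s \<xi>) - ln (ref_weight n s \<xi>) = ln (B.f \<xi>)"
          using ref_weight_pos[OF n(1) s \<xi>] by (simp add: B.f_def ref_weight_def ln_div)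
      qed
      have "l' s \<eta> = (\<Sum>x \<in> sites n. \<tau> s x * B.\<omega> x \<eta>)" by (simp add: l'_def B.\<omega>_def)
      then show "flow m s \<eta> * (scaled_generator n (\<lambda>y. ln (flow m s y) - ln (ref_weight n s y)) \<eta> - l' s \<eta>) =
          flow m s \<eta> * (scaled_generator n (\<lambda>\<xi>. ln (B.f \<xi>)) \<eta> - (\<Sum>x \<in> sites n. \<tau> s x * B.\<omega> x \<eta>))"
        by (simp only: G_eq)
    qed
    also have "\<dots> \<le> R"
      unfolding R_def quadratic_error_def
    proof (rule B.entropy_production_bound[where \<Lambda> = "drift n s" and \<kappa> = "interior_error n"])
      show "drift n s x = (real n)\<^sup>2 * lattice_laplacian n (profile n s) x +
        (if x \<in> boundary_sites n then (real n)\<^sup>2 * (c * real n powr (- \<theta>)) * (g (p (rescale n x)) - profile n s x) else 0) - \<tau> s x" for x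
        by (simp add: drift_def \<tau>_def)
      show "\<epsilon> \<le> g (p (rescale n z)) \<and> g (p (rescale n z)) \<le> 1 - \<epsilon>" if "z \<in> boundary_sites n" for z
        using nearest_boundary_point_near(2)[OF p that] n g by (auto simp: large_def)
      show "real n * \<bar>profile n s x - profile n s (x + axis i 1)\<bar> \<le> 1 + 3 * C" if "x \<in> bonds n i" for x i
        using profile_step[OF n(1) s, of x i] that by (simp add: bonds_def)
      show "\<bar>drift n s x\<bar> \<le> interior_error n" if "x \<in> sites n - boundary_sites n" for x
        using drift_interior[OF n(1) s that] by (simp add: interior_error_def)
      show "0 \<le> interior_error n"
        using C_nonneg spacing_pos[OF n(1)] by (simp add: interior_error_def)
      show "\<bar>drift n s z\<bar> / \<epsilon> \<le> e z \<or> 0 < (real n)\<^sup>2 * (c * real n powr (- \<theta>)) \<and>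
        (drift n s z)\<^sup>2 / ((real n)\<^sup>2 * (c * real n powr (- \<theta>)) * \<epsilon> ^ 4) \<le> e z" if "z \<in> boundary_sites n" for z
        using e[OF s that] .
    qed (use c \<l> n C_nonneg in auto)
    finally show ?thesis .
  qed
  have "H t \<le> H 0 + t * R"
  proof (cases "t = 0")
    case False
    then have t0: "0 < t" using t by simp
    have "(H has_derivative (*) (D s)) (at s within {0..t})" if "0 \<le> s" "s \<le> t" for s
      using DERIV_subset[OF der[of s], of "{0..t}"] that t by (auto simp: has_field_derivative_def)
    then obtain s where s: "s \<in> {0<..<t}" and eq: "H t - H 0 = D s * (t - 0)"
      using mvt_simple[OF t0, of H "\<lambda>s. (*) (D s)"] by auto
    have "D s * t \<le> R * t" using D_le[of s] s t by (intro mult_right_mono) auto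
    then show ?thesis using eq unfolding diff_zero mult.commute[of t R] by linarith
  qed simp
  moreover have "H 0 = finite_entropy (configs n) m (ref_weight n 0)"
    by (simp add: H_def finite_entropy_def flow_0)
  ultimately show ?thesis by (simp add: H_def R_def)
qed

text \<open>An initial law with zeros is replaced by its mixture with the reference measure.\<close>

lemma entropy_growth:
  assumes n: "large n" "1 + 3 * C \<le> real n" and \<l>: "2 \<le> \<l>"
    and K: "transition_function (configs n) K" "has_generator (configs n) K (scaled_generator n)"
    and m: "\<And>\<eta>. \<eta> \<in> configs n \<Longrightarrow> 0 \<le> m \<eta>" "(\<Sum>\<eta> \<in> configs n. m \<eta>) = 1"
    and e: "\<And>t z. t \<in> {0..T} \<Longrightarrow> z \<in> boundary_sites n \<Longrightarrow>
      \<bar>drift n t z\<bar> / \<epsilon> \<le> e z \<or>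
      0 < (real n)\<^sup>2 * (c * real n powr (- \<theta>)) \<and>
        (drift n t z)\<^sup>2 / ((real n)\<^sup>2 * (c * real n powr (- \<theta>)) * \<epsilon> ^ 4) \<le> e z"
    and t: "t \<in> {0..T}"
  shows "finite_entropy (configs n) (finite_semigroup.flow (configs n) K m t) (ref_weight n t) \<le>
    finite_entropy (configs n) m (ref_weight n 0) +
    t * (interior_error n / \<epsilon> * real n ^ CARD('d) + (\<Sum>z \<in> boundary_sites n. e z) + quadratic_error \<l> n)"
proof -
  interpret finite_semigroup "configs n" K "scaled_generator n"
    by unfold_locales (fact finite_configs K)+
  define u where "u = ref_weight n 0"
  have T0: "0 \<in> {0..T}" using T by simp
  have u: "0 < u \<eta>" if "\<eta> \<in> configs n" for \<eta> using ref_weight_pos[OF n(1) T0 that] by (simp add: u_def)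
  \<comment> \<open>The flow is linear in the initial law, so the mixture parameter can be sent to 0
    at the initial and at the final time simultaneously.\<close>
  have flow_mix: "flow (\<lambda>\<eta>. (1 - \<delta>) * m \<eta> + \<delta> * u \<eta>) t y = (1 - \<delta>) * flow m t y + \<delta> * flow u t y" for \<delta> y
    unfolding flow_def by (simp add: sum.distrib sum_distrib_left distrib_right mult.assoc)
  let ?R = "t * (interior_error n / \<epsilon> * real n ^ CARD('d) + (\<Sum>z \<in> boundary_sites n. e z) + quadratic_error \<l> n)"
  have lim_flow: "((\<lambda>\<delta>. finite_entropy (configs n) (\<lambda>\<eta>. (1 - \<delta>) * flow m t \<eta> + \<delta> * flow u t \<eta>) (ref_weight n t)) \<longlongrightarrow>
      finite_entropy (configs n) (flow m t) (ref_weight n t)) (at_right 0)"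
    using t by (intro finite_entropy_tendsto finite_configs flow_nonneg flow_pos m u) auto
  have lim_init: "((\<lambda>\<delta>. finite_entropy (configs n) (\<lambda>\<eta>. (1 - \<delta>) * m \<eta> + \<delta> * u \<eta>) (ref_weight n 0) + ?R) \<longlongrightarrow>
      finite_entropy (configs n) m (ref_weight n 0) + ?R) (at_right 0)"
    by (intro tendsto_add tendsto_const finite_entropy_tendsto finite_configs m u)
  have le: "\<forall>\<^sub>F \<delta> in at_right 0.
      finite_entropy (configs n) (\<lambda>\<eta>. (1 - \<delta>) * flow m t \<eta> + \<delta> * flow u t \<eta>) (ref_weight n t) \<le>
      finite_entropy (configs n) (\<lambda>\<eta>. (1 - \<delta>) * m \<eta> + \<delta> * u \<eta>) (ref_weight n 0) + ?R"
    using eventually_at_right_less[of "0 :: real"] eventually_at_right_real[of 0 "1 :: real", simplified]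
  proof eventually_elim
    case (elim \<delta>)
    have "finite_entropy (configs n) (flow (\<lambda>\<eta>. (1 - \<delta>) * m \<eta> + \<delta> * u \<eta>) t) (ref_weight n t) \<le>
        finite_entropy (configs n) (\<lambda>\<eta>. (1 - \<delta>) * m \<eta> + \<delta> * u \<eta>) (ref_weight n 0) + ?R"
    proof (rule entropy_growth_pos[OF n \<l> K _ _ e t])
      show "0 < (1 - \<delta>) * m \<eta> + \<delta> * u \<eta>" if "\<eta> \<in> configs n" for \<eta>
        using m(1)[OF that] u[OF that] elim by (intro add_nonneg_pos) auto
      show "(\<Sum>\<eta> \<in> configs n. (1 - \<delta>) * m \<eta> + \<delta> * u \<eta>) = 1"
        using m(2) ref_weight_sum[of n 0] by (simp add: sum.distrib sum_distrib_left[symmetric] u_def)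
    qed
    then show ?case by (simp add: finite_entropy_def flow_mix)
  qed
  show ?thesis by (rule tendsto_le[OF _ lim_init lim_flow le]) simp
qed

end

section \<open>Uniform bounds for the solution\<close>

text \<open>The maximum principle, applied to \<rho> and to its negative, keeps the solution in
  [\<epsilon>, 1 - \<epsilon>], where \<epsilon> is the constant that bounds the initial and the
  boundary data.\<close>

lemma hydrodynamic_profile_exists:
  fixes \<rho> :: "real \<Rightarrow> real ^ 'd::finite \<Rightarrow> real"
  assumes \<theta>: "0 \<le> \<theta>" and c: "0 < c" and T: "0 < T"
    and A2: "\<exists>\<epsilon>\<^sub>0 \<in> {0<..<1/2}. \<rho>\<^sub>0 \<in> closed_cube \<rightarrow> {\<epsilon>\<^sub>0<..<1 - \<epsilon>\<^sub>0} \<and> g \<in> cube_boundary \<rightarrow> {\<epsilon>\<^sub>0<..<1 - \<epsilon>\<^sub>0}"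
    and hs: "hydrodynamic_solution \<theta> c g \<rho>\<^sub>0 T \<rho>" and p: "nearest_boundary_point p"
  shows "\<exists>w1 w2 C \<epsilon>. hydrodynamic_profile T \<rho> w1 w2 C \<theta> c \<epsilon> g p"
proof -
  obtain \<epsilon> where \<epsilon>: "0 < \<epsilon>" and \<rho>0: "\<And>u. u \<in> closed_cube \<Longrightarrow> \<epsilon> < \<rho>\<^sub>0 u \<and> \<rho>\<^sub>0 u < 1 - \<epsilon>"
    and g: "\<And>u. u \<in> cube_boundary \<Longrightarrow> \<epsilon> < g u \<and> g u < 1 - \<epsilon>"
    using A2 by (fastforce simp: Pi_iff)
  obtain w1 w2 C where hp: "heat_profile T \<rho> w1 w2 C"
    using hydrodynamic_solution_profile[OF hs T] by blast
  interpret heat_profile T \<rho> w1 w2 C by (rule hp)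
  have init: "\<rho> 0 u = \<rho>\<^sub>0 u" if "u \<in> closed_cube" for u
    using hs that by (auto simp: hydrodynamic_solution_def)
  have bc: "boundary_condition \<theta> c g (\<rho> t)" if "t \<in> {0..T}" for t
    using hs that by (auto simp: hydrodynamic_solution_def)
  have dirichlet: "\<rho> t u = g u" if "\<theta> < 1" "t \<in> {0..T}" "u \<in> cube_boundary" for t u
    using bc[OF that(2)] that by (auto simp: boundary_condition_def dirichlet_bc_def)
  have flux_plus: "w1 i t u = (if \<theta> = 1 then c * (\<rho> t u - g u) else 0)"
    if "1 \<le> \<theta>" "t \<in> {0..T}" "u \<in> face_plus i" for t u i
  proof -
    have "has_right_partial i (\<rho> t) u (if \<theta> = 1 then c * (\<rho> t u - g u) else 0)"
      using bc[OF that(2)] that by (auto simp: boundary_condition_def robin_bc_def neumann_bc_def split: if_splits)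
    then show ?thesis using right_partial_unique[OF that(2,3)] by simp
  qed
  have flux_minus: "w1 i t u = (if \<theta> = 1 then c * (g u - \<rho> t u) else 0)"
    if "1 \<le> \<theta>" "t \<in> {0..T}" "u \<in> face_minus i" for t u i
  proof -
    have "has_left_partial i (\<rho> t) u (if \<theta> = 1 then c * (g u - \<rho> t u) else 0)"
      using bc[OF that(2)] that by (auto simp: boundary_condition_def robin_bc_def neumann_bc_def split: if_splits)
    then show ?thesis using left_partial_unique[OF that(2,3)] by simp
  qed
  have bdry: "u \<in> cube_boundary" "u $ i = 0 \<Longrightarrow> u \<in> face_plus i" "u $ i = 1 \<Longrightarrow> u \<in> face_minus i"
    if "u \<in> closed_cube" "u $ i = 0 \<or> u $ i = 1" for u :: "real ^ 'd" and i
  proof -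
    have "u \<notin> cube" using that(2) by (auto simp: cube_def intro!: exI[of _ i])
    then show "u \<in> cube_boundary" using that(1) by (simp add: cube_boundary_def)
    then show "u $ i = 0 \<Longrightarrow> u \<in> face_plus i" "u $ i = 1 \<Longrightarrow> u \<in> face_minus i"
      by (auto simp: face_plus_def face_minus_def)
  qed
  \<comment> \<open>In all three regimes the inward derivative has weakly the sign of \<rho> - g
    where they differ: vacuously for Dirichlet, by the flux for Robin, as zero for Neumann. Beyond
    the bound \<rho> lies strictly on one side of g, so this is the boundary hypothesis of the
    maximum principle.\<close>
  have flux_sign: "(u $ i = 0 \<longrightarrow> (g u < \<rho> t u \<longrightarrow> 0 \<le> w1 i t u) \<and> (\<rho> t u < g u \<longrightarrow> w1 i t u \<le> 0)) \<and>
      (u $ i = 1 \<longrightarrow> (g u < \<rho> t u \<longrightarrow> w1 i t u \<le> 0) \<and> (\<rho> t u < g u \<longrightarrow> 0 \<le> w1 i t u))"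
    if "t \<in> {0..T}" "u \<in> closed_cube" for t u i
  proof (cases "\<theta> < 1")
    case True
    then show ?thesis using dirichlet[OF True that(1)] bdry(1)[OF that(2)] by force
  next
    case False
    then have "1 \<le> \<theta>" by simp
    then show ?thesis
      using flux_plus[OF _ that(1)] flux_minus[OF _ that(1)] bdry(2,3)[OF that(2), of i] c
      by (auto simp: mult_le_0_iff zero_le_mult_iff)
  qed
  have upper: "\<rho> t u \<le> 1 - \<epsilon>" if "t \<in> {0..T}" "u \<in> closed_cube" for t u
  proof (rule maximum_principle[OF _ _ that])
    show "\<rho> 0 u \<le> 1 - \<epsilon>" if "u \<in> closed_cube" for u
      using init \<rho>0 that by (auto intro: less_imp_le)
    show "(u $ i = 0 \<longrightarrow> 0 \<le> w1 i t u) \<and> (u $ i = 1 \<longrightarrow> w1 i t u \<le> 0)"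
      if "t \<in> {0..T}" "u \<in> closed_cube" "1 - \<epsilon> < \<rho> t u" for t u i
      using flux_sign[OF that(1,2), of i] g[OF bdry(1)[OF that(2), of i]] that(3) by auto
  qed
  have lower: "- \<rho> t u \<le> - \<epsilon>" if "t \<in> {0..T}" "u \<in> closed_cube" for t u
  proof (rule heat_profile.maximum_principle[OF heat_profile_uminus _ _ that])
    show "- \<rho> 0 u \<le> - \<epsilon>" if "u \<in> closed_cube" for u
      using init \<rho>0 that by (auto intro: less_imp_le)
    show "(u $ i = 0 \<longrightarrow> 0 \<le> - w1 i t u) \<and> (u $ i = 1 \<longrightarrow> - w1 i t u \<le> 0)"
      if "t \<in> {0..T}" "u \<in> closed_cube" "- \<epsilon> < - \<rho> t u" for t u i
      using flux_sign[OF that(1,2), of i] g[OF bdry(1)[OF that(2), of i]] that(3) by auto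
  qed
  have "hydrodynamic_profile T \<rho> w1 w2 C \<theta> c \<epsilon> g p"
  proof
    show "\<epsilon> \<le> g u \<and> g u \<le> 1 - \<epsilon>" if "u \<in> cube_boundary" for u
      using g[OF that] by auto
    show "\<epsilon> \<le> \<rho> t u \<and> \<rho> t u \<le> 1 - \<epsilon>" if "t \<in> {0..T}" "u \<in> closed_cube" for t u
      using upper[OF that] lower[OF that] by auto
  qed (fact \<theta> c \<epsilon> p dirichlet flux_plus flux_minus)+
  then show ?thesis by blast
qed

section \<open>From measures and processes to finite sums\<close>

text \<open>A reference measure charging every point has only the empty null set, so the infinite
  branch of \<open>rel_entropy\<close> does not occur; the base exp 1 makes the logarithm
  natural.\<close>

lemma rel_entropy_point_measure:
  assumes A: "finite A" and q: "\<And>x. x \<in> A \<Longrightarrow> 0 \<le> q x" and \<nu>: "\<And>x. x \<in> A \<Longrightarrow> 0 < \<nu> x"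
  shows "rel_entropy (point_measure A (\<lambda>x. ennreal (q x))) (point_measure A (\<lambda>x. ennreal (\<nu> x))) =
    ereal (finite_entropy A q \<nu>)"
proof -
  interpret sigma_finite_measure "count_space A" by (rule sigma_finite_measure_count_space_finite[OF A])
  have "X = {}" if "X \<in> null_sets (point_measure A (\<lambda>x. ennreal (\<nu> x)))" for X
    using that \<nu> by (fastforce simp: null_sets_point_measure_iff)
  then have "absolutely_continuous (point_measure A (\<lambda>x. ennreal (\<nu> x))) (point_measure A (\<lambda>x. ennreal (q x)))"
    by (auto simp: absolutely_continuous_def)
  moreover have "KL_divergence (exp 1) (point_measure A (\<lambda>x. ennreal (\<nu> x))) (point_measure A (\<lambda>x. ennreal (q x))) =
      (\<integral>x. q x * log (exp 1) (q x / \<nu> x) \<partial>count_space A)"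
    unfolding point_measure_def using q less_imp_le[OF \<nu>] less_imp_neq[OF \<nu>, symmetric]
    by (intro KL_density_density) (auto simp: AE_count_space)
  moreover have "\<dots> = finite_entropy A q \<nu>"
    unfolding finite_entropy_def lebesgue_integral_count_space_finite[OF A]
  proof (rule sum.cong[OF refl])
    fix x assume x: "x \<in> A"
    show "q x * log (exp 1) (q x / \<nu> x) = q x * (ln (q x) - ln (\<nu> x))"
      using q[OF x] \<nu>[OF x] by (cases "q x = 0") (auto simp: log_def ln_div)
  qed
  ultimately show ?thesis by (simp add: rel_entropy_def)
qed

lemma distr_finite:
  assumes S: "finite S" and X: "X \<in> measurable M (count_space S)"
  shows "distr M (count_space S) X = point_measure S (\<lambda>y. emeasure M {w \<in> space M. X w = y})"
proof (rule measure_eqI_finite[OF _ _ S])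
  fix y assume y: "y \<in> S"
  have "X -` {y} \<inter> space M = {w \<in> space M. X w = y}" by auto
  then show "emeasure (distr M (count_space S) X) {y} = emeasure (point_measure S (\<lambda>y. emeasure M {w \<in> space M. X w = y})) {y}"
    using y X S by (simp add: emeasure_distr emeasure_point_measure_finite)
qed (auto simp: sets_point_measure)

text \<open>The elementary Markov property with the history reduced to J = {0} gives the joint law
  of start and end; summing over the start yields the flow.\<close>

lemma markov_process_flow:
  assumes mp: "markov_process M S X G" and S: "finite S"
  obtains K where "transition_function S K" "has_generator S K G"
    and "\<And>t y. 0 \<le> t \<Longrightarrow> y \<in> S \<Longrightarrow> measure M {w \<in> space M. X t w = y} =
      finite_semigroup.flow S K (\<lambda>x. measure M {w \<in> space M. X 0 w = x}) t y"
proof -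
  obtain K where K: "transition_function S K" "has_generator S K G"
    and markov: "\<forall>J s h. \<forall>a \<in> J \<rightarrow> S. \<forall>y \<in> S. finite J \<longrightarrow> J \<subseteq> {0..s} \<longrightarrow> s \<in> J \<longrightarrow> 0 \<le> h \<longrightarrow>
           measure M {w \<in> space M. (\<forall>r \<in> J. X r w = a r) \<and> X (s + h) w = y} =
           measure M {w \<in> space M. \<forall>r \<in> J. X r w = a r} * pmf (K h (a s)) y"
    using mp by (auto simp: markov_process_def)
  interpret finite_semigroup S K G by unfold_locales (fact S K)+
  interpret prob_space M using mp by (simp add: markov_process_def)
  have X: "X t \<in> measurable M (count_space S)" if "0 \<le> t" for t
    using mp that by (simp add: markov_process_def)
  have "prob {w \<in> space M. X t w = y} = flow (\<lambda>x. prob {w \<in> space M. X 0 w = x}) t y"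
    if t: "0 \<le> t" and y: "y \<in> S" for t y
  proof -
    have meas: "{w \<in> space M. X 0 w = x \<and> X t w = y} \<in> sets M" if "x \<in> S" for x
    proof -
      have "{w \<in> space M. X 0 w = x \<and> X t w = y} = (X 0 -` {x} \<inter> space M) \<inter> (X t -` {y} \<inter> space M)" by auto
      also have "\<dots> \<in> sets M"
        using X[of 0] X[OF t] that y by (intro sets.Int measurable_sets) auto
      finally show ?thesis .
    qed
    have "{w \<in> space M. X t w = y} = (\<Union>x \<in> S. {w \<in> space M. X 0 w = x \<and> X t w = y})"
      using measurable_space[OF X[of 0]] by auto
    then have "prob {w \<in> space M. X t w = y} = (\<Sum>x \<in> S. prob {w \<in> space M. X 0 w = x \<and> X t w = y})"
      using meas by (simp only:) (rule finite_measure_finite_Union[OF S], auto simp: disjoint_family_on_def)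
    also have "\<dots> = flow (\<lambda>x. prob {w \<in> space M. X 0 w = x}) t y"
      unfolding flow_def
    proof (rule sum.cong[OF refl])
      fix x assume x: "x \<in> S"
      show "prob {w \<in> space M. X 0 w = x \<and> X t w = y} = prob {w \<in> space M. X 0 w = x} * pmf (K t x) y"
        using markov[rule_format, of "\<lambda>_. x" "{0}" y 0 t] x y t by simp
    qed
    finally show ?thesis .
  qed
  then show thesis using K that by blast
qed

text \<open>The order of limits: with \<l> fixed, n tends to infinity and leaves at most K / (\<l> -
  1), which is below any threshold for suitable \<l>.\<close>

lemma tendsto_0_if_bounded:
  fixes a :: "nat \<Rightarrow> real"
  assumes nonneg: "\<forall>\<^sub>F n in sequentially. 0 \<le> a n"
    and le: "\<And>\<l>. 2 \<le> \<l> \<Longrightarrow> \<forall>\<^sub>F n in sequentially. a n \<le> b \<l> n"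
    and lim: "\<And>\<l>. 2 \<le> \<l> \<Longrightarrow> b \<l> \<longlonglongrightarrow> K / real (\<l> - 1)"
  shows "a \<longlonglongrightarrow> 0"
proof (rule order_tendstoI)
  fix y :: real assume "y < 0"
  then show "\<forall>\<^sub>F n in sequentially. y < a n"
    using nonneg by (auto elim: eventually_mono)
next
  fix y :: real assume y: "0 < y"
  have "(\<lambda>\<l>. K / real (\<l> - 1)) \<longlonglongrightarrow> 0" by real_asymp
  then have "\<forall>\<^sub>F \<l> in sequentially. K / real (\<l> - 1) < y" using y by (rule order_tendstoD)
  then obtain \<l> where \<l>: "2 \<le> \<l>" "K / real (\<l> - 1) < y"
    using eventually_ge_at_top[of 2] by (metis (no_types, lifting) eventually_conj eventually_happens sequentially_bot)
  have "\<forall>\<^sub>F n in sequentially. b \<l> n < y" using lim[OF \<l>(1)] \<l>(2) by (rule order_tendstoD)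
  then show "\<forall>\<^sub>F n in sequentially. a n < y" using le[OF \<l>(1)] by eventually_elim simp
qed

context hydrodynamic_profile
begin

lemma quadratic_error_limit:
  "(\<lambda>n. quadratic_error \<l> n / real n ^ CARD('d)) \<longlonglongrightarrow> real CARD('d) * ((1 + 3 * C)\<^sup>2 / \<epsilon> ^ 4) / real (\<l> - 1)"
proof -
  define a b where "a = real CARD('d) * ((1 + 3 * C)\<^sup>2 / \<epsilon> ^ 4) / real (\<l> - 1)"
    and "b = real CARD('d) * ((1 + 3 * C)\<^sup>2 / \<epsilon> ^ 4 * (6 * real \<l> / \<epsilon>\<^sup>2 * (2 * real \<l> * ((1 + 3 * C)\<^sup>2 / \<epsilon> ^ 4) + (1 + 3 * C)) + (1 + 3 * C) + real \<l>))"
  have "(\<lambda>n. a + b * (1 / real n)) \<longlonglongrightarrow> a + b * 0"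
    by (intro tendsto_intros lim_1_over_n)
  moreover have "\<forall>\<^sub>F n in sequentially. a + b * (1 / real n) = quadratic_error \<l> n / real n ^ CARD('d)"
    using eventually_gt_at_top[of 0]
  proof eventually_elim
    case (elim n)
    have nd: "real n ^ CARD('d) = real n * real n ^ (CARD('d) - 1)"
      by (simp add: power_eq_if[of _ "CARD('d)"])
    have "quadratic_error \<l> n = a * real n ^ CARD('d) + b * real n ^ (CARD('d) - 1)"
      by (simp add: quadratic_error_def a_def b_def distrib_left mult_ac)
    then show ?case using elim by (simp add: nd field_simps)
  qed
  ultimately show ?thesis by (auto dest: Lim_transform_eventually simp: a_def)
qed

end

theorem lemma2p1:
  fixes \<theta> c T :: real
    and g \<rho>\<^sub>0 :: "real ^ 'd::finite \<Rightarrow> real"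
    and \<rho> :: "real \<Rightarrow> real ^ 'd \<Rightarrow> real"
    and p :: "real ^ 'd \<Rightarrow> real ^ 'd"
    and \<mu> :: "nat \<Rightarrow> 'd config measure"
    and M :: "nat \<Rightarrow> 'w measure"
    and X :: "nat \<Rightarrow> real \<Rightarrow> 'w \<Rightarrow> 'd config"
  assumes "2 \<le> CARD('d)" and "0 \<le> \<theta>" and "0 < c" and "0 < T"
    and "g \<in> cube_boundary \<rightarrow> {0<..<1}" and "\<rho>\<^sub>0 \<in> closed_cube \<rightarrow> {0..1}"
    and A1: "smooth_on closed_cube \<rho>\<^sub>0"
      "\<exists>V G. open V \<and> cube_boundary \<subseteq> V \<and> smooth_on V G \<and> (\<forall>u \<in> cube_boundary. G u = g u)"
    and A2: "\<exists>\<epsilon>\<^sub>0 \<in> {0<..<1/2}. \<rho>\<^sub>0 \<in> closed_cube \<rightarrow> {\<epsilon>\<^sub>0<..<1 - \<epsilon>\<^sub>0} \<and>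
                                g \<in> cube_boundary \<rightarrow> {\<epsilon>\<^sub>0<..<1 - \<epsilon>\<^sub>0}"
    and A3: "boundary_condition \<theta> c g \<rho>\<^sub>0"
    and "hydrodynamic_solution \<theta> c g \<rho>\<^sub>0 T \<rho>"
    and "nearest_boundary_point p"
    and "\<And>n. prob_space (\<mu> n)" and "\<And>n. sets (\<mu> n) = Pow (configs n)"
    and "\<And>n. markov_process (M n) (configs n) (X n) (\<lambda>f \<eta>. real n ^ 2 * generator \<theta> c g p n f \<eta>)"
    and "\<And>n. distr (M n) (count_space (configs n)) (X n 0) = \<mu> n"
    and "(\<lambda>n. rel_entropy (\<mu> n) (reference_measure \<theta> c n (\<rho> 0)) / ereal (real n ^ CARD('d)))
           \<longlonglongrightarrow> 0"
  shows "\<forall>t \<in> {0..T}.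
           (\<lambda>n. rel_entropy (distr (M n) (count_space (configs n)) (X n t))
                            (reference_measure \<theta> c n (\<rho> t)) / ereal (real n ^ CARD('d)))
             \<longlonglongrightarrow> 0"
proof
  note d = assms(1) and \<theta> = assms(2) and c = assms(3) and T = assms(4) and hs = assms(11) and p = assms(12)
    and mp = assms(15) and start = assms(16) and init = assms(17)
  fix t assume t: "t \<in> {0..T}"
  obtain w1 w2 C \<epsilon> where "hydrodynamic_profile T \<rho> w1 w2 C \<theta> c \<epsilon> g p"
    using hydrodynamic_profile_exists[OF \<theta> c T A2 hs p] by blast
  then interpret hydrodynamic_profile T \<rho> w1 w2 C \<theta> c \<epsilon> g p .
  define law where "law n s \<eta> = measure (M n) {w \<in> space (M n). X n s w = \<eta>}" for n s \<eta>
  define H where "H n s = finite_entropy (configs n) (law n s) (ref_weight n s)" for n s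
  let ?N = "\<lambda>n. real n ^ CARD('d)"
  have prob: "prob_space (M n)" for n using mp[of n] by (simp add: markov_process_def)
  have X: "X n s \<in> measurable (M n) (count_space (configs n))" if "0 \<le> s" for n s
    using mp[of n] that by (simp add: markov_process_def)
  have law_sum: "(\<Sum>\<eta> \<in> configs n. law n s \<eta>) = 1" if s: "0 \<le> s" for n s
  proof -
    interpret prob_space "M n" by (rule prob)
    have "(\<Sum>\<eta> \<in> configs n. law n s \<eta>) = prob (\<Union>\<eta> \<in> configs n. {w \<in> space (M n). X n s w = \<eta>})"
      unfolding law_def
    proof (rule finite_measure_finite_Union[OF finite_configs, symmetric])
      have "X n s -` {\<eta>} \<inter> space (M n) \<in> events" if "\<eta> \<in> configs n" for \<eta>
        using X[OF s] that by (intro measurable_sets) auto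
      then show "(\<lambda>\<eta>. {w \<in> space (M n). X n s w = \<eta>}) ` configs n \<subseteq> events"
        by (auto simp: vimage_def Int_def conj_commute)
    qed (auto simp: disjoint_family_on_def)
    also have "(\<Union>\<eta> \<in> configs n. {w \<in> space (M n). X n s w = \<eta>}) = space (M n)"
      using measurable_space[OF X[OF s]] by auto
    finally show ?thesis using prob_space by simp
  qed
  \<comment> \<open>For large n all sites are mapped into the cube, so every reference weight is
    positive and the entropy is a finite sum.\<close>
  have entropy_eq: "rel_entropy (distr (M n) (count_space (configs n)) (X n s)) (reference_measure \<theta> c n (\<rho> s)) = ereal (H n s)"
    if n: "large n" and s: "s \<in> {0..T}" for n s
  proof -
    interpret prob_space "M n" by (rule prob)
    have "distr (M n) (count_space (configs n)) (X n s) = point_measure (configs n) (\<lambda>\<eta>. ennreal (law n s \<eta>))"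
      using distr_finite[OF finite_configs X[of s n]] s by (simp add: law_def emeasure_eq_measure)
    moreover have "reference_measure \<theta> c n (\<rho> s) = point_measure (configs n) (\<lambda>\<eta>. ennreal (ref_weight n s \<eta>))"
      by (simp add: reference_measure_def ref_weight_def bernoulli_weight_def profile_def)
    ultimately show ?thesis
      using rel_entropy_point_measure[OF finite_configs, of n "law n s" "ref_weight n s"] ref_weight_pos[OF n s]
      by (simp add: H_def law_def)
  qed
  \<comment> \<open>A large n is positive, so the quotient of extended reals is the real
    quotient.\<close>
  have ratio: "ereal a / ereal (?N n) = ereal (a / ?N n)" if "large n" for a n
    using that by (simp add: large_def)
  have T0: "0 \<in> {0..T}" using T by simp
  have "(\<lambda>n. ereal (H n 0 / ?N n)) \<longlonglongrightarrow> 0"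
    using init
  proof (rule Lim_transform_eventually)
    show "\<forall>\<^sub>F n in sequentially. rel_entropy (\<mu> n) (reference_measure \<theta> c n (\<rho> 0)) / ereal (?N n) = ereal (H n 0 / ?N n)"
      using eventually_large by eventually_elim (simp only: start[symmetric] entropy_eq[OF _ T0] ratio)
  qed
  then have H0: "(\<lambda>n. H n 0 / ?N n) \<longlonglongrightarrow> 0" by (simp add: zero_ereal_def)
  obtain e where e0: "(\<lambda>n. (\<Sum>z \<in> boundary_sites n. e n z) / ?N n) \<longlonglongrightarrow> 0"
    and e: "\<And>n t z. large n \<Longrightarrow> t \<in> {0..T} \<Longrightarrow> z \<in> boundary_sites n \<Longrightarrow>
      \<bar>drift n t z\<bar> / \<epsilon> \<le> e n z \<or>
      0 < (real n)\<^sup>2 * (c * real n powr (- \<theta>)) \<and>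
        (drift n t z)\<^sup>2 / ((real n)\<^sup>2 * (c * real n powr (- \<theta>)) * \<epsilon> ^ 4) \<le> e n z"
    using drift_boundary_error[OF d] by blast
  have growth: "H n t \<le> H n 0 + t * (interior_error n / \<epsilon> * ?N n + (\<Sum>z \<in> boundary_sites n. e n z) + quadratic_error \<l> n)"
    if n: "large n" "1 + 3 * C \<le> real n" and \<l>: "2 \<le> \<l>" for n \<l>
  proof -
    obtain K where K: "transition_function (configs n) K" "has_generator (configs n) K (scaled_generator n)"
      and flow: "\<And>s \<eta>. 0 \<le> s \<Longrightarrow> \<eta> \<in> configs n \<Longrightarrow> law n s \<eta> = finite_semigroup.flow (configs n) K (law n 0) s \<eta>"
      using markov_process_flow[OF mp[of n] finite_configs] unfolding law_def by blast
    have "finite_entropy (configs n) (finite_semigroup.flow (configs n) K (law n 0) t) (ref_weight n t) \<le>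
       H n 0 + t * (interior_error n / \<epsilon> * ?N n + (\<Sum>z \<in> boundary_sites n. e n z) + quadratic_error \<l> n)"
      unfolding H_def by (rule entropy_growth[OF n \<l> K _ _ e[OF n(1)] t]) (auto simp: law_sum, simp add: law_def)
    moreover have "H n t = finite_entropy (configs n) (finite_semigroup.flow (configs n) K (law n 0) t) (ref_weight n t)"
      unfolding H_def finite_entropy_def using t by (intro sum.cong) (auto simp: flow)
    ultimately show ?thesis by simp
  qed
  have "(\<lambda>n. H n t / ?N n) \<longlonglongrightarrow> 0"
  proof (rule tendsto_0_if_bounded)
    show "\<forall>\<^sub>F n in sequentially. 0 \<le> H n t / ?N n"
      using eventually_large
    proof eventually_elim
      case (elim n)
      have "0 \<le> H n t"
        unfolding H_def using t law_sum[of t n] ref_weight_sum[of n t] ref_weight_pos[OF elim t]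
        by (intro finite_entropy_nonneg finite_configs) (auto simp: law_def)
      then show ?case by simp
    qed
    fix \<l> :: nat assume \<l>: "2 \<le> \<l>"
    let ?b = "\<lambda>n. H n 0 / ?N n + t * (interior_error n / \<epsilon> + (\<Sum>z \<in> boundary_sites n. e n z) / ?N n + quadratic_error \<l> n / ?N n)"
    show "\<forall>\<^sub>F n in sequentially. H n t / ?N n \<le> ?b n"
      \<comment> \<open>The threshold secures L \<le> n for the value L = 1 + 3 C used in the
        quadratic bound.\<close>
      using eventually_large eventually_ge_at_top[of "nat \<lceil>1 + 3 * C\<rceil>"]
    proof eventually_elim
      case (elim n)
      have n: "1 + 3 * C \<le> real n" using elim(2) by linarith
      have N: "0 < ?N n" using elim(1) by (simp add: large_def)
      have "H n t / ?N n \<le> (H n 0 + t * (interior_error n / \<epsilon> * ?N n + (\<Sum>z \<in> boundary_sites n. e n z) + quadratic_error \<l> n)) / ?N n"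
        using N by (intro divide_right_mono growth elim(1) n \<l>) auto
      also have "\<dots> = ?b n" using N by (simp add: add_divide_distrib distrib_left)
      finally show ?case .
    qed
    \<comment> \<open>At fixed \<l> every error vanishes except the contribution of the diagonal
      correlations along the lines, of size 1 / (\<l> - 1).\<close>
    have "?b \<longlonglongrightarrow> 0 + t * (0 / \<epsilon> + 0 + real CARD('d) * ((1 + 3 * C)\<^sup>2 / \<epsilon> ^ 4) / real (\<l> - 1))"
      using \<epsilon> by (intro tendsto_intros H0 e0 quadratic_error_limit interior_error_limit) auto
    then show "?b \<longlonglongrightarrow> t * (real CARD('d) * ((1 + 3 * C)\<^sup>2 / \<epsilon> ^ 4)) / real (\<l> - 1)"
      by simp
  qed
  then have "(\<lambda>n. ereal (H n t / ?N n)) \<longlonglongrightarrow> 0" by (simp add: zero_ereal_def)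
  then show "(\<lambda>n. rel_entropy (distr (M n) (count_space (configs n)) (X n t))
      (reference_measure \<theta> c n (\<rho> t)) / ereal (?N n)) \<longlonglongrightarrow> 0"
  proof (rule Lim_transform_eventually)
    show "\<forall>\<^sub>F n in sequentially. ereal (H n t / ?N n) =
        rel_entropy (distr (M n) (count_space (configs n)) (X n t)) (reference_measure \<theta> c n (\<rho> t)) / ereal (?N n)"
      using eventually_large by eventually_elim (simp only: entropy_eq[OF _ t] ratio)
  qed
qed

end
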